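(* Let $G$ be a finite group, $k$ a field of characteristic dividing $|G|$, and $W$ a nonzero finite-dimensional $kG$-module. The class of virtually $W$-projective modules is a thick subcategory of the $W$-stable category.
   Context: Modules are finite-dimensional $kG$-modules, $\otimes=\otimes_k$ with diagonal $G$-action, and $W^*$ is the $k$-dual. A module is $W$-projective if it is a direct summand of $W^*\otimes Y$ for some module $Y$. The $W$-stable category has the objects of $\mathrm{mod}(kG)$, with morphism sets $\mathrm{Hom}_{kG}(M,N)$ modulo the homomorphisms factoring through a $W$-projective module. It is triangulated by Happel's theorem: the short exact sequences that split after applying $W\otimes -$ form an exact structure on $\mathrm{mod}(kG)$ with enough projectives and injectives, both classes being the $W$-projective modules; the shift $X[1]$ is the cokernel in a $W$-split short exact sequence $X\to I\to X[1]$ with $I$ $W$-projective, and the distinguished triangles are those isomorphic to triangles arising from $W$-split short exact sequences. The transfer map $\mathrm{Tr}_W:\mathrm{Ext}^n_{kG}(M\otimes W,N\otimes W)\to\mathrm{Ext}^n_{kG}(M,N)$ is the composite of the adjunction isomorphism $\mathrm{Ext}^n_{kG}(M\otimes W,N\otimes W)\cong\mathrm{Ext}^n_{kG}(M,N\otimes W\otimes W^* )$ with the map to $\mathrm{Ext}^n_{kG}(M,N)$ induced by $1_N$ tensored with the evaluation $W\otimes W^*\to k$. A module $X$ is virtually $W$-projective if for every module $Y$ the map $\mathrm{Tr}_W:\mathrm{Ext}_{kG}^n(X\otimes W,Y\otimes W)\to\mathrm{Ext}_{kG}^n(X,Y)$ is surjective for all $n$ sufficiently large (the bound on $n$ may depend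 on $Y$). A thick subcategory is a full triangulated subcategory closed under direct summands. *)

theory Defs
  imports "HOL-Algebra.Coset" "HOL-Computational_Algebra.Computational_Algebra"
    "Jordan_Normal_Form.Matrix_Kernel"
begin

section \<open>Finite-dimensional modules over a group algebra\<close>

text \<open>
  A finite-dimensional \<open>kG\<close>-module is given in coordinates, as the column space \<open>k\<^sup>n\<close>
  together with a matrix representation of \<open>G\<close>.  Only the values of \<^term>\<open>act M\<close> on the
  carrier of \<open>G\<close> matter.  Linear maps are matrices, and composition is the matrix product.
\<close>

datatype ('g, 'k) rep = Rep (deg: nat) (act: "'g \<Rightarrow> 'k mat")

definition is_rep :: "('g, 'b) monoid_scheme \<Rightarrow> ('g, 'k::field) rep \<Rightarrow> bool" where
  "is_rep G M \<longleftrightarrow>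
     (\<forall>g\<in>carrier G. act M g \<in> carrier_mat (deg M) (deg M)) \<and>
     act M \<one>\<^bsub>G\<^esub> = 1\<^sub>m (deg M) \<and>
     (\<forall>g\<in>carrier G. \<forall>h\<in>carrier G. act M (g \<otimes>\<^bsub>G\<^esub> h) = act M g * act M h)"

definition rep_hom ::
  "('g, 'b) monoid_scheme \<Rightarrow> ('g, 'k::field) rep \<Rightarrow> ('g, 'k) rep \<Rightarrow> 'k mat set" where
  "rep_hom G M N =
     {f \<in> carrier_mat (deg N) (deg M). \<forall>g\<in>carrier G. f * act M g = act N g * f}"

definition rep_iso ::
  "('g, 'b) monoid_scheme \<Rightarrow> ('g, 'k::field) rep \<Rightarrow> ('g, 'k) rep \<Rightarrow> bool" where
  "rep_iso G M N \<longleftrightarrow>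
     (\<exists>f\<in>rep_hom G M N. \<exists>g\<in>rep_hom G N M. g * f = 1\<^sub>m (deg M) \<and> f * g = 1\<^sub>m (deg N))"

definition mat_image :: "'k::field mat \<Rightarrow> 'k vec set" where
  "mat_image f = (\<lambda>v. f *\<^sub>v v) ` carrier_vec (dim_col f)"

definition rep_surj :: "('g, 'b) monoid_scheme \<Rightarrow> ('g, 'k::field) rep \<Rightarrow> ('g, 'k) rep \<Rightarrow> 'k mat \<Rightarrow> bool"
  where "rep_surj G M N f \<longleftrightarrow> f \<in> rep_hom G M N \<and> mat_image f = carrier_vec (deg N)"

definition short_exact ::
  "('g, 'b) monoid_scheme \<Rightarrow> ('g, 'k::field) rep \<Rightarrow> ('g, 'k) rep \<Rightarrow> ('g, 'k) rep
     \<Rightarrow> 'k mat \<Rightarrow> 'k mat \<Rightarrow> bool" where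
  "short_exact G X Y Z f g \<longleftrightarrow>
     is_rep G X \<and> is_rep G Y \<and> is_rep G Z \<and> f \<in> rep_hom G X Y \<and> rep_surj G Y Z g \<and>
     mat_kernel f = {0\<^sub>v (deg X)} \<and> mat_image f = mat_kernel g"

definition rep_sum :: "('g, 'k::field) rep \<Rightarrow> ('g, 'k) rep \<Rightarrow> ('g, 'k) rep" where
  "rep_sum M N = Rep (deg M + deg N)
     (\<lambda>g. four_block_mat (act M g) (0\<^sub>m (deg M) (deg N)) (0\<^sub>m (deg N) (deg M)) (act N g))"

definition rep_summand ::
  "('g, 'b) monoid_scheme \<Rightarrow> ('g, 'k::field) rep \<Rightarrow> ('g, 'k) rep \<Rightarrow> bool" where
  "rep_summand G M N \<longleftrightarrow> (\<exists>M'. is_rep G M' \<and> rep_iso G N (rep_sum M M'))"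

text \<open>
  The Kronecker product is the matrix of \<open>f \<otimes> g\<close> in the bases \<open>e\<^sub>i \<otimes> e\<^sub>j\<close>, where \<open>e\<^sub>i \<otimes> e\<^sub>j\<close> has
  index \<open>i * n + j\<close> (\<open>n\<close> the dimension of the second factor).  With this indexing tensor products
  are strictly associative, so the associativity isomorphisms are identity matrices.
\<close>

definition kron :: "'k::field mat \<Rightarrow> 'k mat \<Rightarrow> 'k mat" where
  "kron A B = mat (dim_row A * dim_row B) (dim_col A * dim_col B)
     (\<lambda>(i, j). A $$ (i div dim_row B, j div dim_col B) * B $$ (i mod dim_row B, j mod dim_col B))"

definition tensor :: "('g, 'k::field) rep \<Rightarrow> ('g, 'k) rep \<Rightarrow> ('g, 'k) rep" where
  "tensor M N = Rep (deg M * deg N) (\<lambda>g. kron (act M g) (act N g))"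

text \<open>The \<open>k\<close>-dual, in the dual basis.\<close>

definition dual :: "('g, 'b) monoid_scheme \<Rightarrow> ('g, 'k::field) rep \<Rightarrow> ('g, 'k) rep" where
  "dual G M = Rep (deg M) (\<lambda>g. transpose_mat (act M (inv\<^bsub>G\<^esub> g)))"

text \<open>
  For \<open>W\<close> of dimension \<open>n\<close>: the evaluation \<open>W \<otimes> W\<^sup>* \<rightarrow> k\<close>, \<open>w \<otimes> \<phi> \<mapsto> \<phi> w\<close>, and the coevaluation
  \<open>k \<rightarrow> W \<otimes> W\<^sup>*\<close>, \<open>1 \<mapsto> \<Sum>\<^sub>i e\<^sub>i \<otimes> e\<^sub>i\<^sup>*\<close>.
\<close>

definition evaluation :: "nat \<Rightarrow> 'k::field mat" where
  "evaluation n = mat 1 (n * n) (\<lambda>(_, j). if j div n = j mod n then 1 else 0)"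

definition coevaluation :: "nat \<Rightarrow> 'k::field mat" where
  "coevaluation n = mat (n * n) 1 (\<lambda>(i, _). if i div n = i mod n then 1 else 0)"

text \<open>The adjunction \<open>Hom(M \<otimes> W, N) \<cong> Hom(M, N \<otimes> W\<^sup>*)\<close>, sending \<open>f\<close> to the composite
  \<open>M \<rightarrow> M \<otimes> W \<otimes> W\<^sup>* \<rightarrow> N \<otimes> W\<^sup>*\<close>.\<close>

definition hom_adj :: "('g, 'k::field) rep \<Rightarrow> ('g, 'k) rep \<Rightarrow> 'k mat \<Rightarrow> 'k mat" where
  "hom_adj W M f = kron f (1\<^sub>m (deg W)) * kron (1\<^sub>m (deg M)) (coevaluation (deg W))"


section \<open>Ext and the transfer map\<close>

definition rep_projective :: "('g, 'b) monoid_scheme \<Rightarrow> ('g, 'k::field) rep \<Rightarrow> bool" where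
  "rep_projective G P \<longleftrightarrow> is_rep G P \<and>
     (\<forall>M N f g. is_rep G M \<longrightarrow> is_rep G N \<longrightarrow> rep_surj G M N f \<longrightarrow> g \<in> rep_hom G P N \<longrightarrow>
        (\<exists>h\<in>rep_hom G P M. f * h = g))"

text \<open>Complexes \<open>\<dots> \<rightarrow> P\<^sub>1 \<rightarrow> P\<^sub>0\<close> with an augmentation out of \<open>P\<^sub>0\<close>; the differential
  \<^term>\<open>bd P n\<close> goes from \<^term>\<open>ob P (Suc n)\<close> to \<^term>\<open>ob P n\<close>.\<close>

datatype ('g, 'k) aug_complex =
  Aug_Complex (ob: "nat \<Rightarrow> ('g, 'k) rep") (bd: "nat \<Rightarrow> 'k mat") (aug: "'k mat")

definition proj_resolution ::
  "('g, 'b) monoid_scheme \<Rightarrow> ('g, 'k::field) rep \<Rightarrow> ('g, 'k) aug_complex \<Rightarrow> bool" where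
  "proj_resolution G M P \<longleftrightarrow>
     (\<forall>n. rep_projective G (ob P n)) \<and>
     (\<forall>n. bd P n \<in> rep_hom G (ob P (Suc n)) (ob P n)) \<and>
     rep_surj G (ob P 0) M (aug P) \<and>
     mat_image (bd P 0) = mat_kernel (aug P) \<and>
     (\<forall>n. mat_image (bd P (Suc n)) = mat_kernel (bd P n))"

definition resolution ::
  "('g, 'b) monoid_scheme \<Rightarrow> ('g, 'k::field) rep \<Rightarrow> ('g, 'k) aug_complex" where
  "resolution G M = (SOME P. proj_resolution G M P)"

definition cocycles ::
  "('g, 'b) monoid_scheme \<Rightarrow> nat \<Rightarrow> ('g, 'k::field) rep \<Rightarrow> ('g, 'k) rep \<Rightarrow> 'k mat set" where
  "cocycles G n M N = (let P = resolution G M in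
     {f \<in> rep_hom G (ob P n) N. f * bd P n = 0\<^sub>m (deg N) (deg (ob P (Suc n)))})"

definition coboundaries ::
  "('g, 'b) monoid_scheme \<Rightarrow> nat \<Rightarrow> ('g, 'k::field) rep \<Rightarrow> ('g, 'k) rep \<Rightarrow> 'k mat set" where
  "coboundaries G n M N = (let P = resolution G M in
     case n of 0 \<Rightarrow> {0\<^sub>m (deg N) (deg (ob P 0))}
     | Suc m \<Rightarrow> {h * bd P m |h. h \<in> rep_hom G (ob P m) N})"

definition ext_rel ::
  "('g, 'b) monoid_scheme \<Rightarrow> nat \<Rightarrow> ('g, 'k::field) rep \<Rightarrow> ('g, 'k) rep \<Rightarrow> 'k mat rel" where
  "ext_rel G n M N =
     {(f, g). f \<in> cocycles G n M N \<and> g \<in> cocycles G n M N \<and> f - g \<in> coboundaries G n M N}"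

definition Ext ::
  "('g, 'b) monoid_scheme \<Rightarrow> nat \<Rightarrow> ('g, 'k::field) rep \<Rightarrow> ('g, 'k) rep \<Rightarrow> 'k mat set set" where
  "Ext G n M N = cocycles G n M N // ext_rel G n M N"

definition ext_class ::
  "('g, 'b) monoid_scheme \<Rightarrow> nat \<Rightarrow> ('g, 'k::field) rep \<Rightarrow> ('g, 'k) rep \<Rightarrow> 'k mat \<Rightarrow> 'k mat set" where
  "ext_class G n M N f = ext_rel G n M N `` {f}"

text \<open>The map \<open>Ext\<^sup>n(M, N) \<rightarrow> Ext\<^sup>n(M, N')\<close> induced by \<open>u : N \<rightarrow> N'\<close>.\<close>

definition ext_map ::
  "('g, 'b) monoid_scheme \<Rightarrow> nat \<Rightarrow> ('g, 'k::field) rep \<Rightarrow> ('g, 'k) rep \<Rightarrow> 'k mat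
     \<Rightarrow> 'k mat set \<Rightarrow> 'k mat set" where
  "ext_map G n M N' u c = (\<Union>f\<in>c. ext_class G n M N' (u * f))"

text \<open>
  If \<open>P\<close> is the chosen resolution of \<open>M\<close>, then \<open>P \<otimes> W\<close> is a projective resolution of \<open>M \<otimes> W\<close>.
  A comparison is a chain map over the identity of \<open>M \<otimes> W\<close> from it to the chosen resolution of
  \<open>M \<otimes> W\<close>; it is unique up to homotopy.  The adjunction isomorphism
  \<open>Ext\<^sup>n(M \<otimes> W, N) \<cong> Ext\<^sup>n(M, N \<otimes> W\<^sup>*)\<close> pulls a cocycle back along it and then applies the adjunction
  for homomorphisms.
\<close>

definition is_comparison ::
  "('g, 'b) monoid_scheme \<Rightarrow> ('g, 'k::field) rep \<Rightarrow> ('g, 'k) rep \<Rightarrow> (nat \<Rightarrow> 'k mat) \<Rightarrow> bool" where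
  "is_comparison G W M \<phi> \<longleftrightarrow>
     (let P = resolution G M; Q = resolution G (tensor M W); I = 1\<^sub>m (deg W) in
       (\<forall>n. \<phi> n \<in> rep_hom G (tensor (ob P n) W) (ob Q n)) \<and>
       aug Q * \<phi> 0 = kron (aug P) I \<and>
       (\<forall>n. bd Q n * \<phi> (Suc n) = \<phi> n * kron (bd P n) I))"

definition comparison ::
  "('g, 'b) monoid_scheme \<Rightarrow> ('g, 'k::field) rep \<Rightarrow> ('g, 'k) rep \<Rightarrow> nat \<Rightarrow> 'k mat" where
  "comparison G W M = (SOME \<phi>. is_comparison G W M \<phi>)"

definition ext_adj ::
  "('g, 'b) monoid_scheme \<Rightarrow> ('g, 'k::field) rep \<Rightarrow> nat \<Rightarrow> ('g, 'k) rep \<Rightarrow> ('g, 'k) rep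
     \<Rightarrow> 'k mat set \<Rightarrow> 'k mat set" where
  "ext_adj G W n M N c =
     (\<Union>f\<in>c. ext_class G n M (tensor N (dual G W))
        (hom_adj W (ob (resolution G M) n) (f * comparison G W M n)))"

text \<open>\<open>Tr\<^sub>W : Ext\<^sup>n(M \<otimes> W, N \<otimes> W) \<cong> Ext\<^sup>n(M, N \<otimes> W \<otimes> W\<^sup>*) \<rightarrow> Ext\<^sup>n(M, N)\<close>, where \<open>N \<otimes> k\<close> is \<open>N\<close>
  on the nose.\<close>

definition transfer ::
  "('g, 'b) monoid_scheme \<Rightarrow> ('g, 'k::field) rep \<Rightarrow> nat \<Rightarrow> ('g, 'k) rep \<Rightarrow> ('g, 'k) rep
     \<Rightarrow> 'k mat set \<Rightarrow> 'k mat set" where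
  "transfer G W n M N =
     ext_map G n M N (kron (1\<^sub>m (deg N)) (evaluation (deg W))) \<circ> ext_adj G W n M (tensor N W)"

definition virtually_projective ::
  "('g, 'b) monoid_scheme \<Rightarrow> ('g, 'k::field) rep \<Rightarrow> ('g, 'k) rep \<Rightarrow> bool" where
  "virtually_projective G W X \<longleftrightarrow> is_rep G X \<and>
     (\<forall>Y. is_rep G Y \<longrightarrow>
        (\<exists>n\<^sub>0. \<forall>n\<ge>n\<^sub>0. transfer G W n X Y ` Ext G n (tensor X W) (tensor Y W) = Ext G n X Y))"


section \<open>Additive categories with shift and triangles\<close>

text \<open>Composition \<^term>\<open>Comp C X Y Z v u\<close> is \<open>v \<circ> u : X \<rightarrow> Y \<rightarrow> Z\<close>.\<close>

record ('o, 'm) shift_cat =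
  Obj :: "'o set"
  Hom :: "'o \<Rightarrow> 'o \<Rightarrow> 'm set"
  Comp :: "'o \<Rightarrow> 'o \<Rightarrow> 'o \<Rightarrow> 'm \<Rightarrow> 'm \<Rightarrow> 'm"
  Ident :: "'o \<Rightarrow> 'm"
  Add :: "'o \<Rightarrow> 'o \<Rightarrow> 'm \<Rightarrow> 'm \<Rightarrow> 'm"
  Zero :: "'o \<Rightarrow> 'o \<Rightarrow> 'm"
  Shift :: "'o \<Rightarrow> 'o"
  ShiftMor :: "'o \<Rightarrow> 'o \<Rightarrow> 'm \<Rightarrow> 'm"

text \<open>A triangle \<open>X \<rightarrow>\<^sup>u Y \<rightarrow>\<^sup>v Z \<rightarrow>\<^sup>w X[1]\<close>.\<close>

datatype ('o, 'm) triangle = Triangle 'o 'o 'o 'm 'm 'm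

record ('o, 'm) triangulated_cat = "('o, 'm) shift_cat" +
  Distinguished :: "('o, 'm) triangle set"

definition inverse_mors ::
  "('o, 'm, 'z) shift_cat_scheme \<Rightarrow> 'o \<Rightarrow> 'o \<Rightarrow> 'm \<Rightarrow> 'm \<Rightarrow> bool" where
  "inverse_mors C X Y u v \<longleftrightarrow> u \<in> Hom C X Y \<and> v \<in> Hom C Y X \<and>
     Comp C X Y X v u = Ident C X \<and> Comp C Y X Y u v = Ident C Y"

definition is_iso :: "('o, 'm, 'z) shift_cat_scheme \<Rightarrow> 'o \<Rightarrow> 'o \<Rightarrow> 'm \<Rightarrow> bool" where
  "is_iso C X Y u \<longleftrightarrow> (\<exists>v. inverse_mors C X Y u v)"

fun triangle_iso ::
  "('o, 'm, 'z) shift_cat_scheme \<Rightarrow> ('o, 'm) triangle \<Rightarrow> ('o, 'm) triangle \<Rightarrow> bool" where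
  "triangle_iso C (Triangle X Y Z u v w) (Triangle X' Y' Z' u' v' w') \<longleftrightarrow>
     (\<exists>a b c. is_iso C X X' a \<and> is_iso C Y Y' b \<and> is_iso C Z Z' c \<and>
        Comp C X Y Y' b u = Comp C X X' Y' u' a \<and>
        Comp C Y Z Z' c v = Comp C Y Y' Z' v' b \<and>
        Comp C Z (Shift C X) (Shift C X') (ShiftMor C X X' a) w =
          Comp C Z Z' (Shift C X') w' c)"

fun is_triangle :: "('o, 'm, 'z) shift_cat_scheme \<Rightarrow> ('o, 'm) triangle \<Rightarrow> bool" where
  "is_triangle C (Triangle X Y Z u v w) \<longleftrightarrow>
     X \<in> Obj C \<and> Y \<in> Obj C \<and> Z \<in> Obj C \<and>
     u \<in> Hom C X Y \<and> v \<in> Hom C Y Z \<and> w \<in> Hom C Z (Shift C X)"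

text \<open>\<open>A\<close> is a direct summand of \<open>X\<close>: \<open>X\<close> is a biproduct of \<open>A\<close> and some object \<open>B\<close>.\<close>

definition direct_summand :: "('o, 'm, 'z) shift_cat_scheme \<Rightarrow> 'o \<Rightarrow> 'o \<Rightarrow> bool" where
  "direct_summand C A X \<longleftrightarrow>
     (\<exists>B\<in>Obj C. \<exists>i\<in>Hom C A X. \<exists>p\<in>Hom C X A. \<exists>j\<in>Hom C B X. \<exists>q\<in>Hom C X B.
        Comp C A X A p i = Ident C A \<and> Comp C B X B q j = Ident C B \<and>
        Comp C B X A p j = Zero C B A \<and> Comp C A X B q i = Zero C A B \<and>
        Add C X X (Comp C X A X i p) (Comp C X B X j q) = Ident C X)"

text \<open>
  A full subcategory is given by its class \<open>S\<close> of objects.  Since \<open>S\<close> is closed under isomorphism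
  and every object is isomorphic to a shift, the equivalence in the second clause of
  \<open>triangulated_subcategory\<close> is closure under both \<open>[1]\<close> and \<open>[-1]\<close>.
\<close>

definition triangulated_subcategory ::
  "('o, 'm) triangulated_cat \<Rightarrow> 'o set \<Rightarrow> bool" where
  "triangulated_subcategory C S \<longleftrightarrow>
     S \<subseteq> Obj C \<and> (\<exists>X\<in>S. Ident C X = Zero C X X) \<and>
     (\<forall>X\<in>Obj C. X \<in> S \<longleftrightarrow> Shift C X \<in> S) \<and>
     (\<forall>X\<in>S. \<forall>Y\<in>Obj C. (\<exists>u. is_iso C X Y u) \<longrightarrow> Y \<in> S) \<and>
     (\<forall>X Y Z u v w. Triangle X Y Z u v w \<in> Distinguished C \<longrightarrow>
        (X \<in> S \<and> Y \<in> S \<longrightarrow> Z \<in> S) \<and> (Y \<in> S \<and> Z \<in> S \<longrightarrow> X \<in> S) \<and> (X \<in> S \<and> Z \<in> S \<longrightarrow> Y \<in> S))"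

definition thick_subcategory :: "('o, 'm) triangulated_cat \<Rightarrow> 'o set \<Rightarrow> bool" where
  "thick_subcategory C S \<longleftrightarrow> triangulated_subcategory C S \<and>
     (\<forall>X\<in>S. \<forall>A\<in>Obj C. direct_summand C A X \<longrightarrow> A \<in> S)"


section \<open>The relative stable category\<close>

definition rel_projective ::
  "('g, 'b) monoid_scheme \<Rightarrow> ('g, 'k::field) rep \<Rightarrow> ('g, 'k) rep \<Rightarrow> bool" where
  "rel_projective G W M \<longleftrightarrow> is_rep G M \<and>
     (\<exists>Y. is_rep G Y \<and> rep_summand G M (tensor (dual G W) Y))"

definition rel_split ::
  "('g, 'b) monoid_scheme \<Rightarrow> ('g, 'k::field) rep \<Rightarrow> ('g, 'k) rep \<Rightarrow> ('g, 'k) rep \<Rightarrow> ('g, 'k) rep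
     \<Rightarrow> 'k mat \<Rightarrow> 'k mat \<Rightarrow> bool" where
  "rel_split G W X Y Z f g \<longleftrightarrow> short_exact G X Y Z f g \<and>
     (\<exists>s\<in>rep_hom G (tensor W Z) (tensor W Y). kron (1\<^sub>m (deg W)) g * s = 1\<^sub>m (deg W * deg Z))"

definition null_homs ::
  "('g, 'b) monoid_scheme \<Rightarrow> ('g, 'k::field) rep \<Rightarrow> ('g, 'k) rep \<Rightarrow> ('g, 'k) rep \<Rightarrow> 'k mat set" where
  "null_homs G W M N =
     {b * a |a b Q. rel_projective G W Q \<and> a \<in> rep_hom G M Q \<and> b \<in> rep_hom G Q N}"

definition stable_rel ::
  "('g, 'b) monoid_scheme \<Rightarrow> ('g, 'k::field) rep \<Rightarrow> ('g, 'k) rep \<Rightarrow> ('g, 'k) rep \<Rightarrow> 'k mat rel" where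
  "stable_rel G W M N =
     {(f, g). f \<in> rep_hom G M N \<and> g \<in> rep_hom G M N \<and> f - g \<in> null_homs G W M N}"

definition stable_class ::
  "('g, 'b) monoid_scheme \<Rightarrow> ('g, 'k::field) rep \<Rightarrow> ('g, 'k) rep \<Rightarrow> ('g, 'k) rep
     \<Rightarrow> 'k mat \<Rightarrow> 'k mat set" where
  "stable_class G W M N f = stable_rel G W M N `` {f}"

text \<open>
  For every \<open>X\<close> a \<open>W\<close>-split short exact sequence \<open>X \<rightarrow>\<^sup>i I \<rightarrow>\<^sup>p X[1]\<close> with \<open>W\<close>-projective \<open>I\<close> is chosen;
  the shift of a morphism is induced by extending a representative to a morphism between these
  sequences.
\<close>

datatype ('g, 'k) susp_seq =
  Susp_Seq (susp_mid: "('g, 'k) rep") (susp_end: "('g, 'k) rep") (susp_inj: "'k mat") (susp_prj: "'k mat")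

definition suspension ::
  "('g, 'b) monoid_scheme \<Rightarrow> ('g, 'k::field) rep \<Rightarrow> ('g, 'k) rep \<Rightarrow> ('g, 'k) susp_seq" where
  "suspension G W X = (SOME s. rel_projective G W (susp_mid s) \<and>
     rel_split G W X (susp_mid s) (susp_end s) (susp_inj s) (susp_prj s))"

definition stable_shift_mor ::
  "('g, 'b) monoid_scheme \<Rightarrow> ('g, 'k::field) rep \<Rightarrow> ('g, 'k) rep \<Rightarrow> ('g, 'k) rep
     \<Rightarrow> 'k mat set \<Rightarrow> 'k mat set" where
  "stable_shift_mor G W X Y u = (let s = suspension G W X; t = suspension G W Y in
     \<Union>{stable_class G W (susp_end s) (susp_end t) g |f g h.
         f \<in> u \<and> h \<in> rep_hom G (susp_mid s) (susp_mid t) \<and> g \<in> rep_hom G (susp_end s) (susp_end t) \<and>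
         h * susp_inj s = susp_inj t * f \<and> g * susp_prj s = susp_prj t * h})"

definition stable_shift_cat ::
  "('g, 'b) monoid_scheme \<Rightarrow> ('g, 'k::field) rep \<Rightarrow> (('g, 'k) rep, 'k mat set) shift_cat" where
  "stable_shift_cat G W = \<lparr>
     Obj = {M. is_rep G M},
     Hom = (\<lambda>M N. rep_hom G M N // stable_rel G W M N),
     Comp = (\<lambda>L M N v u. \<Union>g\<in>v. \<Union>f\<in>u. stable_class G W L N (g * f)),
     Ident = (\<lambda>M. stable_class G W M M (1\<^sub>m (deg M))),
     Add = (\<lambda>M N u v. \<Union>f\<in>u. \<Union>g\<in>v. stable_class G W M N (f + g)),
     Zero = (\<lambda>M N. stable_class G W M N (0\<^sub>m (deg N) (deg M))),
     Shift = (\<lambda>M. susp_end (suspension G W M)),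
     ShiftMor = stable_shift_mor G W\<rparr>"

text \<open>
  The triangle of a \<open>W\<close>-split sequence \<open>X \<rightarrow>\<^sup>f Y \<rightarrow>\<^sup>g Z\<close>: the identity of \<open>X\<close> extends to a morphism
  \<open>(1, a, b)\<close> to the chosen sequence \<open>X \<rightarrow> I \<rightarrow> X[1]\<close>, and the connecting morphism is \<open>-b\<close>.  With
  this sign (Happel's) the triangle is isomorphic to the pushout triangle of \<open>f\<close>.
\<close>

definition standard_triangles ::
  "('g, 'b) monoid_scheme \<Rightarrow> ('g, 'k::field) rep \<Rightarrow> (('g, 'k) rep, 'k mat set) triangle set" where
  "standard_triangles G W =
     {Triangle X Y Z (stable_class G W X Y f) (stable_class G W Y Z g)
        (stable_class G W Z (susp_end (suspension G W X)) (- b)) |X Y Z f g a b.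
        rel_split G W X Y Z f g \<and>
        a \<in> rep_hom G Y (susp_mid (suspension G W X)) \<and>
        b \<in> rep_hom G Z (susp_end (suspension G W X)) \<and>
        a * f = susp_inj (suspension G W X) \<and>
        b * g = susp_prj (suspension G W X) * a}"

definition stable_cat ::
  "('g, 'b) monoid_scheme \<Rightarrow> ('g, 'k::field) rep
     \<Rightarrow> (('g, 'k) rep, 'k mat set) triangulated_cat" where
  "stable_cat G W = shift_cat.extend (stable_shift_cat G W)
     (triangulated_cat.fields
       {t. is_triangle (stable_shift_cat G W) t \<and>
           (\<exists>t'\<in>standard_triangles G W. triangle_iso (stable_shift_cat G W) t t')})"

end

theory Submission
  imports Defs
begin

text \<open>
  Write \<open>I\<close> for the augmentation ideal of \<open>kG\<close> and \<open>\<Omega>\<^sup>n X = I \<otimes> \<dots> \<otimes> I \<otimes> X\<close> (\<open>n\<close> factors \<open>I\<close>).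
  Tensoring \<open>0 \<rightarrow> I \<rightarrow> kG \<rightarrow> k \<rightarrow> 0\<close> with \<open>\<Omega>\<^sup>n X\<close> and splicing gives a projective resolution of \<open>X\<close>
  with terms \<open>kG \<otimes> \<Omega>\<^sup>n X\<close> and syzygies \<open>\<Omega>\<^sup>n X\<close>.  The point of this resolution is that every \<open>\<Omega>\<^sup>n\<close> is
  an honest exact functor, namely tensoring with a fixed module.

  In degree zero the transfer is the trace \<open>Hom(M \<otimes> W, N \<otimes> W) \<rightarrow> Hom(M, N)\<close> over \<open>W\<close>, and the
  equivariant maps that are traces are exactly those factoring through a \<open>W\<close>-projective module
  (\<open>null_homs_eq_traces\<close>).  Comparing resolutions shows that for \<open>n \<ge> 1\<close> the transfer
  \<open>Ext\<^sup>n(X \<otimes> W, Y \<otimes> W) \<rightarrow> Ext\<^sup>n(X, Y)\<close> is onto if and only if every equivariant map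
  \<open>\<Omega>\<^sup>n X \<rightarrow> Y\<close> is a trace: cocycles are maps out of the syzygy, and coboundaries factor through a
  projective module, hence are traces.  So \<open>X\<close> is virtually \<open>W\<close>-projective if and only if for every \<open>Y\<close>
  all maps \<open>\<Omega>\<^sup>n X \<rightarrow> Y\<close> vanish in the \<open>W\<close>-stable category for large \<open>n\<close>
  (\<open>virtually_projective_iff\<close>).

  This condition visibly passes to retracts in the \<open>W\<close>-stable category, which gives closure under
  isomorphism and direct summands.  Tensoring with a module preserves \<open>W\<close>-split sequences, so for
  two out of three it suffices to treat a \<open>W\<close>-split sequence \<open>X \<rightarrow> Y \<rightarrow> Z\<close> and maps into a fixed
  module \<open>B\<close>.  The middle term is handled by extending a trace along \<open>X \<rightarrow> Y\<close>.  The outer terms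
  use \<open>K \<rightarrow> B \<otimes> W \<otimes> W\<^sup>* \<rightarrow> B\<close> and \<open>B \<rightarrow> B \<otimes> W \<otimes> W\<^sup>* \<rightarrow> C\<close>: vanishing of the maps into \<open>K\<close>, respectively \<open>C\<close>,
  replaces the connecting maps of the long exact sequences (\<open>vanishing_middle\<close>, \<open>vanishing_right\<close>,
  \<open>vanishing_left\<close>).  Closure under the shift is the case of a \<open>W\<close>-projective middle term.
\<close>

section \<open>Matrices and Kronecker products\<close>

lemma kron_dim [simp]:
  "dim_row (kron A B) = dim_row A * dim_row B" "dim_col (kron A B) = dim_col A * dim_col B"
  by (simp_all add: kron_def)

lemma kron_index:
  "i < dim_row A * dim_row B \<Longrightarrow> j < dim_col A * dim_col B \<Longrightarrow>
   kron A B $$ (i, j) = A $$ (i div dim_row B, j div dim_col B) * B $$ (i mod dim_row B, j mod dim_col B)"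
  by (simp add: kron_def)

lemma divmod_less:
  assumes "i < m * (n::nat)"
  shows "i div n < m" "i mod n < n"
proof -
  from assms have "0 < n" by (cases n) auto
  with assms show "i div n < m" "i mod n < n" by (auto simp: less_mult_imp_div_less)
qed

lemma sum_divmod:
  "(\<Sum>k<m * n. F (k div n) (k mod n)) = (\<Sum>i<m. \<Sum>j<(n::nat). F i j)"
proof (induction m)
  case (Suc m)
  have "(\<Sum>k<Suc m * n. F (k div n) (k mod n)) =
      (\<Sum>k<m * n. F (k div n) (k mod n)) + (\<Sum>k=m * n..<m * n + n. F (k div n) (k mod n))"
    by (subst sum.union_disjoint [symmetric]) (auto intro!: sum.cong simp: add.commute)
  also have "(\<Sum>k=m * n..<m * n + n. F (k div n) (k mod n)) =
      (\<Sum>j<n. F ((m * n + j) div n) ((m * n + j) mod n))"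
    by (rule sum.reindex_bij_witness [of _ "\<lambda>j. m * n + j" "\<lambda>k. k - m * n"]) auto
  also have "\<dots> = (\<Sum>j<n. F m j)"
    by (intro sum.cong) auto
  finally show ?case using Suc by simp
qed simp

lemma mult_index:
  "i < dim_row A \<Longrightarrow> j < dim_col B \<Longrightarrow> dim_col A = dim_row B \<Longrightarrow>
   (A * B) $$ (i, j) = (\<Sum>k<dim_row B. A $$ (i, k) * B $$ (k, j))"
  by (simp add: scalar_prod_def atLeast0LessThan)

lemma kron_mult:
  fixes A :: "'k::field mat"
  assumes "dim_col A = dim_row C" "dim_col B = dim_row D"
  shows "kron A B * kron C D = kron (A * C) (B * D)"
proof (rule eq_matI, goal_cases)
  case (1 i j)
  then have i: "i < dim_row A * dim_row B" and j: "j < dim_col C * dim_col D" by auto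
  let ?F = "\<lambda>a b. A $$ (i div dim_row B, a) * B $$ (i mod dim_row B, b) *
     (C $$ (a, j div dim_col D) * D $$ (b, j mod dim_col D))"
  have "(kron A B * kron C D) $$ (i, j) =
      (\<Sum>k<dim_row C * dim_row D. ?F (k div dim_row D) (k mod dim_row D))"
    using i j assms by (subst mult_index) (auto intro!: sum.cong simp: kron_index)
  also have "\<dots> = (\<Sum>a<dim_row C. \<Sum>b<dim_row D. ?F a b)"
    by (rule sum_divmod)
  also have "\<dots> = (\<Sum>a<dim_row C. A $$ (i div dim_row B, a) * C $$ (a, j div dim_col D)) *
      (\<Sum>b<dim_row D. B $$ (i mod dim_row B, b) * D $$ (b, j mod dim_col D))"
    by (simp add: sum_product mult_ac)
  also have "\<dots> = kron (A * C) (B * D) $$ (i, j)"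
    using i j divmod_less [OF i] divmod_less [OF j] assms
    by (simp add: kron_index mult_index del: index_mult_mat(1))
  finally show ?case .
qed auto

lemma kron_one [simp]: "kron (1\<^sub>m m) (1\<^sub>m n) = (1\<^sub>m (m * n) :: 'k::field mat)"
proof (rule eq_matI, goal_cases)
  case (1 i j)
  then have i: "i < m * n" and j: "j < m * n" by auto
  have "i = j \<longleftrightarrow> i div n = j div n \<and> i mod n = j mod n"
    by (metis div_mult_mod_eq)
  then show ?case using i j divmod_less [OF i] divmod_less [OF j] by (auto simp: kron_index)
qed auto

lemma divmod_mult:
  "x mod (m * n) div n = x div n mod (m::nat)" "x mod (m * n) mod n = x mod n"
proof -
  show "x mod (m * n) div n = x div n mod m"
  proof (cases "n = 0")
    case False
    have "x mod (m * n) = n * (x div n mod m) + x mod n"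
      by (simp add: mult.commute [of m] mod_mult2_eq)
    with False show ?thesis by simp
  qed simp
  show "x mod (m * n) mod n = x mod n"
    by (simp add: mod_mod_cancel)
qed

lemma kron_assoc: "kron (kron A B) C = kron A (kron B (C :: 'k::field mat))"
proof (rule eq_matI, goal_cases)
  case (1 i j)
  have *: "(x div n) mod m = (x mod (m * n)) div n" "(x mod (m * n)) mod n = x mod n"
    "x div n div m = x div (m * n)" for x m n :: nat
    by (simp_all only: divmod_mult) (metis div_mult2_eq mult.commute)
  from 1 have i: "i < dim_row A * dim_row B * dim_row C" "i < dim_row A * (dim_row B * dim_row C)"
    and j: "j < dim_col A * dim_col B * dim_col C" "j < dim_col A * (dim_col B * dim_col C)"
    by (auto simp: mult.assoc)
  show ?case
    using divmod_less(1) [OF i(1)] divmod_less(1) [OF j(1)] i j divmod_less(2) [OF i(2)] divmod_less(2) [OF j(2)]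
    by (simp add: kron_index * mult.assoc)
qed (auto simp: mult.assoc)

lemma kron_one_left [simp]: "kron (1\<^sub>m (Suc 0)) A = (A :: 'k::field mat)"
  by (rule eq_matI) (auto simp: kron_index)

lemma kron_one_right [simp]: "kron A (1\<^sub>m (Suc 0)) = (A :: 'k::field mat)"
  by (rule eq_matI) (auto simp: kron_index)

lemma kron_add_left:
  fixes A :: "'k::field mat"
  assumes "dim_row A = dim_row B" "dim_col A = dim_col B"
  shows "kron (A + B) C = kron A C + kron B C"
  by (rule eq_matI) (use assms in \<open>auto simp: kron_index divmod_less distrib_right\<close>)

lemma kron_add_right:
  fixes A :: "'k::field mat"
  assumes "dim_row A = dim_row B" "dim_col A = dim_col B"
  shows "kron C (A + B) = kron C A + kron C B"
  by (rule eq_matI) (use assms in \<open>auto simp: kron_index divmod_less distrib_left\<close>)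

lemma kron_minus_left:
  fixes A :: "'k::field mat"
  assumes "dim_row A = dim_row B" "dim_col A = dim_col B"
  shows "kron (A - B) C = kron A C - kron B C"
  by (rule eq_matI) (use assms in \<open>auto simp: kron_index divmod_less left_diff_distrib\<close>)

lemma kron_minus_right:
  fixes A :: "'k::field mat"
  assumes "dim_row A = dim_row B" "dim_col A = dim_col B"
  shows "kron C (A - B) = kron C A - kron C B"
  by (rule eq_matI) (use assms in \<open>auto simp: kron_index divmod_less right_diff_distrib\<close>)

lemma kron_zero_left [simp]: "kron (0\<^sub>m a b) A = 0\<^sub>m (a * dim_row A) (b * dim_col (A :: 'k::field mat))"
  by (rule eq_matI) (auto simp: kron_index divmod_less)

lemma kron_zero_right [simp]: "kron A (0\<^sub>m a b) = 0\<^sub>m (dim_row A * a) (dim_col (A :: 'k::field mat) * b)"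
  by (rule eq_matI) (auto simp: kron_index divmod_less)

text \<open>Versions of the ring laws whose side conditions only mention dimensions.\<close>

lemma mat_assoc:
  fixes A :: "'k::field mat"
  shows "dim_col A = dim_row B \<Longrightarrow> dim_col B = dim_row C \<Longrightarrow> A * B * C = A * (B * C)"
  by (rule assoc_mult_mat) auto

lemma mat_distrib_left:
  fixes A :: "'k::field mat"
  assumes "dim_col A = dim_row B" "dim_row B = dim_row C" "dim_col B = dim_col C"
  shows "A * (B + C) = A * B + A * C"
  by (rule mult_add_distrib_mat [of _ "dim_row A" "dim_col A" _ "dim_col B"]) (use assms in auto)

lemma mat_distrib_right:
  fixes A :: "'k::field mat"
  assumes "dim_col A = dim_row C" "dim_row A = dim_row B" "dim_col A = dim_col B"
  shows "(A + B) * C = A * C + B * C"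
  by (rule add_mult_distrib_mat [of _ "dim_row A" "dim_col A" _ _ "dim_col C"]) (use assms in auto)

lemma mat_diff_left:
  fixes A :: "'k::field mat"
  assumes "dim_col A = dim_row B" "dim_row B = dim_row C" "dim_col B = dim_col C"
  shows "A * (B - C) = A * B - A * C"
  by (rule mult_minus_distrib_mat [of _ "dim_row A" "dim_col A" _ "dim_col B"]) (use assms in auto)

lemma mat_diff_right:
  fixes A :: "'k::field mat"
  assumes "dim_col A = dim_row C" "dim_row A = dim_row B" "dim_col A = dim_col B"
  shows "(A - B) * C = A * C - B * C"
  by (rule minus_mult_distrib_mat [of _ "dim_row A" "dim_col A" _ _ "dim_col C"]) (use assms in auto)

lemma mat_eq_iff_diff:
  fixes A :: "'k::field mat"
  assumes "dim_row A = dim_row B" "dim_col A = dim_col B"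
  shows "A - B = 0\<^sub>m (dim_row B) (dim_col B) \<longleftrightarrow> A = B"
  using assms by (auto simp: mat_eq_iff)

lemma mat_diff_self [simp]: "A - A = (0\<^sub>m (dim_row A) (dim_col A) :: 'k::field mat)"
  by (rule eq_matI) auto

lemma mat_eqI:
  assumes "dim_row A = dim_row B" "dim_col A = dim_col B"
    "\<And>i j. i < dim_row B \<Longrightarrow> j < dim_col B \<Longrightarrow> A $$ (i, j) = B $$ (i, j)"
  shows "A = B"
  using assms by (intro eq_matI) auto

text \<open>Congruence modulo a set of matrices that is closed under subtraction.\<close>

lemma equiv_mod_mat:
  fixes Z B :: "'k::field mat set"
  assumes Z: "Z \<subseteq> carrier_mat a b" and 0: "0\<^sub>m a b \<in> B" and diff: "\<And>f g. f \<in> B \<Longrightarrow> g \<in> B \<Longrightarrow> f - g \<in> B"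
  shows "equiv Z {(f, g). f \<in> Z \<and> g \<in> Z \<and> f - g \<in> B}"
proof (rule equivI)
  let ?R = "{(f, g). f \<in> Z \<and> g \<in> Z \<and> f - g \<in> B}"
  have d: "dim_row f = a" "dim_col f = b" if "f \<in> Z" for f using Z that by auto
  show "?R \<subseteq> Z \<times> Z" by auto
  show "refl_on Z ?R" using 0 d by (auto simp: refl_on_def)
  show "sym ?R"
  proof (rule symI)
    fix f g assume fg: "(f, g) \<in> ?R"
    then have "0\<^sub>m a b - (f - g) = g - f" using d by (intro mat_eqI) auto
    with fg show "(g, f) \<in> ?R" using diff [OF 0, of "f - g"] by auto
  qed
  show "trans ?R"
  proof (rule transI)
    fix f g h assume fgh: "(f, g) \<in> ?R" "(g, h) \<in> ?R"
    then have "f - g - (0\<^sub>m a b - (g - h)) = f - h" using d by (intro mat_eqI) auto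
    with fgh show "(f, h) \<in> ?R" using diff [OF _ diff [OF 0], of "f - g" "g - h"] by auto
  qed
qed

section \<open>Evaluation, coevaluation and the swap\<close>

lemma evaluation_dim [simp]:
  "dim_row (evaluation n) = Suc 0" "dim_col (evaluation n) = n * n"
  "dim_row (coevaluation n) = n * n" "dim_col (coevaluation n) = Suc 0"
  by (simp_all add: evaluation_def coevaluation_def)

lemma divmod_pair: "j < n \<Longrightarrow> (i * n + j) div n = (i::nat)" "j < n \<Longrightarrow> (i * n + j) mod n = j"
  by auto

lemma pair_less: "i < m \<Longrightarrow> j < n \<Longrightarrow> i * n + j < m * (n::nat)"
  by (metis div_less_iff_less_mult divmod_pair(1) less_nat_zero_code not_gr_zero)

lemma sum_delta_kron:
  "(\<Sum>i<n. \<Sum>j<n. (if i = j then F i j else 0)) = (\<Sum>i<(n::nat). (F i i :: 'k::field))"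
  by (intro sum.cong refl) simp

text \<open>The two zigzag identities for the duality between \<open>W\<close> and its dual.\<close>

lemma zigzag1:
  "kron (1\<^sub>m n) (evaluation n) * kron (coevaluation n) (1\<^sub>m n) = (1\<^sub>m n :: 'k::field mat)"
proof (rule mat_eqI, goal_cases)
  case (3 i j)
  then have i: "i < n" and j: "j < n" by auto
  let ?F = "\<lambda>p r q. (if i = p \<and> r = q then 1 else 0) * (if p = r \<and> q = j then 1 else (0::'k))"
  have "(kron (1\<^sub>m n) (evaluation n) * kron (coevaluation n) (1\<^sub>m n)) $$ (i, j) =
     (\<Sum>k<n * (n * n). ?F (k div (n * n)) (k mod (n * n) div n) (k mod (n * n) mod n))"
  proof (subst mult_index, goal_cases)
    case 4
    have "kron (1\<^sub>m n) (evaluation n) $$ (i, k) * kron (coevaluation n) (1\<^sub>m n) $$ (k, j) =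
       ?F (k div (n * n)) (k mod (n * n) div n) (k mod (n * n) mod n)"
      if "k < n * (n * n)" for k
    proof -
      note d = divmod_less [OF that] divmod_less [OF divmod_less(2) [OF that]]
      have that': "k < n * n * n" using that by (simp add: mult.assoc)
      have e: "k div n div n = k div (n * n)" "k div n mod n = k mod (n * n) div n"
        "k mod (n * n) mod n = k mod n"
        by (simp_all add: div_mult2_eq divmod_mult)
      show ?thesis using d i j that that' divmod_less [OF that']
        by (auto simp: kron_index evaluation_def coevaluation_def e)
    qed
    then show ?case by (intro sum.cong) (auto simp: mult.assoc)
  qed (use i j in auto)
  also have "\<dots> = (\<Sum>p<n. \<Sum>k<n * n. ?F p (k div n) (k mod n))"
    by (rule sum_divmod)
  also have "\<dots> = (\<Sum>p<n. \<Sum>r<n. \<Sum>q<n. ?F p r q)"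
    by (intro sum.cong refl sum_divmod)
  also have "\<dots> = (\<Sum>p<n. \<Sum>r<n. \<Sum>q<n. if r = q then (if i = p \<and> p = r \<and> r = j then 1 else 0) else 0)"
    by (intro sum.cong refl) auto
  also have "\<dots> = (\<Sum>p<n. \<Sum>r<n. if p = r then (if i = p \<and> p = j then 1 else 0) else 0)"
    by (intro sum.cong refl) (auto simp: sum_delta_kron)
  also have "\<dots> = (\<Sum>p<n. if i = p then (if i = j then 1 else 0) else 0)"
    by (subst sum_delta_kron, intro sum.cong refl) auto
  also have "\<dots> = (1\<^sub>m n) $$ (i, j)"
    using i j by simp
  finally show ?case .
qed auto

text \<open>Invariance of the evaluation: the dual of a module acts by the transposed inverse.\<close>

lemma evaluation_kron:
  fixes A :: "'k::field mat"
  assumes "A \<in> carrier_mat n n" "B \<in> carrier_mat n n" "B * A = 1\<^sub>m n"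
  shows "evaluation n * kron A (transpose_mat B) = evaluation n"
    and "evaluation n * kron (transpose_mat B) A = evaluation n"
proof -
  have "(evaluation n * kron A (transpose_mat B)) $$ (i, j) = evaluation n $$ (i, j) \<and>
     (evaluation n * kron (transpose_mat B) A) $$ (i, j) = evaluation n $$ (i, j)"
    if "i < 1" "j < n * n" for i j
  proof -
    note j = divmod_less [OF that(2)]
    have 1: "(\<Sum>a<n. A $$ (a, u) * B $$ (v, a)) = (if u = v then 1 else 0)" if "u < n" "v < n" for u v
    proof -
      have "(B * A) $$ (v, u) = (\<Sum>a<n. B $$ (v, a) * A $$ (a, u))"
        using assms(1,2) that by (subst mult_index) auto
      also have "(B * A) $$ (v, u) = (if u = v then 1 else 0)"
        using assms(3) that by auto
      finally show ?thesis by (simp add: mult.commute)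
    qed
    have "(evaluation n * kron A (transpose_mat B)) $$ (i, j) =
       (\<Sum>k<n * n. (if k div n = k mod n then A $$ (k div n, j div n) * B $$ (j mod n, k mod n) else 0))"
      using that assms j
      by (subst mult_index) (auto intro!: sum.cong simp: evaluation_def kron_index divmod_less)
    also have "\<dots> = (\<Sum>p<n. \<Sum>q<n. (if p = q then A $$ (p, j div n) * B $$ (j mod n, q) else 0))"
      by (rule sum_divmod)
    also have "\<dots> = evaluation n $$ (i, j)"
      using that j 1 by (simp add: evaluation_def sum_delta_kron)
    finally have *: "(evaluation n * kron A (transpose_mat B)) $$ (i, j) = evaluation n $$ (i, j)" .
    have "(evaluation n * kron (transpose_mat B) A) $$ (i, j) =
       (\<Sum>k<n * n. (if k div n = k mod n then A $$ (k mod n, j mod n) * B $$ (j div n, k div n) else 0))"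
      using that assms j
      by (subst mult_index) (auto intro!: sum.cong simp: evaluation_def kron_index divmod_less)
    also have "\<dots> = (\<Sum>p<n. \<Sum>q<n. (if p = q then A $$ (q, j mod n) * B $$ (j div n, p) else 0))"
      by (rule sum_divmod)
    also have "\<dots> = evaluation n $$ (i, j)"
      using that j 1 [of "j mod n" "j div n"] by (auto simp: evaluation_def sum_delta_kron)
    finally show ?thesis using * by blast
  qed
  then show "evaluation n * kron A (transpose_mat B) = evaluation n"
    "evaluation n * kron (transpose_mat B) A = evaluation n"
    using assms by (auto intro!: mat_eqI simp del: index_mult_mat(1))
qed

lemma coevaluation_transpose: "coevaluation n = transpose_mat (evaluation n :: 'k::field mat)"
  by (rule mat_eqI) (auto simp: evaluation_def coevaluation_def)

lemma kron_transpose: "transpose_mat (kron A B) = kron (transpose_mat A) (transpose_mat B)"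
  by (rule mat_eqI) (auto simp: kron_index divmod_less)

lemma zigzag2:
  "kron (evaluation n) (1\<^sub>m n) * kron (1\<^sub>m n) (coevaluation n) = (1\<^sub>m n :: 'k::field mat)"
proof -
  have "1\<^sub>m n = transpose_mat (kron (1\<^sub>m n) (evaluation n) * kron (coevaluation n) (1\<^sub>m n) :: 'k mat)"
    by (simp only: zigzag1 transpose_one)
  also have "\<dots> = transpose_mat (kron (coevaluation n) (1\<^sub>m n)) * transpose_mat (kron (1\<^sub>m n) (evaluation n))"
    by (rule transpose_mult [of _ n "n * (n * n)" _ n]) (rule carrier_matI; simp add: mult.assoc)+
  also have "\<dots> = kron (evaluation n) (1\<^sub>m n) * kron (1\<^sub>m n) (coevaluation n)"
    by (simp only: kron_transpose coevaluation_transpose transpose_one transpose_transpose)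
  finally show ?thesis by (rule sym)
qed

text \<open>Invariance of the coevaluation, by transposition.\<close>

lemma coevaluation_kron:
  fixes A :: "'k::field mat"
  assumes "A \<in> carrier_mat n n" "B \<in> carrier_mat n n" "A * B = 1\<^sub>m n"
  shows "kron A (transpose_mat B) * coevaluation n = coevaluation n"
    and "kron (transpose_mat B) A * coevaluation n = coevaluation n"
proof -
  have eq: "transpose_mat B * transpose_mat A = 1\<^sub>m n"
    using assms by (metis transpose_mult transpose_one)
  have "transpose_mat (evaluation n * kron (transpose_mat A) (transpose_mat (transpose_mat B))) = transpose_mat (evaluation n)"
    by (subst evaluation_kron(1) [OF _ _ eq]) (use assms in auto)
  then show "kron A (transpose_mat B) * coevaluation n = coevaluation n"
    using assms by (subst (asm) transpose_mult [of _ 1 "n*n" _ "n * n"])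
      (auto simp: kron_transpose coevaluation_transpose)
  have "transpose_mat (evaluation n * kron (transpose_mat (transpose_mat B)) (transpose_mat A)) = transpose_mat (evaluation n)"
    by (subst evaluation_kron(2) [OF _ _ eq]) (use assms in auto)
  then show "kron (transpose_mat B) A * coevaluation n = coevaluation n"
    using assms by (subst (asm) transpose_mult [of _ 1 "n*n" _ "n * n"])
      (auto simp: kron_transpose coevaluation_transpose)
qed

text \<open>The matrix of the swap \<open>k\<^sup>m \<otimes> k\<^sup>n \<rightarrow> k\<^sup>n \<otimes> k\<^sup>m\<close>.\<close>

definition swap :: "nat \<Rightarrow> nat \<Rightarrow> 'k::field mat" where
  "swap m n = mat (n * m) (m * n) (\<lambda>(i, j). if i div m = j mod n \<and> i mod m = j div n then 1 else 0)"

lemma swap_dim [simp]: "dim_row (swap m n) = n * m" "dim_col (swap m n) = m * n"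
  by (simp_all add: swap_def)

lemma swap_mult_index:
  fixes A :: "'k::field mat"
  assumes "dim_row A = m * n" "i < n * m" "j < dim_col A"
  shows "(swap m n * A) $$ (i, j) = A $$ ((i mod m) * n + i div m, j)"
proof -
  note i = divmod_less [OF assms(2)]
  have "(swap m n * A) $$ (i, j) =
     (\<Sum>k<m * n. if k = (i mod m) * n + i div m then A $$ (k, j) else 0)"
  proof (subst mult_index, goal_cases)
    case 4
    have "i div m = k mod n \<and> i mod m = k div n \<longleftrightarrow> k = (i mod m) * n + i div m" for k
      using i by (auto simp: divmod_pair)
    then show ?case using assms by (intro sum.cong) (auto simp: swap_def)
  qed (use assms in auto)
  also have "\<dots> = A $$ ((i mod m) * n + i div m, j)"
    using pair_less [OF i(2,1)] by simp
  finally show ?thesis .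
qed

lemma mult_swap_index:
  fixes A :: "'k::field mat"
  assumes "dim_col A = n * m" "i < dim_row A" "j < m * n"
  shows "(A * swap m n) $$ (i, j) = A $$ (i, (j mod n) * m + j div n)"
proof -
  note j = divmod_less [OF assms(3)]
  have "(A * swap m n) $$ (i, j) =
     (\<Sum>k<n * m. if k = (j mod n) * m + j div n then A $$ (i, k) else 0)"
  proof (subst mult_index, goal_cases)
    case 4
    have "k div m = j mod n \<and> k mod m = j div n \<longleftrightarrow> k = (j mod n) * m + j div n" for k
      using j by (metis div_mult_mod_eq divmod_pair)
    then show ?case using assms by (intro sum.cong) (auto simp: swap_def)
  qed (use assms in auto)
  also have "\<dots> = A $$ (i, (j mod n) * m + j div n)"
    using pair_less [OF j(2,1)] by simp
  finally show ?thesis .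
qed

lemma swap_kron:
  fixes A :: "'k::field mat"
  assumes "A \<in> carrier_mat m m'" "B \<in> carrier_mat n n'"
  shows "swap m n * kron A B = kron B A * swap m' n'"
proof (rule mat_eqI, goal_cases)
  case (3 i j)
  with assms have i: "i < n * m" and j: "j < m' * n'" by auto
  note d = divmod_less [OF i] divmod_less [OF j]
  show ?case
    using assms i j d pair_less [OF d(2,1)] pair_less [OF d(4,3)]
    by (simp add: swap_mult_index mult_swap_index kron_index del: index_mult_mat(1))
qed (use assms in auto)

lemma swap_swap: "swap n m * swap m n = (1\<^sub>m (m * n) :: 'k::field mat)"
proof (rule mat_eqI, goal_cases)
  case (3 i j)
  then have i: "i < m * n" and j: "j < m * n" by auto
  note d = divmod_less [OF i] divmod_less [OF j]
  have "j mod n = i mod n \<and> i div n = j div n \<longleftrightarrow> i = j" by (metis div_mult_mod_eq)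
  moreover have "(swap n m * swap m n) $$ (i, j) = swap m n $$ (i mod n * m + i div n, j)"
    using i j by (subst swap_mult_index) auto
  ultimately show ?case
    using i j d pair_less [OF d(2,1)] by (auto simp: swap_def)
qed auto

section \<open>Representations and equivariant maps\<close>

text \<open>The trivial one-dimensional module \<open>k\<close>.\<close>

definition triv :: "('g, 'k::field) rep" where
  "triv = Rep 1 (\<lambda>_. 1\<^sub>m 1)"

lemma triv_simps [simp]: "deg triv = Suc 0" "act triv g = 1\<^sub>m (Suc 0)"
  by (simp_all add: triv_def)

lemma tensor_simps [simp]:
  "deg (tensor M N) = deg M * deg N" "act (tensor M N) g = kron (act M g) (act N g)"
  by (simp_all add: tensor_def)

lemma dual_simps [simp]:
  "deg (dual G M) = deg M" "act (dual G M) g = transpose_mat (act M (inv\<^bsub>G\<^esub> g))"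
  by (simp_all add: dual_def)

text \<open>Equality, not just isomorphism: the Kronecker product is strictly associative.\<close>

lemma tensor_assoc: "tensor (tensor L M) N = tensor L (tensor M N)"
  by (simp add: tensor_def kron_assoc mult.assoc)

lemma tensor_triv [simp]: "tensor M triv = M" "tensor triv M = M"
  by (cases M; simp add: tensor_def)+

lemma rep_dim:
  assumes "is_rep G M" "g \<in> carrier G"
  shows "dim_row (act M g) = deg M" "dim_col (act M g) = deg M"
  using assms by (auto simp: is_rep_def)

lemma rep_one: "is_rep G M \<Longrightarrow> act M \<one>\<^bsub>G\<^esub> = 1\<^sub>m (deg M)"
  by (simp add: is_rep_def)

lemma rep_mult: "is_rep G M \<Longrightarrow> g \<in> carrier G \<Longrightarrow> h \<in> carrier G \<Longrightarrow> act M (g \<otimes>\<^bsub>G\<^esub> h) = act M g * act M h"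
  by (simp add: is_rep_def)

lemma is_repI:
  assumes "\<And>g. g \<in> carrier G \<Longrightarrow> act M g \<in> carrier_mat (deg M) (deg M)"
    "act M \<one>\<^bsub>G\<^esub> = 1\<^sub>m (deg M)"
    "\<And>g h. g \<in> carrier G \<Longrightarrow> h \<in> carrier G \<Longrightarrow> act M (g \<otimes>\<^bsub>G\<^esub> h) = act M g * act M h"
  shows "is_rep G M"
  using assms by (simp add: is_rep_def)

lemma is_rep_triv [simp]: "is_rep G triv"
  by (rule is_repI) auto

lemma is_rep_tensor [simp]:
  assumes "is_rep G M" "is_rep G N"
  shows "is_rep G (tensor M N)"
  by (rule is_repI)
    (use assms in \<open>auto simp: rep_dim rep_one rep_mult kron_mult intro!: carrier_matI\<close>)

lemma rep_homI:
  assumes "f \<in> carrier_mat (deg N) (deg M)" "\<And>g. g \<in> carrier G \<Longrightarrow> f * act M g = act N g * f"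
  shows "f \<in> rep_hom G M N"
  using assms by (simp add: rep_hom_def)

lemma rep_hom_carrier: "f \<in> rep_hom G M N \<Longrightarrow> f \<in> carrier_mat (deg N) (deg M)"
  by (simp add: rep_hom_def)

lemma rep_hom_dim [simp]:
  assumes "f \<in> rep_hom G M N" shows "dim_row f = deg N" "dim_col f = deg M"
  using assms by (auto simp: rep_hom_def)

lemma rep_homD: "f \<in> rep_hom G M N \<Longrightarrow> g \<in> carrier G \<Longrightarrow> f * act M g = act N g * f"
  by (simp add: rep_hom_def)

lemma rep_hom_one [simp]: "is_rep G M \<Longrightarrow> 1\<^sub>m (deg M) \<in> rep_hom G M M"
  by (rule rep_homI) (auto simp: rep_dim)

lemma rep_hom_zero: "is_rep G M \<Longrightarrow> is_rep G N \<Longrightarrow> 0\<^sub>m (deg N) (deg M) \<in> rep_hom G M N"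
  by (rule rep_homI) (auto simp: rep_dim)

lemma rep_hom_comp:
  assumes "g \<in> rep_hom G M N" "f \<in> rep_hom G L M" "is_rep G L" "is_rep G M" "is_rep G N"
  shows "g * f \<in> rep_hom G L N"
proof (rule rep_homI)
  fix x assume x: "x \<in> carrier G"
  have "g * f * act L x = g * (act M x * f)"
    using assms x by (simp add: mat_assoc rep_dim rep_homD)
  also have "\<dots> = act N x * (g * f)"
    using assms x by (simp add: mat_assoc [symmetric] rep_dim rep_homD)
  finally show "g * f * act L x = act N x * (g * f)" .
qed (use assms in \<open>auto intro: carrier_matI\<close>)

lemma rep_hom_add:
  assumes "f \<in> rep_hom G M N" "g \<in> rep_hom G M N" "is_rep G M" "is_rep G N"
  shows "f + g \<in> rep_hom G M N"
  by (rule rep_homI)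
    (use assms in \<open>auto simp: rep_dim mat_distrib_left mat_distrib_right rep_homD intro: carrier_matI\<close>)

lemma rep_hom_diff:
  assumes "f \<in> rep_hom G M N" "g \<in> rep_hom G M N" "is_rep G M" "is_rep G N"
  shows "f - g \<in> rep_hom G M N"
  by (rule rep_homI)
    (use assms in \<open>auto simp: rep_dim mat_diff_left mat_diff_right rep_homD intro: carrier_matI\<close>)

lemma rep_hom_kron:
  assumes "f \<in> rep_hom G M N" "g \<in> rep_hom G M' N'"
    "is_rep G M" "is_rep G N" "is_rep G M'" "is_rep G N'"
  shows "kron f g \<in> rep_hom G (tensor M M') (tensor N N')"
  by (rule rep_homI)
    (use assms in \<open>auto simp: rep_dim kron_mult rep_homD intro: carrier_matI\<close>)

lemma rep_hom_kron_left:
  assumes "g \<in> rep_hom G M N" "is_rep G A" "is_rep G M" "is_rep G N"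
  shows "kron (1\<^sub>m (deg A)) g \<in> rep_hom G (tensor A M) (tensor A N)"
  using assms by (intro rep_hom_kron) auto

lemma rep_hom_kron_right:
  assumes "g \<in> rep_hom G M N" "is_rep G A" "is_rep G M" "is_rep G N"
  shows "kron g (1\<^sub>m (deg A)) \<in> rep_hom G (tensor M A) (tensor N A)"
  using assms by (intro rep_hom_kron) auto

lemma rep_hom_swap:
  assumes "is_rep G M" "is_rep G N"
  shows "swap (deg M) (deg N) \<in> rep_hom G (tensor M N) (tensor N M)"
proof (rule rep_homI)
  fix x assume x: "x \<in> carrier G"
  show "swap (deg M) (deg N) * act (tensor M N) x = act (tensor N M) x * swap (deg M) (deg N)"
    using assms x swap_kron [of "act M x" "deg M" "deg M" "act N x" "deg N" "deg N"]
    by (simp add: is_rep_def)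
qed (auto intro: carrier_matI)

section \<open>Duality and the trace over a module\<close>

text \<open>
  The trace \<open>Hom(M \<otimes> W, N \<otimes> W) \<rightarrow> Hom(M, N)\<close> over the factor \<open>W\<close>: the transfer in degree zero.
\<close>

definition tr :: "('g, 'k::field) rep \<Rightarrow> ('g, 'k) rep \<Rightarrow> ('g, 'k) rep \<Rightarrow> 'k mat \<Rightarrow> 'k mat" where
  "tr W M N \<theta> = kron (1\<^sub>m (deg N)) (evaluation (deg W)) * hom_adj W M \<theta>"

lemma hom_adj_dim [simp]:
  "dim_row (hom_adj W M \<theta>) = dim_row \<theta> * deg W" "dim_col (hom_adj W M \<theta>) = deg M"
  by (simp_all add: hom_adj_def)

lemma tr_dim [simp]: "dim_row (tr W M N \<theta>) = deg N" "dim_col (tr W M N \<theta>) = deg M"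
  by (simp_all add: tr_def)

lemma hom_adj_comp_right:
  assumes "dim_col \<theta> = deg M * deg W" "b \<in> carrier_mat (deg M) (deg L)"
  shows "hom_adj W L (\<theta> * kron b (1\<^sub>m (deg W))) = hom_adj W M \<theta> * b"
proof -
  let ?w = "1\<^sub>m (deg W)" and ?c = "coevaluation (deg W)"
  have "hom_adj W L (\<theta> * kron b ?w) = kron (\<theta> * kron b ?w) (?w * ?w) * kron (1\<^sub>m (deg L)) ?c"
    by (simp add: hom_adj_def)
  also have "\<dots> = kron \<theta> ?w * (kron b (1\<^sub>m (deg W * deg W)) * kron (1\<^sub>m (deg L)) ?c)"
    using assms by (subst kron_mult [symmetric]) (auto simp: kron_assoc mat_assoc mult.assoc)
  also have "kron b (1\<^sub>m (deg W * deg W)) * kron (1\<^sub>m (deg L)) ?c = kron (1\<^sub>m (deg M)) ?c * kron b (1\<^sub>m (Suc 0))"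
    using assms by (simp add: kron_mult del: kron_one_right)
  finally show ?thesis
    using assms by (simp add: hom_adj_def mat_assoc mult.assoc)
qed

lemma hom_adj_comp_left:
  assumes "dim_col \<theta> = deg M * deg W" "dim_col a = dim_row \<theta>"
  shows "hom_adj W M (a * \<theta>) = kron a (1\<^sub>m (deg W)) * hom_adj W M \<theta>"
proof -
  let ?w = "1\<^sub>m (deg W)" and ?c = "coevaluation (deg W)"
  have "hom_adj W M (a * \<theta>) = kron (a * \<theta>) (?w * ?w) * kron (1\<^sub>m (deg M)) ?c"
    by (simp add: hom_adj_def)
  then show ?thesis
    using assms by (subst (asm) kron_mult [symmetric]) (auto simp: hom_adj_def mat_assoc mult.assoc)
qed

lemma hom_adj_diff:
  assumes "dim_col \<theta> = deg M * deg W" "dim_col \<theta>' = deg M * deg W" "dim_row \<theta> = dim_row \<theta>'"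
  shows "hom_adj W M (\<theta> - \<theta>') = hom_adj W M \<theta> - hom_adj W M \<theta>'"
  using assms by (simp add: hom_adj_def kron_minus_left mat_diff_right mult.assoc)

text \<open>The trace is natural in both variables, and commutes with tensoring from the left.\<close>

lemma tr_right:
  assumes "\<theta> \<in> carrier_mat (deg N * deg W) (deg M * deg W)" "b \<in> carrier_mat (deg M) (deg L)"
  shows "tr W M N \<theta> * b = tr W L N (\<theta> * kron b (1\<^sub>m (deg W)))"
  using assms by (simp add: tr_def hom_adj_comp_right [of _ M] mat_assoc mult.assoc)

lemma tr_left:
  assumes "\<theta> \<in> carrier_mat (deg N * deg W) (deg M * deg W)" "a \<in> carrier_mat (deg L) (deg N)"
  shows "a * tr W M N \<theta> = tr W M L (kron a (1\<^sub>m (deg W)) * \<theta>)"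
proof -
  have "a * tr W M N \<theta> = kron a (1\<^sub>m (Suc 0)) * kron (1\<^sub>m (deg N)) (evaluation (deg W)) * hom_adj W M \<theta>"
    using assms by (simp add: tr_def mat_assoc mult.assoc)
  also have "kron a (1\<^sub>m (Suc 0)) * kron (1\<^sub>m (deg N)) (evaluation (deg W)) =
      kron (1\<^sub>m (deg L)) (evaluation (deg W)) * kron a (1\<^sub>m (deg W * deg W))"
    using assms by (simp add: kron_mult del: kron_one_right)
  also have "kron a (1\<^sub>m (deg W * deg W)) = kron (kron a (1\<^sub>m (deg W))) (1\<^sub>m (deg W))"
    by (simp add: kron_assoc)
  finally show ?thesis
    using assms by (simp add: tr_def hom_adj_comp_left mat_assoc mult.assoc)
qed

lemma tr_diff:
  assumes "\<theta> \<in> carrier_mat (deg N * deg W) (deg M * deg W)"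
    "\<theta>' \<in> carrier_mat (deg N * deg W) (deg M * deg W)"
  shows "tr W M N (\<theta> - \<theta>') = tr W M N \<theta> - tr W M N \<theta>'"
  using assms by (simp add: tr_def hom_adj_diff mat_diff_left mult.assoc)

lemma tr_tensor:
  assumes "\<theta> \<in> carrier_mat (deg N * deg W) (deg M * deg W)"
  shows "kron (1\<^sub>m (deg A)) (tr W M N \<theta>) = tr W (tensor A M) (tensor A N) (kron (1\<^sub>m (deg A)) \<theta>)"
proof -
  have *: "kron (1\<^sub>m (m * n)) B = kron (1\<^sub>m m) (kron (1\<^sub>m n) B)" for m n and B :: "'a mat"
    by (simp add: kron_assoc [symmetric])
  show ?thesis
    using assms by (simp add: tr_def hom_adj_def * kron_assoc kron_mult mult.assoc)
qed

context
  fixes G :: "('g, 'b) monoid_scheme"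
  assumes G: "group G"
begin

lemma is_rep_dual:
  assumes "is_rep G M"
  shows "is_rep G (dual G M)"
proof (rule is_repI)
  fix g h assume gh: "g \<in> carrier G" "h \<in> carrier G"
  have "act M (inv\<^bsub>G\<^esub> (g \<otimes>\<^bsub>G\<^esub> h)) = act M (inv\<^bsub>G\<^esub> h) * act M (inv\<^bsub>G\<^esub> g)"
    using G gh assms by (simp add: group.inv_mult_group rep_mult)
  then show "act (dual G M) (g \<otimes>\<^bsub>G\<^esub> h) = act (dual G M) g * act (dual G M) h"
    using assms gh G by (simp add: is_rep_def transpose_mult [of _ "deg M" "deg M" _ "deg M"])
next
  show "act (dual G M) \<one>\<^bsub>G\<^esub> = 1\<^sub>m (deg (dual G M))"
    using G assms by (simp add: rep_one group.is_monoid monoid.inv_one)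
qed (use assms G in \<open>auto simp: is_rep_def\<close>)

lemma rep_inv:
  assumes "is_rep G M" "g \<in> carrier G"
  shows "act M g * act M (inv\<^bsub>G\<^esub> g) = 1\<^sub>m (deg M)" "act M (inv\<^bsub>G\<^esub> g) * act M g = 1\<^sub>m (deg M)"
  using assms G by (simp_all add: rep_mult [symmetric] group.r_inv group.l_inv rep_one)

lemma evaluation_hom:
  assumes "is_rep G M"
  shows "evaluation (deg M) \<in> rep_hom G (tensor M (dual G M)) triv"
    and "evaluation (deg M) \<in> rep_hom G (tensor (dual G M) M) triv"
proof -
  have "act M g \<in> carrier_mat (deg M) (deg M)" "act M (inv\<^bsub>G\<^esub> g) \<in> carrier_mat (deg M) (deg M)"
    if "g \<in> carrier G" for g
    using that assms G by (auto simp: is_rep_def)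
  then show "evaluation (deg M) \<in> rep_hom G (tensor M (dual G M)) triv"
    "evaluation (deg M) \<in> rep_hom G (tensor (dual G M) M) triv"
    using assms by (auto intro!: rep_homI carrier_matI simp: evaluation_kron rep_inv)
qed

lemma coevaluation_hom:
  assumes "is_rep G M"
  shows "coevaluation (deg M) \<in> rep_hom G triv (tensor M (dual G M))"
    and "coevaluation (deg M) \<in> rep_hom G triv (tensor (dual G M) M)"
proof -
  have "act M g \<in> carrier_mat (deg M) (deg M)" "act M (inv\<^bsub>G\<^esub> g) \<in> carrier_mat (deg M) (deg M)"
    if "g \<in> carrier G" for g
    using that assms G by (auto simp: is_rep_def)
  then show "coevaluation (deg M) \<in> rep_hom G triv (tensor M (dual G M))"
    "coevaluation (deg M) \<in> rep_hom G triv (tensor (dual G M) M)"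
    using assms by (auto intro!: rep_homI carrier_matI simp: coevaluation_kron rep_inv)
qed

lemma hom_adj_hom:
  assumes "is_rep G W" "is_rep G M" "is_rep G N" "\<theta> \<in> rep_hom G (tensor M W) N"
  shows "hom_adj W M \<theta> \<in> rep_hom G M (tensor N (dual G W))"
proof -
  have 1: "kron (1\<^sub>m (deg M)) (coevaluation (deg W)) \<in> rep_hom G M (tensor M (tensor W (dual G W)))"
    using rep_hom_kron_left [OF coevaluation_hom(1), of W M] assms by (simp add: is_rep_dual)
  have 2: "kron \<theta> (1\<^sub>m (deg W)) \<in> rep_hom G (tensor M (tensor W (dual G W))) (tensor N (dual G W))"
    using rep_hom_kron_right [OF assms(4), of "dual G W"] assms by (simp add: is_rep_dual tensor_assoc)
  show ?thesis
    unfolding hom_adj_def by (rule rep_hom_comp [OF 2 1]) (use assms in \<open>auto simp: is_rep_dual\<close>)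
qed

text \<open>The counit \<open>N \<otimes> W \<otimes> W\<^sup>* \<rightarrow> N\<close>; traces are the maps that factor through it.\<close>

lemma counit_hom:
  assumes "is_rep G W" "is_rep G N"
  shows "kron (1\<^sub>m (deg N)) (evaluation (deg W)) \<in> rep_hom G (tensor (tensor N W) (dual G W)) N"
  using rep_hom_kron_left [OF evaluation_hom(1), of W N] assms by (simp add: is_rep_dual tensor_assoc)

lemma unit_hom:
  assumes "is_rep G W" "is_rep G N"
  shows "kron (1\<^sub>m (deg N)) (coevaluation (deg W)) \<in> rep_hom G N (tensor (tensor N W) (dual G W))"
  using rep_hom_kron_left [OF coevaluation_hom(1), of W N] assms by (simp add: is_rep_dual tensor_assoc)

lemma tr_hom:
  assumes "is_rep G W" "is_rep G M" "is_rep G N" "\<theta> \<in> rep_hom G (tensor M W) (tensor N W)"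
  shows "tr W M N \<theta> \<in> rep_hom G M N"
  unfolding tr_def
  by (rule rep_hom_comp [OF counit_hom hom_adj_hom]) (use assms in \<open>auto simp: is_rep_dual\<close>)

end

text \<open>The equivariant maps that are traces of equivariant maps.\<close>

definition traces ::
  "('g, 'b) monoid_scheme \<Rightarrow> ('g, 'k::field) rep \<Rightarrow> ('g, 'k) rep \<Rightarrow> ('g, 'k) rep \<Rightarrow> 'k mat set" where
  "traces G W M N = tr W M N ` rep_hom G (tensor M W) (tensor N W)"

text \<open>The traces form a two-sided ideal, closed under tensoring with a module.\<close>

lemma traces_comp_left:
  assumes "f \<in> traces G W M N" "a \<in> rep_hom G N L" "is_rep G M" "is_rep G N" "is_rep G L" "is_rep G W"
  shows "a * f \<in> traces G W M L"
proof -
  obtain \<theta> where \<theta>: "\<theta> \<in> rep_hom G (tensor M W) (tensor N W)" "f = tr W M N \<theta>"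
    using assms by (auto simp: traces_def)
  have "kron a (1\<^sub>m (deg W)) * \<theta> \<in> rep_hom G (tensor M W) (tensor L W)"
    by (rule rep_hom_comp [OF rep_hom_kron_right \<theta>(1)]) (use assms in auto)
  moreover have "a * f = tr W M L (kron a (1\<^sub>m (deg W)) * \<theta>)"
    using tr_left [of \<theta> N W M a L] \<theta> rep_hom_carrier [OF \<theta>(1)] rep_hom_carrier [OF assms(2)] by simp
  ultimately show ?thesis by (simp add: traces_def)
qed

lemma traces_comp_right:
  assumes "f \<in> traces G W M N" "b \<in> rep_hom G L M" "is_rep G M" "is_rep G N" "is_rep G L" "is_rep G W"
  shows "f * b \<in> traces G W L N"
proof -
  obtain \<theta> where \<theta>: "\<theta> \<in> rep_hom G (tensor M W) (tensor N W)" "f = tr W M N \<theta>"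
    using assms by (auto simp: traces_def)
  have "\<theta> * kron b (1\<^sub>m (deg W)) \<in> rep_hom G (tensor L W) (tensor N W)"
    by (rule rep_hom_comp [OF \<theta>(1) rep_hom_kron_right]) (use assms in auto)
  moreover have "f * b = tr W L N (\<theta> * kron b (1\<^sub>m (deg W)))"
    using tr_right [of \<theta> N W M b L] \<theta> rep_hom_carrier [OF \<theta>(1)] rep_hom_carrier [OF assms(2)] by simp
  ultimately show ?thesis by (simp add: traces_def)
qed

lemma traces_diff:
  assumes "f \<in> traces G W M N" "g \<in> traces G W M N" "is_rep G M" "is_rep G N" "is_rep G W"
  shows "f - g \<in> traces G W M N"
proof -
  obtain \<theta> where \<theta>: "\<theta> \<in> rep_hom G (tensor M W) (tensor N W)" "f = tr W M N \<theta>"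
    using assms by (auto simp: traces_def)
  obtain \<eta> where \<eta>: "\<eta> \<in> rep_hom G (tensor M W) (tensor N W)" "g = tr W M N \<eta>"
    using assms by (auto simp: traces_def)
  have "\<theta> - \<eta> \<in> rep_hom G (tensor M W) (tensor N W)"
    by (rule rep_hom_diff) (use \<theta> \<eta> assms in auto)
  moreover have "f - g = tr W M N (\<theta> - \<eta>)"
    using tr_diff [of \<theta> N W M \<eta>] \<theta> \<eta> rep_hom_carrier [OF \<theta>(1)] rep_hom_carrier [OF \<eta>(1)] by simp
  ultimately show ?thesis by (simp add: traces_def)
qed

lemma traces_zero:
  assumes "is_rep G M" "is_rep G N" "is_rep G W"
  shows "0\<^sub>m (deg N) (deg M) \<in> traces G W M N"
proof -
  have 0: "0\<^sub>m (deg N * deg W) (deg M * deg W) \<in> rep_hom G (tensor M W) (tensor N W)"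
    using rep_hom_zero [of G "tensor M W" "tensor N W"] assms by simp
  have "tr W M N (0\<^sub>m (deg N * deg W) (deg M * deg W) - 0\<^sub>m (deg N * deg W) (deg M * deg W)) = 0\<^sub>m (deg N) (deg M)"
    by (subst tr_diff) auto
  with 0 show ?thesis unfolding traces_def
    by (metis (no_types, lifting) image_eqI minus_r_inv_mat zero_carrier_mat)
qed

lemma traces_add:
  assumes "f \<in> traces G W M N" "g \<in> traces G W M N" "is_rep G M" "is_rep G N" "is_rep G W"
  shows "f + g \<in> traces G W M N"
proof -
  have dim: "dim_row f = deg N" "dim_col f = deg M" "dim_row g = deg N" "dim_col g = deg M"
    using assms by (auto simp: traces_def)
  have "f - (0\<^sub>m (deg N) (deg M) - g) \<in> traces G W M N"
    using assms by (intro traces_diff traces_zero)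
  moreover have "f - (0\<^sub>m (deg N) (deg M) - g) = f + g"
    by (rule mat_eqI) (use dim in auto)
  ultimately show ?thesis by simp
qed

lemma traces_tensor:
  assumes "f \<in> traces G W M N" "is_rep G M" "is_rep G N" "is_rep G W" "is_rep G A"
  shows "kron (1\<^sub>m (deg A)) f \<in> traces G W (tensor A M) (tensor A N)"
proof -
  obtain \<theta> where \<theta>: "\<theta> \<in> rep_hom G (tensor M W) (tensor N W)" "f = tr W M N \<theta>"
    using assms by (auto simp: traces_def)
  have "kron (1\<^sub>m (deg A)) \<theta> \<in> rep_hom G (tensor (tensor A M) W) (tensor (tensor A N) W)"
    unfolding tensor_assoc by (rule rep_hom_kron_left) (use \<theta> assms in auto)
  moreover have "kron (1\<^sub>m (deg A)) f = tr W (tensor A M) (tensor A N) (kron (1\<^sub>m (deg A)) \<theta>)"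
    using tr_tensor [of \<theta> N W M A] \<theta> rep_hom_carrier [OF \<theta>(1)] by simp
  ultimately show ?thesis by (simp add: traces_def)
qed

lemma traces_rep_hom:
  assumes "f \<in> traces G W M N" "group G" "is_rep G M" "is_rep G N" "is_rep G W"
  shows "f \<in> rep_hom G M N"
  using assms by (auto simp: traces_def tr_hom)

section \<open>Exactness and linear splittings\<close>

lemma zero_mult_vec [simp]: "v \<in> carrier_vec n \<Longrightarrow> 0\<^sub>m m n *\<^sub>v v = (0\<^sub>v m :: 'k::field vec)"
  by (rule eq_vecI) auto

lemma mult_zero_vec [simp]: "A \<in> carrier_mat m n \<Longrightarrow> A *\<^sub>v 0\<^sub>v n = (0\<^sub>v m :: 'k::field vec)"
  by (rule eq_vecI) auto

text \<open>A linear map can be lifted through \<open>a\<close> as soon as its values lie in the image of \<open>a\<close>: choose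
  preimages of the basis vectors.\<close>

lemma mat_lift:
  fixes a :: "'k::field mat"
  assumes "a \<in> carrier_mat m n" "h \<in> carrier_mat m l"
    and "\<And>v. v \<in> carrier_vec l \<Longrightarrow> h *\<^sub>v v \<in> mat_image a"
  obtains L where "L \<in> carrier_mat n l" "a * L = h"
proof -
  have "\<exists>v. v \<in> carrier_vec n \<and> a *\<^sub>v v = col h j" if "j < l" for j
  proof -
    have "h *\<^sub>v unit_vec l j = col h j"
      using assms(2) that by (intro eq_vecI) (auto simp: scalar_prod_right_unit)
    moreover have "h *\<^sub>v unit_vec l j \<in> mat_image a"
      by (rule assms(3)) simp
    ultimately show ?thesis using assms(1) by (auto simp: mat_image_def)
  qed
  then obtain v where v: "\<And>j. j < l \<Longrightarrow> v j \<in> carrier_vec n" "\<And>j. j < l \<Longrightarrow> a *\<^sub>v v j = col h j"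
    by metis
  define L where "L = mat_of_cols n (map v [0..<l])"
  have L: "L \<in> carrier_mat n l" by (auto simp: L_def intro: carrier_matI)
  have "a * L = h"
  proof (rule mat_col_eqI)
    fix j assume "j < dim_col h"
    then have j: "j < l" using assms by simp
    have "col (a * L) j = a *\<^sub>v col L j"
      using assms(1) L j by (rule col_mult2)
    also have "col L j = v j"
      using j v by (simp add: L_def)
    finally show "col (a * L) j = col h j" using v j by simp
  qed (use assms L in auto)
  with L show thesis by (rule that)
qed

lemma mat_image_mult:
  fixes a :: "'k::field mat"
  assumes "a \<in> carrier_mat m n" "v \<in> carrier_vec n"
  shows "a *\<^sub>v v \<in> mat_image a"
  using assms by (auto simp: mat_image_def)

lemma exact_lift:
  fixes a :: "'k::field mat"
  assumes "a \<in> carrier_mat m n" "b \<in> carrier_mat l m" "h \<in> carrier_mat m k"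
    and "mat_image a = mat_kernel b" "b * h = 0\<^sub>m l k"
  obtains L where "L \<in> carrier_mat n k" "a * L = h"
proof (rule mat_lift [OF assms(1,3)])
  fix v :: "'k vec" assume v: "v \<in> carrier_vec k"
  have "b *\<^sub>v (h *\<^sub>v v) = b * h *\<^sub>v v"
    using assms(2,3) v by (simp add: assoc_mult_mat_vec)
  then have "b *\<^sub>v (h *\<^sub>v v) = 0\<^sub>v l" using assms v by simp
  then show "h *\<^sub>v v \<in> mat_image a"
    unfolding assms(4) using assms v by (intro mat_kernelI [OF assms(2)]) auto
qed

lemma surj_lift:
  fixes g :: "'k::field mat"
  assumes "g \<in> carrier_mat m n" "mat_image g = carrier_vec m" "h \<in> carrier_mat m k"
  obtains L where "L \<in> carrier_mat n k" "g * L = h"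
  using mat_lift [OF assms(1,3)] assms by (metis mult_mat_vec_carrier)

lemma exact_comp:
  fixes a :: "'k::field mat"
  assumes "a \<in> carrier_mat m n" "b \<in> carrier_mat l m" "mat_image a \<subseteq> mat_kernel b"
  shows "b * a = 0\<^sub>m l n"
proof (rule mat_col_eqI)
  fix j assume "j < dim_col (0\<^sub>m l n :: 'k mat)"
  then have j: "j < n" by simp
  have "a *\<^sub>v unit_vec n j \<in> mat_kernel b"
    using assms(3) mat_image_mult [OF assms(1)] by auto
  then have "b *\<^sub>v (a *\<^sub>v unit_vec n j) = 0\<^sub>v l"
    by (rule mat_kernelD [OF assms(2)])
  moreover have "a *\<^sub>v unit_vec n j = col a j"
    using assms(1) j by (intro eq_vecI) (auto simp: scalar_prod_right_unit)
  moreover have "col (b * a) j = b *\<^sub>v col a j"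
    using assms(2,1) j by (rule col_mult2)
  ultimately show "col (b * a) j = col (0\<^sub>m l n) j" using j by simp
qed (use assms in auto)

lemma inj_cancel:
  fixes f :: "'k::field mat"
  assumes "f \<in> carrier_mat m n" "mat_kernel f = {0\<^sub>v n}" "A \<in> carrier_mat n k" "f * A = 0\<^sub>m m k"
  shows "A = 0\<^sub>m n k"
proof (rule mat_col_eqI)
  fix j assume "j < dim_col (0\<^sub>m n k :: 'k mat)"
  then have j: "j < k" by simp
  have "col (f * A) j = f *\<^sub>v col A j"
    using assms(1,3) j by (rule col_mult2)
  then have "f *\<^sub>v col A j = 0\<^sub>v m" using assms j by simp
  then have "col A j \<in> mat_kernel f"
    using assms j by (intro mat_kernelI [OF assms(1)]) auto
  then show "col A j = col (0\<^sub>m n k) j" using assms j by simp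
qed (use assms in auto)

lemma exactI:
  fixes a :: "'k::field mat"
  assumes "a \<in> carrier_mat m n" "b \<in> carrier_mat l m" "t \<in> carrier_mat n m" "u \<in> carrier_mat m l"
    and "b * a = 0\<^sub>m l n" "a * t + u * b = 1\<^sub>m m"
  shows "mat_image a = mat_kernel b"
proof (intro subset_antisym subsetI)
  fix v assume "v \<in> mat_image a"
  then obtain w where w: "w \<in> carrier_vec n" "v = a *\<^sub>v w" using assms by (auto simp: mat_image_def)
  have "b *\<^sub>v v = b * a *\<^sub>v w" using assms(1,2) w by (simp add: assoc_mult_mat_vec)
  then show "v \<in> mat_kernel b" using assms w by (intro mat_kernelI [OF assms(2)]) auto
next
  fix v assume v: "v \<in> mat_kernel b"
  note vD = mat_kernelD [OF assms(2) v]
  have "v = (a * t + u * b) *\<^sub>v v" using assms vD by simp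
  also have "\<dots> = a *\<^sub>v (t *\<^sub>v v) + u *\<^sub>v (b *\<^sub>v v)"
    using assms(1-4) vD(1)
    by (subst add_mult_distrib_mat_vec [of _ m m]) (auto simp: assoc_mult_mat_vec)
  also have "\<dots> = a *\<^sub>v (t *\<^sub>v v)" using assms vD by simp
  finally show "v \<in> mat_image a"
    using mat_image_mult [OF assms(1)] assms(3) vD by (metis mult_mat_vec_carrier)
qed

lemma surjI:
  fixes g :: "'k::field mat"
  assumes "g \<in> carrier_mat m n" "s \<in> carrier_mat n m" "g * s = 1\<^sub>m m"
  shows "mat_image g = carrier_vec m"
proof (intro subset_antisym subsetI)
  fix v :: "'k vec" assume v: "v \<in> carrier_vec m"
  have "g *\<^sub>v (s *\<^sub>v v) = g * s *\<^sub>v v" using assms(1,2) v by (simp add: assoc_mult_mat_vec)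
  then have "v = g *\<^sub>v (s *\<^sub>v v)" using assms v by simp
  then show "v \<in> mat_image g"
    using mat_image_mult [OF assms(1)] assms(2) v by (metis mult_mat_vec_carrier)
qed (use assms in \<open>auto simp: mat_image_def\<close>)

text \<open>
  A short exact sequence of modules together with a linear (not necessarily equivariant)
  splitting \<open>p\<close>, \<open>s\<close>.
\<close>

definition split_exact ::
  "('g, 'b) monoid_scheme \<Rightarrow> ('g, 'k::field) rep \<Rightarrow> ('g, 'k) rep \<Rightarrow> ('g, 'k) rep
     \<Rightarrow> 'k mat \<Rightarrow> 'k mat \<Rightarrow> 'k mat \<Rightarrow> 'k mat \<Rightarrow> bool" where
  "split_exact G X Y Z f g p s \<longleftrightarrow>
     is_rep G X \<and> is_rep G Y \<and> is_rep G Z \<and> f \<in> rep_hom G X Y \<and> g \<in> rep_hom G Y Z \<and>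
     p \<in> carrier_mat (deg X) (deg Y) \<and> s \<in> carrier_mat (deg Y) (deg Z) \<and>
     p * f = 1\<^sub>m (deg X) \<and> g * s = 1\<^sub>m (deg Z) \<and> g * f = 0\<^sub>m (deg Z) (deg X) \<and>
     f * p + s * g = 1\<^sub>m (deg Y)"

lemma split_exactD:
  assumes "split_exact G X Y Z f g p s"
  shows "is_rep G X" "is_rep G Y" "is_rep G Z" "f \<in> rep_hom G X Y" "g \<in> rep_hom G Y Z"
    "p \<in> carrier_mat (deg X) (deg Y)" "s \<in> carrier_mat (deg Y) (deg Z)"
    "p * f = 1\<^sub>m (deg X)" "g * s = 1\<^sub>m (deg Z)" "g * f = 0\<^sub>m (deg Z) (deg X)"
    "f * p + s * g = 1\<^sub>m (deg Y)"
  using assms by (auto simp: split_exact_def)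

lemma short_exact_if_split_exact:
  assumes "split_exact G X Y Z f g p s"
  shows "short_exact G X Y Z f g"
proof -
  note D = split_exactD [OF assms]
  note c = rep_hom_carrier [OF D(4)] rep_hom_carrier [OF D(5)]
  have "v = 0\<^sub>v (deg X)" if v: "v \<in> mat_kernel f" for v
  proof -
    note vD = mat_kernelD [OF c(1) v]
    have "v = p * f *\<^sub>v v" using D vD by simp
    also have "\<dots> = p *\<^sub>v (f *\<^sub>v v)" using D(6) c vD(1) by (simp add: assoc_mult_mat_vec)
    finally show ?thesis using vD D by simp
  qed
  moreover have "0\<^sub>v (deg X) \<in> mat_kernel f"
    using c by (intro mat_kernelI [OF c(1)]) auto
  ultimately have "mat_kernel f = {0\<^sub>v (deg X)}" by blast
  moreover have "mat_image f = mat_kernel g"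
    using exactI [OF c D(6,7,10,11)] .
  moreover have "mat_image g = carrier_vec (deg Z)"
    using surjI [OF c(2) D(7,9)] .
  ultimately show ?thesis
    using D(1-5) unfolding short_exact_def rep_surj_def by blast
qed

text \<open>Over a field every short exact sequence of modules splits linearly: \<open>s\<close> is a linear section of
  \<open>g\<close>, and \<open>p\<close> is the corestriction of \<open>1 - s g\<close> to the image of \<open>f\<close>.\<close>

lemma split_exact_if_short_exact:
  assumes "short_exact G X Y Z f g"
  obtains p s where "split_exact G X Y Z f g p s"
proof -
  have D: "is_rep G X" "is_rep G Y" "is_rep G Z" "f \<in> rep_hom G X Y" "g \<in> rep_hom G Y Z"
    "mat_image g = carrier_vec (deg Z)" "mat_kernel f = {0\<^sub>v (deg X)}" "mat_image f = mat_kernel g"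
    using assms by (auto simp: short_exact_def rep_surj_def)
  note c = rep_hom_carrier [OF D(4)] rep_hom_carrier [OF D(5)]
  obtain s where s: "s \<in> carrier_mat (deg Y) (deg Z)" "g * s = 1\<^sub>m (deg Z)"
    using surj_lift [OF c(2) D(6) one_carrier_mat] by blast
  have gf: "g * f = 0\<^sub>m (deg Z) (deg X)"
    using exact_comp [OF c] D(8) by simp
  let ?e = "1\<^sub>m (deg Y) - s * g"
  have e: "?e \<in> carrier_mat (deg Y) (deg Y)"
    using s c by (auto intro: carrier_matI)
  have "g * ?e = g - g * s * g"
    using s(1) c by (simp add: mat_diff_left mat_assoc)
  also have "\<dots> = 0\<^sub>m (deg Z) (deg Y)"
    unfolding s(2) using c by simp
  finally have "g * ?e = 0\<^sub>m (deg Z) (deg Y)" .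
  then obtain p where p: "p \<in> carrier_mat (deg X) (deg Y)" "f * p = ?e"
    using exact_lift [OF c e D(8)] by auto
  have sum: "f * p + s * g = 1\<^sub>m (deg Y)"
    unfolding p using s c by (intro mat_eqI) auto
  have "f * (p * f) = (1\<^sub>m (deg Y) - s * g) * f"
    using p c by (simp add: mat_assoc [symmetric])
  also have "\<dots> = f - s * (g * f)"
    using s c by (simp add: mat_diff_right mat_assoc)
  also have "\<dots> = f"
    unfolding gf using s c by (intro mat_eqI) auto
  finally have "f * (p * f - 1\<^sub>m (deg X)) = 0\<^sub>m (deg Y) (deg X)"
    using p c by (simp add: mat_diff_left)
  then have "p * f - 1\<^sub>m (deg X) = 0\<^sub>m (deg X) (deg X)"
    using p c by (intro inj_cancel [OF c(1) D(7)]) (auto intro: carrier_matI)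
  then have "p * f = 1\<^sub>m (deg X)"
    using mat_eq_iff_diff [of "p * f" "1\<^sub>m (deg X)"] p c by simp
  with sum gf s p D have "split_exact G X Y Z f g p s"
    by (simp add: split_exact_def)
  then show thesis by (rule that)
qed

text \<open>The universal properties of the kernel and of the cokernel, for equivariant maps.\<close>

lemma split_exact_lift:
  assumes "split_exact G X Y Z f g p s" "h \<in> rep_hom G T Y" "is_rep G T" "g * h = 0\<^sub>m (deg Z) (deg T)"
  obtains k where "k \<in> rep_hom G T X" "f * k = h"
proof -
  note D = split_exactD [OF assms(1)]
  note d = rep_hom_dim [OF D(4)] rep_hom_dim [OF D(5)] rep_hom_dim [OF assms(2)]
    carrier_matD [OF D(6)] carrier_matD [OF D(7)]
  have "h = (f * p + s * g) * h" using D assms by simp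
  also have "\<dots> = f * (p * h) + s * (g * h)" using d by (simp add: mat_distrib_right mat_assoc)
  also have "\<dots> = f * (p * h)" unfolding assms(4) by (rule mat_eqI) (use d in auto)
  finally have h: "f * (p * h) = h" by simp
  have "p * h \<in> rep_hom G T X"
  proof (rule rep_homI)
    fix x assume x: "x \<in> carrier G"
    note dx = rep_dim [OF D(1) x] rep_dim [OF D(2) x] rep_dim [OF assms(3) x]
    have "p * h * act T x = p * (act Y x * (f * (p * h)))"
      using d dx h rep_homD [OF assms(2) x] by (simp add: mat_assoc)
    also have "act Y x * (f * (p * h)) = f * act X x * (p * h)"
      using d dx by (simp add: mat_assoc [symmetric] rep_homD [OF D(4) x])
    also have "p * (f * act X x * (p * h)) = p * f * (act X x * (p * h))"
      using d dx by (simp add: mat_assoc)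
    finally show "p * h * act T x = act X x * (p * h)"
      using D(8) d dx by simp
  qed (use d in \<open>auto intro: carrier_matI\<close>)
  then show thesis using h by (rule that)
qed

lemma split_exact_descend:
  assumes "split_exact G X Y Z f g p s" "h \<in> rep_hom G Y T" "is_rep G T" "h * f = 0\<^sub>m (deg T) (deg X)"
  obtains k where "k \<in> rep_hom G Z T" "k * g = h"
proof -
  note D = split_exactD [OF assms(1)]
  note d = rep_hom_dim [OF D(4)] rep_hom_dim [OF D(5)] rep_hom_dim [OF assms(2)]
    carrier_matD [OF D(6)] carrier_matD [OF D(7)]
  have "h = h * (f * p + s * g)" using D assms by simp
  also have "\<dots> = h * f * p + h * s * g" using d by (simp add: mat_distrib_left mat_assoc)
  also have "\<dots> = h * s * g" unfolding assms(4) by (rule mat_eqI) (use d in auto)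
  finally have h: "h * s * g = h" by simp
  have "h * s \<in> rep_hom G Z T"
  proof (rule rep_homI)
    fix x assume x: "x \<in> carrier G"
    note dx = rep_dim [OF D(3) x] rep_dim [OF D(2) x] rep_dim [OF assms(3) x]
    have "act T x * (h * s) = act T x * h * s"
      using d dx by (simp add: mat_assoc)
    also have "\<dots> = h * s * g * act Y x * s"
      using h rep_homD [OF assms(2) x] by simp
    also have "\<dots> = h * s * (g * act Y x) * s"
      using d dx by (simp add: mat_assoc)
    also have "\<dots> = h * s * act Z x * (g * s)"
      using d dx by (simp add: mat_assoc rep_homD [OF D(5) x])
    finally show "h * s * act Z x = act T x * (h * s)"
      using D(9) d dx by simp
  qed (use d in \<open>auto intro: carrier_matI\<close>)
  then show thesis using h by (rule that)
qed

lemma split_exact_epi: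
  assumes "split_exact G X Y Z f g p s" "a * g = b * g" "dim_col a = deg Z" "dim_col b = deg Z"
  shows "a = b"
proof -
  note D = split_exactD [OF assms(1)]
  have "a * g * s = a * (g * s)" "b * g * s = b * (g * s)"
    using assms(3,4) D(3,5,7) by (simp_all add: mat_assoc)
  then have "a * (g * s) = b * (g * s)" using assms(2) by metis
  then have "a * 1\<^sub>m (deg Z) = b * 1\<^sub>m (deg Z)" unfolding D(9) .
  then show ?thesis using assms(3,4) by simp
qed

lemma split_exact_mono:
  assumes "split_exact G X Y Z f g p s" "f * a = f * b" "dim_row a = deg X" "dim_row b = deg X"
  shows "a = b"
proof -
  note D = split_exactD [OF assms(1)]
  have "p * f * a = p * (f * a)" "p * f * b = p * (f * b)"
    using assms(3,4) D(1,4,6) by (simp_all add: mat_assoc)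
  then have "p * f * a = p * f * b" using assms(2) by metis
  then have "1\<^sub>m (deg X) * a = 1\<^sub>m (deg X) * b" unfolding D(8) .
  then show ?thesis using assms(3,4) by simp
qed

lemma split_exact_tensor_left:
  assumes "split_exact G X Y Z f g p s" "is_rep G A"
  shows "split_exact G (tensor A X) (tensor A Y) (tensor A Z) (kron (1\<^sub>m (deg A)) f)
    (kron (1\<^sub>m (deg A)) g) (kron (1\<^sub>m (deg A)) p) (kron (1\<^sub>m (deg A)) s)"
proof -
  note D = split_exactD [OF assms(1)]
  note d = rep_hom_dim [OF D(4)] rep_hom_dim [OF D(5)] carrier_matD [OF D(6)] carrier_matD [OF D(7)]
  have "kron (1\<^sub>m (deg A)) f * kron (1\<^sub>m (deg A)) p + kron (1\<^sub>m (deg A)) s * kron (1\<^sub>m (deg A)) g =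
      kron (1\<^sub>m (deg A)) (f * p + s * g)"
    using d by (simp add: kron_mult kron_add_right)
  with D d show ?thesis
    using assms(2) by (auto simp: split_exact_def kron_mult rep_hom_kron_left)
qed

lemma split_exact_tensor_right:
  assumes "split_exact G X Y Z f g p s" "is_rep G A"
  shows "split_exact G (tensor X A) (tensor Y A) (tensor Z A) (kron f (1\<^sub>m (deg A)))
    (kron g (1\<^sub>m (deg A))) (kron p (1\<^sub>m (deg A))) (kron s (1\<^sub>m (deg A)))"
proof -
  note D = split_exactD [OF assms(1)]
  note d = rep_hom_dim [OF D(4)] rep_hom_dim [OF D(5)] carrier_matD [OF D(6)] carrier_matD [OF D(7)]
  have "kron f (1\<^sub>m (deg A)) * kron p (1\<^sub>m (deg A)) + kron s (1\<^sub>m (deg A)) * kron g (1\<^sub>m (deg A)) =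
      kron (f * p + s * g) (1\<^sub>m (deg A))"
    using d by (simp add: kron_mult kron_add_left)
  with D d show ?thesis
    using assms(2) by (auto simp: split_exact_def kron_mult rep_hom_kron_right)
qed

text \<open>Two short exact sequences spliced at \<open>X\<close>.\<close>

lemma split_exact_splice:
  assumes S': "split_exact G X' Y' X j' e' p' s'" and S: "split_exact G X Y Z j e p s"
  shows "mat_image (j * e') = mat_kernel e" "mat_kernel (j * e') = mat_kernel e'"
proof -
  note D = split_exactD [OF S] and D' = split_exactD [OF S']
  note d = rep_hom_dim [OF D(4)] rep_hom_dim [OF D(5)] carrier_matD [OF D(6)] carrier_matD [OF D(7)]
    rep_hom_dim [OF D'(5)] carrier_matD [OF D'(7)]
  note c = rep_hom_carrier [OF D(4)] rep_hom_carrier [OF D(5)] rep_hom_carrier [OF D'(5)]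
  have je: "j * e' \<in> carrier_mat (deg Y) (deg Y')" using c by auto
  have "e * (j * e') = e * j * e'" using d by (simp add: mat_assoc)
  then have 0: "e * (j * e') = 0\<^sub>m (deg Z) (deg Y')" unfolding D(10) using d by simp
  have "j * e' * (s' * p) = j * (e' * s' * p)" using d by (simp add: mat_assoc)
  then have 1: "j * e' * (s' * p) + s * e = 1\<^sub>m (deg Y)" unfolding D'(9) using d D(11) by simp
  show "mat_image (j * e') = mat_kernel e"
    by (rule exactI [OF je c(2) _ D(7) 0 1]) (use D D' in auto)
  show "mat_kernel (j * e') = mat_kernel e'"
  proof (rule subset_antisym [OF _ mat_kernel_mult_subset [OF c(3,1)]])
    have "p * (j * e') = p * j * e'" using d by (simp add: mat_assoc)
    then have "p * (j * e') = e'" unfolding D(8) using d by simp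
    then show "mat_kernel (j * e') \<subseteq> mat_kernel e'"
      using mat_kernel_mult_subset [OF je D(6)] by simp
  qed
qed

text \<open>The kernel and the cokernel of an equivariant map with a given linear splitting.\<close>

lemma split_exact_kernel:
  assumes "is_rep G Y" "is_rep G Z" "g \<in> rep_hom G Y Z"
    and m: "f \<in> carrier_mat (deg Y) m" "p \<in> carrier_mat m (deg Y)" "s \<in> carrier_mat (deg Y) (deg Z)"
    and "p * f = 1\<^sub>m m" "g * s = 1\<^sub>m (deg Z)" "g * f = 0\<^sub>m (deg Z) m" "f * p + s * g = 1\<^sub>m (deg Y)"
  shows "split_exact G (Rep m (\<lambda>x. p * act Y x * f)) Y Z f g p s"
proof -
  let ?X = "Rep m (\<lambda>x. p * act Y x * f)"
  note d = rep_hom_dim [OF assms(3)] carrier_matD [OF m(1)] carrier_matD [OF m(2)] carrier_matD [OF m(3)]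
  have key: "f * (p * (act Y x * f)) = act Y x * f" if x: "x \<in> carrier G" for x
  proof -
    note dx = rep_dim [OF assms(1) x] rep_dim [OF assms(2) x]
    have "g * (act Y x * f) = act Z x * (g * f)"
      using d dx by (simp add: mat_assoc [symmetric] rep_homD [OF assms(3) x])
    then have 0: "g * (act Y x * f) = 0\<^sub>m (deg Z) m"
      unfolding assms(9) using dx by simp
    have "act Y x * f = (f * p + s * g) * (act Y x * f)" using assms d dx by simp
    also have "\<dots> = f * (p * (act Y x * f)) + s * (g * (act Y x * f))"
      using d dx by (simp add: mat_distrib_right mat_assoc)
    also have "\<dots> = f * (p * (act Y x * f))" unfolding 0 by (rule mat_eqI) (use d dx in auto)
    finally show ?thesis by simp
  qed
  have "is_rep G ?X"
  proof (rule is_repI)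
    fix x y assume x: "x \<in> carrier G" and y: "y \<in> carrier G"
    note dx = rep_dim [OF assms(1) x] rep_dim [OF assms(1) y]
    have "p * act Y x * f * (p * act Y y * f) = p * (act Y x * (f * (p * (act Y y * f))))"
      using d dx by (simp add: mat_assoc)
    also have "\<dots> = p * act Y (x \<otimes>\<^bsub>G\<^esub> y) * f"
      unfolding key [OF y] rep_mult [OF assms(1) x y] using d dx by (simp add: mat_assoc)
    finally show "act ?X (x \<otimes>\<^bsub>G\<^esub> y) = act ?X x * act ?X y" by simp
  qed (use assms d in \<open>auto simp: rep_dim rep_one intro: carrier_matI\<close>)
  moreover have "f \<in> rep_hom G ?X Y"
  proof (rule rep_homI)
    fix x assume x: "x \<in> carrier G"
    note dx = rep_dim [OF assms(1) x]
    have "f * (p * act Y x * f) = f * (p * (act Y x * f))" using d dx by (simp add: mat_assoc)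
    then show "f * act ?X x = act Y x * f" using key [OF x] by simp
  qed (use m in auto)
  ultimately show ?thesis using assms by (simp add: split_exact_def)
qed

lemma split_exact_cokernel:
  assumes "is_rep G X" "is_rep G Y" "f \<in> rep_hom G X Y"
    and m: "g \<in> carrier_mat m (deg Y)" "p \<in> carrier_mat (deg X) (deg Y)" "s \<in> carrier_mat (deg Y) m"
    and "p * f = 1\<^sub>m (deg X)" "g * s = 1\<^sub>m m" "g * f = 0\<^sub>m m (deg X)" "f * p + s * g = 1\<^sub>m (deg Y)"
  shows "split_exact G X Y (Rep m (\<lambda>x. g * act Y x * s)) f g p s"
proof -
  let ?Z = "Rep m (\<lambda>x. g * act Y x * s)"
  note d = rep_hom_dim [OF assms(3)] carrier_matD [OF m(1)] carrier_matD [OF m(2)] carrier_matD [OF m(3)]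
  have key: "g * act Y x * s * g = g * act Y x" if x: "x \<in> carrier G" for x
  proof -
    note dx = rep_dim [OF assms(1) x] rep_dim [OF assms(2) x]
    have "g * act Y x * f = g * f * act X x"
      using d dx by (simp add: mat_assoc rep_homD [OF assms(3) x])
    then have 0: "g * act Y x * f = 0\<^sub>m m (deg X)"
      unfolding assms(9) using dx by simp
    have "g * act Y x = g * act Y x * (f * p + s * g)" using assms d dx by simp
    also have "\<dots> = g * act Y x * f * p + g * act Y x * s * g"
      using d dx by (simp add: mat_distrib_left mat_assoc)
    also have "\<dots> = g * act Y x * s * g" unfolding 0 by (rule mat_eqI) (use d dx in auto)
    finally show ?thesis by simp
  qed
  have "is_rep G ?Z"
  proof (rule is_repI)
    fix x y assume x: "x \<in> carrier G" and y: "y \<in> carrier G"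
    note dx = rep_dim [OF assms(2) x] rep_dim [OF assms(2) y]
    have "g * act Y x * s * (g * act Y y * s) = g * act Y x * s * g * (act Y y * s)"
      using d dx by (simp add: mat_assoc)
    also have "\<dots> = g * act Y (x \<otimes>\<^bsub>G\<^esub> y) * s"
      unfolding key [OF x] rep_mult [OF assms(2) x y] using d dx by (simp add: mat_assoc)
    finally show "act ?Z (x \<otimes>\<^bsub>G\<^esub> y) = act ?Z x * act ?Z y" by simp
  qed (use assms d in \<open>auto simp: rep_dim rep_one intro: carrier_matI\<close>)
  moreover have "g \<in> rep_hom G Y ?Z"
    by (rule rep_homI) (use m key in auto)
  ultimately show ?thesis using assms by (simp add: split_exact_def)
qed

text \<open>Bases adapted to a row vector, or to a column vector, whose first entry is \<open>1\<close>.\<close>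

lemma row_splitting:
  fixes g :: "'k::field mat"
  assumes "g \<in> carrier_mat 1 (Suc m)" "g $$ (0, 0) = 1"
  obtains f p s where "f \<in> carrier_mat (Suc m) m" "p \<in> carrier_mat m (Suc m)" "s \<in> carrier_mat (Suc m) 1"
    "p * f = 1\<^sub>m m" "g * s = 1\<^sub>m 1" "g * f = 0\<^sub>m 1 m" "f * p + s * g = 1\<^sub>m (Suc m)"
proof
  let ?f = "mat (Suc m) m (\<lambda>(i, j). if i = 0 then - g $$ (0, Suc j) else if i = Suc j then 1 else 0)"
  let ?p = "mat m (Suc m) (\<lambda>(i, j). if j = Suc i then 1 else 0 :: 'k)"
  let ?s = "mat (Suc m) 1 (\<lambda>(i, j). if i = 0 then 1 else 0 :: 'k)"
  have d: "dim_row g = 1" "dim_col g = Suc m" using assms by auto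
  have if_mult: "(if P then 1 else 0) * x = (if P then x else 0)"
    "x * (if P then 1 else 0) = (if P then x else 0)" for P and x :: 'k by auto
  show "?f \<in> carrier_mat (Suc m) m" "?p \<in> carrier_mat m (Suc m)" "?s \<in> carrier_mat (Suc m) 1"
    by auto
  show "?p * ?f = 1\<^sub>m m"
    by (rule mat_eqI) (auto simp: mult_index if_mult simp del: index_mult_mat(1))
  show "g * ?s = 1\<^sub>m 1"
    by (rule mat_eqI) (auto simp: mult_index if_mult d assms simp del: index_mult_mat(1))
  show "g * ?f = 0\<^sub>m 1 m"
    by (rule mat_eqI)
      (auto simp: mult_index if_mult d assms sum.lessThan_Suc_shift simp del: index_mult_mat(1) sum.lessThan_Suc)
  show "?f * ?p + ?s * g = 1\<^sub>m (Suc m)"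
  proof (rule mat_eqI, goal_cases)
    case (3 i j)
    then show ?case
      by (cases j) (auto simp: mult_index if_mult d assms simp del: index_mult_mat(1))
  qed (use d in auto)
qed

lemma col_splitting:
  fixes f :: "'k::field mat"
  assumes "f \<in> carrier_mat (Suc m) 1" "f $$ (0, 0) = 1"
  obtains g p s where "g \<in> carrier_mat m (Suc m)" "s \<in> carrier_mat (Suc m) m" "p \<in> carrier_mat 1 (Suc m)"
    "g * s = 1\<^sub>m m" "p * f = 1\<^sub>m 1" "g * f = 0\<^sub>m m 1" "f * p + s * g = 1\<^sub>m (Suc m)"
proof -
  have t: "transpose_mat f \<in> carrier_mat 1 (Suc m)" "transpose_mat f $$ (0, 0) = 1"
    using assms by auto
  obtain f' p' s' where *: "f' \<in> carrier_mat (Suc m) m" "p' \<in> carrier_mat m (Suc m)" "s' \<in> carrier_mat (Suc m) 1"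
    "p' * f' = 1\<^sub>m m" "transpose_mat f * s' = 1\<^sub>m 1" "transpose_mat f * f' = 0\<^sub>m 1 m"
    "f' * p' + s' * transpose_mat f = 1\<^sub>m (Suc m)"
    using row_splitting [OF t] .
  show thesis
  proof
    show "transpose_mat f' \<in> carrier_mat m (Suc m)" "transpose_mat p' \<in> carrier_mat (Suc m) m"
      "transpose_mat s' \<in> carrier_mat 1 (Suc m)"
      using * by auto
    show "transpose_mat f' * transpose_mat p' = 1\<^sub>m m"
      using * by (simp add: transpose_mult [symmetric, of p' m "Suc m"])
    show "transpose_mat s' * f = 1\<^sub>m 1"
      using arg_cong [OF *(5), of transpose_mat] *(3) t(1) by (simp add: transpose_mult)
    show "transpose_mat f' * f = 0\<^sub>m m 1"
      using arg_cong [OF *(6), of transpose_mat] *(1) t(1) by (simp add: transpose_mult)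
    have "1\<^sub>m (Suc m) = transpose_mat (f' * p') + transpose_mat (s' * transpose_mat f)"
      using arg_cong [OF *(7), of transpose_mat] *(1,2,3) t(1)
      by (subst (asm) transpose_add [of _ "Suc m" "Suc m"]) auto
    also have "transpose_mat (f' * p') = transpose_mat p' * transpose_mat f'"
      using *(1,2) by (simp add: transpose_mult)
    also have "transpose_mat (s' * transpose_mat f) = f * transpose_mat s'"
      using *(3) t(1) by (simp add: transpose_mult)
    also have "transpose_mat p' * transpose_mat f' + f * transpose_mat s' = f * transpose_mat s' + transpose_mat p' * transpose_mat f'"
      using * assms by (intro comm_add_mat [of _ "Suc m" "Suc m"]) auto
    finally show "f * transpose_mat s' + transpose_mat p' * transpose_mat f' = 1\<^sub>m (Suc m)" by simp
  qed
qed

section \<open>Averaging and projectivity\<close>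

text \<open>The sum of \<open>F x\<close> over the group, for matrices \<open>F x\<close> of size \<open>a \<times> b\<close>.\<close>

definition group_sum :: "('g, 'b) monoid_scheme \<Rightarrow> nat \<Rightarrow> nat \<Rightarrow> ('g \<Rightarrow> 'k::field mat) \<Rightarrow> 'k mat" where
  "group_sum G a b F = mat a b (\<lambda>ij. \<Sum>x\<in>carrier G. F x $$ ij)"

lemma group_sum_dim [simp]: "dim_row (group_sum G a b F) = a" "dim_col (group_sum G a b F) = b"
  by (simp_all add: group_sum_def)

lemma group_sum_cong:
  "(\<And>x. x \<in> carrier G \<Longrightarrow> F x = F' x) \<Longrightarrow> group_sum G a b F = group_sum G a b F'"
  unfolding group_sum_def by (metis (mono_tags, lifting) sum.cong)

lemma group_sum_left:
  assumes "\<And>x. x \<in> carrier G \<Longrightarrow> F x \<in> carrier_mat a b" "L \<in> carrier_mat c a"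
  shows "L * group_sum G a b F = group_sum G c b (\<lambda>x. L * F x)"
proof (rule mat_eqI, goal_cases)
  case (3 i j)
  then have ij: "i < c" "j < b" by auto
  have "(L * group_sum G a b F) $$ (i, j) = (\<Sum>k<a. \<Sum>x\<in>carrier G. L $$ (i, k) * F x $$ (k, j))"
    using ij assms(2) by (subst mult_index) (auto simp: group_sum_def sum_distrib_left)
  also have "\<dots> = (\<Sum>x\<in>carrier G. \<Sum>k<a. L $$ (i, k) * F x $$ (k, j))"
    by (rule sum.swap)
  also have "\<dots> = (\<Sum>x\<in>carrier G. (L * F x) $$ (i, j))"
  proof (rule sum.cong [OF refl])
    fix x assume "x \<in> carrier G"
    then show "(\<Sum>k<a. L $$ (i, k) * F x $$ (k, j)) = (L * F x) $$ (i, j)"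
      using ij assms by (subst mult_index) auto
  qed
  finally show ?case using ij by (simp add: group_sum_def)
qed (use assms in auto)

lemma group_sum_right:
  assumes "\<And>x. x \<in> carrier G \<Longrightarrow> F x \<in> carrier_mat a b" "L \<in> carrier_mat b c"
  shows "group_sum G a b F * L = group_sum G a c (\<lambda>x. F x * L)"
proof (rule mat_eqI, goal_cases)
  case (3 i j)
  then have ij: "i < a" "j < c" by auto
  have "(group_sum G a b F * L) $$ (i, j) = (\<Sum>k<b. \<Sum>x\<in>carrier G. F x $$ (i, k) * L $$ (k, j))"
    using ij assms(2) by (subst mult_index) (auto simp: group_sum_def sum_distrib_right)
  also have "\<dots> = (\<Sum>x\<in>carrier G. \<Sum>k<b. F x $$ (i, k) * L $$ (k, j))"
    by (rule sum.swap)
  also have "\<dots> = (\<Sum>x\<in>carrier G. (F x * L) $$ (i, j))"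
  proof (rule sum.cong [OF refl])
    fix x assume "x \<in> carrier G"
    then show "(\<Sum>k<b. F x $$ (i, k) * L $$ (k, j)) = (F x * L) $$ (i, j)"
      using ij assms by (subst mult_index) auto
  qed
  finally show ?case using ij by (simp add: group_sum_def)
qed (use assms in auto)

lemma group_sum_kron:
  assumes "\<And>x. x \<in> carrier G \<Longrightarrow> F x \<in> carrier_mat a b" "L \<in> carrier_mat c d"
  shows "kron (group_sum G a b F) L = group_sum G (a * c) (b * d) (\<lambda>x. kron (F x) L)"
proof (rule mat_eqI, goal_cases)
  case (3 i j)
  then have i: "i < a * c" and j: "j < b * d" by auto
  have "kron (F x) L $$ (i, j) = F x $$ (i div c, j div d) * L $$ (i mod c, j mod d)"
    if "x \<in> carrier G" for x
    using assms(1) [OF that] assms(2) i j by (subst kron_index) auto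
  then show ?case
    using assms(2) i j divmod_less [OF i] divmod_less [OF j]
    by (simp add: kron_index group_sum_def sum_distrib_right)
qed (use assms in auto)

text \<open>The average \<open>\<Sum>\<^sub>x x L x\<^sup>-\<^sup>1\<close> of a linear map, without normalization.\<close>

definition average ::
  "('g, 'b) monoid_scheme \<Rightarrow> ('g, 'k::field) rep \<Rightarrow> ('g, 'k) rep \<Rightarrow> 'k mat \<Rightarrow> 'k mat" where
  "average G A B L = group_sum G (deg B) (deg A) (\<lambda>x. act B x * (L * act A (inv\<^bsub>G\<^esub> x)))"

text \<open>Higman's criterion: the identity is an average.\<close>

definition higman :: "('g, 'b) monoid_scheme \<Rightarrow> ('g, 'k::field) rep \<Rightarrow> bool" where
  "higman G P \<longleftrightarrow> (\<exists>\<pi>\<in>carrier_mat (deg P) (deg P). average G P P \<pi> = 1\<^sub>m (deg P))"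

context
  fixes G :: "('g, 'b) monoid_scheme"
  assumes G: "group G"
begin

lemma average_summand_carrier:
  assumes "is_rep G A" "is_rep G B" "L \<in> carrier_mat (deg B) (deg A)" "x \<in> carrier G"
  shows "act B x * (L * act A (inv\<^bsub>G\<^esub> x)) \<in> carrier_mat (deg B) (deg A)"
  using assms G by (auto simp: is_rep_def)

lemma average_hom:
  assumes "is_rep G A" "is_rep G B" "L \<in> carrier_mat (deg B) (deg A)"
  shows "average G A B L \<in> rep_hom G A B"
proof (rule rep_homI)
  fix y assume y: "y \<in> carrier G"
  let ?F = "\<lambda>x. act B x * (L * act A (inv\<^bsub>G\<^esub> x \<otimes>\<^bsub>G\<^esub> y))"
  have yc: "act A y \<in> carrier_mat (deg A) (deg A)" "act B y \<in> carrier_mat (deg B) (deg B)"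
    using assms y by (auto simp: is_rep_def)
  have inv: "inv\<^bsub>G\<^esub> x \<in> carrier G" if "x \<in> carrier G" for x
    using that G by simp
  have "average G A B L * act A y =
      group_sum G (deg B) (deg A) (\<lambda>x. act B x * (L * act A (inv\<^bsub>G\<^esub> x)) * act A y)"
    unfolding average_def using average_summand_carrier [OF assms] yc(1) by (rule group_sum_right)
  also have "\<dots> = group_sum G (deg B) (deg A) ?F"
    using assms y inv by (intro group_sum_cong) (simp add: mat_assoc rep_dim rep_mult)
  finally have 1: "average G A B L * act A y = group_sum G (deg B) (deg A) ?F" .
  have "act B y * average G A B L =
      group_sum G (deg B) (deg A) (\<lambda>x. act B y * (act B x * (L * act A (inv\<^bsub>G\<^esub> x))))"
    unfolding average_def using average_summand_carrier [OF assms] yc(2) by (rule group_sum_left)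
  also have "\<dots> = group_sum G (deg B) (deg A) (\<lambda>x. ?F (y \<otimes>\<^bsub>G\<^esub> x))"
  proof (rule group_sum_cong)
    fix x assume x: "x \<in> carrier G"
    interpret group G by (rule G)
    have "inv\<^bsub>G\<^esub> (y \<otimes>\<^bsub>G\<^esub> x) \<otimes>\<^bsub>G\<^esub> y = inv\<^bsub>G\<^esub> x"
      using x y by (simp add: inv_mult_group m_assoc)
    then show "act B y * (act B x * (L * act A (inv\<^bsub>G\<^esub> x))) = ?F (y \<otimes>\<^bsub>G\<^esub> x)"
      using assms x y inv by (simp add: mat_assoc rep_dim rep_mult)
  qed
  also have "\<dots> = group_sum G (deg B) (deg A) ?F"
  proof -
    interpret group G by (rule G)
    have "(\<Sum>x\<in>carrier G. ?F (y \<otimes>\<^bsub>G\<^esub> x) $$ ij) = (\<Sum>x\<in>carrier G. ?F x $$ ij)" for ij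
      by (rule sum.reindex_bij_witness [of _ "\<lambda>x. inv\<^bsub>G\<^esub> y \<otimes>\<^bsub>G\<^esub> x" "\<lambda>x. y \<otimes>\<^bsub>G\<^esub> x"])
        (use y in \<open>auto simp: m_assoc [symmetric]\<close>)
    then show ?thesis by (simp add: group_sum_def)
  qed
  finally show "average G A B L * act A y = act B y * average G A B L" using 1 by simp
qed (auto simp: average_def intro: carrier_matI)

lemma average_left:
  assumes "is_rep G A" "is_rep G B" "is_rep G C" "L \<in> carrier_mat (deg B) (deg A)" "f \<in> rep_hom G B C"
  shows "f * average G A B L = average G A C (f * L)"
proof -
  have "f * average G A B L = group_sum G (deg C) (deg A) (\<lambda>x. f * (act B x * (L * act A (inv\<^bsub>G\<^esub> x))))"
    unfolding average_def
    using average_summand_carrier [OF assms(1,2,4)] rep_hom_carrier [OF assms(5)] by (rule group_sum_left)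
  also have "\<dots> = average G A C (f * L)"
    unfolding average_def
  proof (rule group_sum_cong)
    fix x assume x: "x \<in> carrier G"
    then have ix: "inv\<^bsub>G\<^esub> x \<in> carrier G" using G by simp
    note d = rep_dim [OF assms(1) ix] rep_dim [OF assms(2) x] rep_dim [OF assms(3) x]
      rep_hom_dim [OF assms(5)] carrier_matD [OF assms(4)]
    have "f * (act B x * (L * act A (inv\<^bsub>G\<^esub> x))) = f * act B x * (L * act A (inv\<^bsub>G\<^esub> x))"
      using d by (simp add: mat_assoc)
    then show "f * (act B x * (L * act A (inv\<^bsub>G\<^esub> x))) = act C x * (f * L * act A (inv\<^bsub>G\<^esub> x))"
      unfolding rep_homD [OF assms(5) x] using d by (simp add: mat_assoc)
  qed
  finally show ?thesis .
qed

lemma average_right: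
  assumes "is_rep G A" "is_rep G B" "is_rep G C" "L \<in> carrier_mat (deg B) (deg A)" "f \<in> rep_hom G C A"
  shows "average G A B L * f = average G C B (L * f)"
proof -
  have "average G A B L * f = group_sum G (deg B) (deg C) (\<lambda>x. act B x * (L * act A (inv\<^bsub>G\<^esub> x)) * f)"
    unfolding average_def
    using average_summand_carrier [OF assms(1,2,4)] rep_hom_carrier [OF assms(5)] by (rule group_sum_right)
  also have "\<dots> = average G C B (L * f)"
    unfolding average_def
  proof (rule group_sum_cong)
    fix x assume x: "x \<in> carrier G"
    then have ix: "inv\<^bsub>G\<^esub> x \<in> carrier G" using G by simp
    note d = rep_dim [OF assms(1) ix] rep_dim [OF assms(2) x] rep_dim [OF assms(3) ix]
      rep_hom_dim [OF assms(5)] carrier_matD [OF assms(4)]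
    have "act B x * (L * act A (inv\<^bsub>G\<^esub> x)) * f = act B x * (L * (act A (inv\<^bsub>G\<^esub> x) * f))"
      using d by (simp add: mat_assoc)
    then show "act B x * (L * act A (inv\<^bsub>G\<^esub> x)) * f = act B x * (L * f * act C (inv\<^bsub>G\<^esub> x))"
      unfolding rep_homD [OF assms(5) ix, symmetric] using d by (simp add: mat_assoc)
  qed
  finally show ?thesis .
qed

text \<open>The lift is the average of a linear lift.  No module structure on the image of \<open>a\<close> is needed.\<close>

lemma higman_lift:
  assumes "is_rep G P" "higman G P" "is_rep G A" "is_rep G B"
    and "a \<in> rep_hom G A B" "h \<in> rep_hom G P B"
    and L: "L \<in> carrier_mat (deg A) (deg P)" "a * L = h"
  obtains k where "k \<in> rep_hom G P A" "a * k = h"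
proof -
  obtain \<pi> where \<pi>: "\<pi> \<in> carrier_mat (deg P) (deg P)" "average G P P \<pi> = 1\<^sub>m (deg P)"
    using assms(2) by (auto simp: higman_def)
  have L\<pi>: "L * \<pi> \<in> carrier_mat (deg A) (deg P)" using L \<pi> by auto
  have "a * average G P A (L * \<pi>) = average G P B (a * (L * \<pi>))"
    using assms(1,3,4) L\<pi> assms(5) by (rule average_left)
  also have "a * (L * \<pi>) = h * \<pi>"
    using L \<pi>(1) assms(5) by (simp add: mat_assoc [symmetric] del: assoc_mult_mat)
  also have "average G P B (h * \<pi>) = h * average G P P \<pi>"
    using average_left [OF assms(1,1,4) \<pi>(1) assms(6)] by simp
  also have "\<dots> = h" using \<pi>(2) assms(6) by simp
  finally have "a * average G P A (L * \<pi>) = h" .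
  then show thesis using average_hom [OF assms(1,3) L\<pi>] by (intro that)
qed

lemma higman_imp_projective:
  fixes P :: "('g, 'k::field) rep"
  assumes "is_rep G P" "higman G P"
  shows "rep_projective G P"
  unfolding rep_projective_def
proof (intro conjI allI impI)
  fix M N :: "('g, 'k) rep" and f g :: "'k mat"
  assume MN: "is_rep G M" "is_rep G N" and f: "rep_surj G M N f" and g: "g \<in> rep_hom G P N"
  obtain L where "L \<in> carrier_mat (deg M) (deg P)" "f * L = g"
    using surj_lift [OF rep_hom_carrier _ rep_hom_carrier [OF g], of f G M] f
    by (auto simp: rep_surj_def)
  then obtain h where "h \<in> rep_hom G P M" "f * h = g"
    using higman_lift [OF assms MN _ g, of f L] f by (auto simp: rep_surj_def)
  then show "\<exists>h\<in>rep_hom G P M. f * h = g" by blast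
qed (rule assms)

lemma higman_tensor:
  assumes "is_rep G P" "higman G P" "is_rep G M"
  shows "higman G (tensor P M)"
proof -
  obtain \<pi> where \<pi>: "\<pi> \<in> carrier_mat (deg P) (deg P)" "average G P P \<pi> = 1\<^sub>m (deg P)"
    using assms(2) by (auto simp: higman_def)
  have "average G (tensor P M) (tensor P M) (kron \<pi> (1\<^sub>m (deg M))) =
      group_sum G (deg P * deg M) (deg P * deg M) (\<lambda>x. kron (act P x * (\<pi> * act P (inv\<^bsub>G\<^esub> x))) (1\<^sub>m (deg M)))"
    unfolding average_def tensor_simps
  proof (rule group_sum_cong)
    fix x assume x: "x \<in> carrier G"
    then have ix: "inv\<^bsub>G\<^esub> x \<in> carrier G" using G by simp
    note d = rep_dim [OF assms(1) x] rep_dim [OF assms(3) x] rep_dim [OF assms(1) ix] rep_dim [OF assms(3) ix]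
    show "kron (act P x) (act M x) * (kron \<pi> (1\<^sub>m (deg M)) * kron (act P (inv\<^bsub>G\<^esub> x)) (act M (inv\<^bsub>G\<^esub> x))) =
        kron (act P x * (\<pi> * act P (inv\<^bsub>G\<^esub> x))) (1\<^sub>m (deg M))"
      using d \<pi>(1) rep_inv [OF G assms(3) x] by (simp add: kron_mult)
  qed
  also have "\<dots> = kron (average G P P \<pi>) (1\<^sub>m (deg M))"
    unfolding average_def
    using average_summand_carrier [OF assms(1,1) \<pi>(1)] one_carrier_mat by (rule group_sum_kron [symmetric])
  also have "\<dots> = 1\<^sub>m (deg (tensor P M))" using \<pi> by simp
  finally show ?thesis
    unfolding higman_def using \<pi>(1) by (intro bexI [of _ "kron \<pi> (1\<^sub>m (deg M))"]) auto
qed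

lemma higman_retract:
  assumes "is_rep G P" "higman G P" "is_rep G M"
    and "i \<in> rep_hom G M P" "r \<in> rep_hom G P M" "r * i = 1\<^sub>m (deg M)"
  shows "higman G M"
proof -
  obtain \<pi> where \<pi>: "\<pi> \<in> carrier_mat (deg P) (deg P)" "average G P P \<pi> = 1\<^sub>m (deg P)"
    using assms(2) by (auto simp: higman_def)
  have c: "r * \<pi> \<in> carrier_mat (deg M) (deg P)" "r * \<pi> * i \<in> carrier_mat (deg M) (deg M)"
    using \<pi>(1) assms(4,5) by (auto intro: carrier_matI)
  have "average G M M (r * \<pi> * i) = average G P M (r * \<pi>) * i"
    using average_right [OF assms(1,3,3) c(1) assms(4)] by simp
  also have "average G P M (r * \<pi>) = r * average G P P \<pi>"
    using average_left [OF assms(1,1,3) \<pi>(1) assms(5)] by simp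
  also have "\<dots> * i = 1\<^sub>m (deg M)"
    using \<pi>(2) assms(5,6) by simp
  finally show ?thesis unfolding higman_def using c(2) by blast
qed

end

lemma rep_projective_rep: "rep_projective G P \<Longrightarrow> is_rep G P"
  by (simp add: rep_projective_def)

lemma rep_projectiveD:
  assumes "rep_projective G P" "is_rep G M" "is_rep G N" "rep_surj G M N f" "g \<in> rep_hom G P N"
  obtains h where "h \<in> rep_hom G P M" "f * h = g"
  using assms unfolding rep_projective_def by blast

section \<open>The regular representation and its augmentation\<close>

text \<open>The regular representation in a basis enumerating \<open>G\<close>, with the augmentation \<open>\<epsilon>\<close>.  The projection
  to the line of one basis element averages to the identity.\<close>

lemma regular_rep_exists:
  fixes G :: "('g, 'b) monoid_scheme" (structure)
  assumes "group G" "finite (carrier G)"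
  obtains F :: "('g, 'k::field) rep" and \<epsilon> :: "'k mat" and m
  where "is_rep G F" "higman G F" "\<epsilon> \<in> rep_hom G F triv" "deg F = Suc m" "\<epsilon> $$ (0, 0) = 1"
proof -
  interpret group G by fact
  note sum.lessThan_Suc [simp del]
  obtain m where m: "card (carrier G) = Suc m"
    using assms(2) by (metis card_gt_0_iff gr0_implies_Suc one_closed empty_iff)
  obtain e where e: "bij_betw e {0..<Suc m} (carrier G)"
    using ex_bij_betw_nat_finite [OF assms(2)] m by auto
  have e_in: "e i \<in> carrier G" if "i < Suc m" for i
    using e that by (auto simp: bij_betw_def)
  have e_inj: "e i = e j \<longleftrightarrow> i = j" if "i < Suc m" "j < Suc m" for i j
    using e that by (auto simp: bij_betw_def inj_on_def)
  have e_sur: "\<exists>i<Suc m. e i = x" if "x \<in> carrier G" for x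
  proof -
    have "x \<in> e ` {0..<Suc m}" using e that by (simp add: bij_betw_def)
    then show ?thesis by auto
  qed
  define F :: "('g, 'k) rep" where
    "F = Rep (Suc m) (\<lambda>g. mat (Suc m) (Suc m) (\<lambda>(i, j). if e i = g \<otimes> e j then 1 else 0))"
  define \<epsilon> :: "'k mat" where "\<epsilon> = mat 1 (Suc m) (\<lambda>_. 1)"
  have deg: "deg F = Suc m" by (simp add: F_def)
  have dims: "dim_row (act F x) = Suc m" "dim_col (act F x) = Suc m" for x by (simp_all add: F_def)
  have ind: "act F x $$ (i, j) = (if e i = x \<otimes> e j then 1 else 0)" if "i < Suc m" "j < Suc m" for x i j
    using that by (simp add: F_def)
  have pick: "(\<Sum>k<Suc m. if e k = x then f k else 0) = f l" if "l < Suc m" "e l = x" for f :: "nat \<Rightarrow> 'k" and x l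
  proof -
    have "(\<Sum>k<Suc m. if e k = x then f k else 0) = (\<Sum>k<Suc m. if k = l then f k else 0)"
      using that e_inj by (intro sum.cong) auto
    also have "\<dots> = f l" using that(1) by simp
    finally show ?thesis .
  qed
  have mul: "act F (x \<otimes> y) = act F x * act F y" if x: "x \<in> carrier G" and y: "y \<in> carrier G" for x y
  proof (rule mat_eqI, goal_cases)
    case (3 i j)
    then have i: "i < Suc m" and j: "j < Suc m" by (auto simp: dims)
    obtain l where l: "l < Suc m" "e l = y \<otimes> e j" using e_sur y e_in [OF j] by blast
    have "(act F x * act F y) $$ (i, j) = (\<Sum>k<Suc m. if e k = y \<otimes> e j then act F x $$ (i, k) else 0)"
      using i j by (subst mult_index) (auto simp: dims ind intro!: sum.cong)
    also have "\<dots> = act F x $$ (i, l)" by (rule pick [OF l])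
    also have "\<dots> = act F (x \<otimes> y) $$ (i, j)"
      using i j l x y e_in [OF j] by (simp add: ind m_assoc)
    finally show ?case by simp
  qed (auto simp: dims)
  have F: "is_rep G F"
  proof (rule is_repI)
    show "act F \<one> = 1\<^sub>m (deg F)"
      by (rule mat_eqI) (auto simp: dims deg ind e_in e_inj)
  qed (use mul in \<open>auto simp: dims deg intro: carrier_matI\<close>)
  have \<epsilon>: "\<epsilon> \<in> rep_hom G F triv"
  proof (rule rep_homI)
    fix x assume x: "x \<in> carrier G"
    have "(\<epsilon> * act F x) $$ (i, j) = \<epsilon> $$ (i, j)" if i: "i < 1" and j: "j < Suc m" for i j
    proof -
      obtain l where l: "l < Suc m" "e l = x \<otimes> e j" using e_sur x e_in [OF j] by blast
      have "(\<epsilon> * act F x) $$ (i, j) = (\<Sum>k<Suc m. if e k = x \<otimes> e j then 1 else 0)"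
        using i j by (subst mult_index) (auto simp: dims ind \<epsilon>_def intro!: sum.cong)
      also have "\<dots> = 1" by (rule pick [OF l])
      finally show ?thesis using i j by (simp add: \<epsilon>_def)
    qed
    then have "\<epsilon> * act F x = \<epsilon>" by (intro mat_eqI) (auto simp: dims \<epsilon>_def)
    then show "\<epsilon> * act F x = act triv x * \<epsilon>" by (simp add: \<epsilon>_def)
  qed (simp add: \<epsilon>_def deg)
  have "higman G F"
  proof -
    define \<pi> :: "'k mat" where "\<pi> = mat (Suc m) (Suc m) (\<lambda>(i, j). if i = 0 \<and> j = 0 then 1 else 0)"
    have summand: "(act F x * (\<pi> * act F (inv x))) $$ (i, j) =
        (if x = e i \<otimes> inv (e 0) \<and> i = j then 1 else 0)"
      if i: "i < Suc m" and j: "j < Suc m" and x: "x \<in> carrier G" for x i j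
    proof -
      have 1: "(\<pi> * act F (inv x)) $$ (k, j) = (if k = 0 then act F (inv x) $$ (0, j) else 0)" if "k < Suc m" for k
      proof -
        have "(\<pi> * act F (inv x)) $$ (k, j) = (\<Sum>l<Suc m. \<pi> $$ (k, l) * act F (inv x) $$ (l, j))"
          using that j by (subst mult_index) (auto simp: dims \<pi>_def)
        also have "\<dots> = (\<Sum>l<Suc m. if l = 0 then (if k = 0 then act F (inv x) $$ (l, j) else 0) else 0)"
          using that by (intro sum.cong) (auto simp: \<pi>_def)
        also have "\<dots> = (if k = 0 then act F (inv x) $$ (0, j) else 0)" by simp
        finally show ?thesis .
      qed
      have "(act F x * (\<pi> * act F (inv x))) $$ (i, j) =
          (\<Sum>k<Suc m. act F x $$ (i, k) * (\<pi> * act F (inv x)) $$ (k, j))"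
        using i j by (subst mult_index) (auto simp: dims \<pi>_def)
      also have "\<dots> = (\<Sum>k<Suc m. if k = 0 then act F x $$ (i, k) * act F (inv x) $$ (0, j) else 0)"
        by (intro sum.cong) (auto simp: 1 simp del: index_mult_mat)
      also have "\<dots> = act F x $$ (i, 0) * act F (inv x) $$ (0, j)" by simp
      also have "\<dots> = (if e i = x \<otimes> e 0 \<and> e 0 = inv x \<otimes> e j then 1 else 0)"
        using i j by (simp add: ind)
      also have "e i = x \<otimes> e 0 \<and> e 0 = inv x \<otimes> e j \<longleftrightarrow> x = e i \<otimes> inv (e 0) \<and> i = j"
      proof -
        have c: "e 0 \<in> carrier G" "e i \<in> carrier G" "e j \<in> carrier G" using e_in i j by auto
        have "e i = x \<otimes> e 0 \<longleftrightarrow> x = e i \<otimes> inv (e 0)"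
          using c x by (metis inv_solve_right)
        moreover have "e 0 = inv x \<otimes> e j \<longleftrightarrow> e j = x \<otimes> e 0"
          using c x by (metis inv_solve_left)
        ultimately show ?thesis using e_inj [OF i j] by auto
      qed
      finally show ?thesis .
    qed
    have "average G F F \<pi> = 1\<^sub>m (deg F)"
    proof (rule mat_eqI, goal_cases)
      case (3 i j)
      then have i: "i < Suc m" and j: "j < Suc m" by (auto simp: deg)
      have c: "e i \<otimes> inv (e 0) \<in> carrier G" using e_in i by simp
      have "average G F F \<pi> $$ (i, j) = (\<Sum>x\<in>carrier G. (act F x * (\<pi> * act F (inv x))) $$ (i, j))"
        using i j by (simp add: average_def group_sum_def deg)
      also have "\<dots> = (\<Sum>x\<in>carrier G. if x = e i \<otimes> inv (e 0) then (if i = j then 1 else 0) else 0)"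
        by (rule sum.cong) (auto simp: summand [OF i j])
      also have "\<dots> = 1\<^sub>m (deg F) $$ (i, j)"
        using c assms(2) i j by (simp add: deg)
      finally show ?case .
    qed (auto simp: average_def)
    then show ?thesis unfolding higman_def by (intro bexI [of _ \<pi>]) (auto simp: \<pi>_def deg)
  qed
  with F \<epsilon> deg show thesis by (intro that [of F \<epsilon> m]) (auto simp: \<epsilon>_def)
qed

text \<open>
  The augmentation sequence \<open>0 \<rightarrow> I \<rightarrow> kG \<rightarrow> k \<rightarrow> 0\<close>, with a linear splitting \<open>q\<close>, \<open>t\<close>.
\<close>

locale augmentation = group G for G :: "('g, 'b) monoid_scheme" (structure) +
  fixes F I :: "('g, 'k::field) rep" and j \<epsilon> q t :: "'k mat"
  assumes aug_split: "split_exact G I F triv j \<epsilon> q t"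
    and higman_F: "higman G F"

lemma augmentation_exists:
  fixes G :: "('g, 'b) monoid_scheme"
  assumes "group G" "finite (carrier G)"
  obtains F I :: "('g, 'k::field) rep" and j \<epsilon> q t where "augmentation G F I j \<epsilon> q t"
proof -
  obtain F :: "('g, 'k) rep" and \<epsilon> m where F: "is_rep G F" "higman G F" "\<epsilon> \<in> rep_hom G F triv"
    "deg F = Suc m" "\<epsilon> $$ (0, 0) = 1"
    using regular_rep_exists [OF assms] .
  have c: "\<epsilon> \<in> carrier_mat 1 (Suc m)" using rep_hom_carrier [OF F(3)] F(4) by simp
  obtain j q t where *: "j \<in> carrier_mat (Suc m) m" "q \<in> carrier_mat m (Suc m)" "t \<in> carrier_mat (Suc m) 1"
    "q * j = 1\<^sub>m m" "\<epsilon> * t = 1\<^sub>m 1" "\<epsilon> * j = 0\<^sub>m 1 m" "j * q + t * \<epsilon> = 1\<^sub>m (Suc m)"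
    using row_splitting [OF c F(5)] .
  have "split_exact G (Rep m (\<lambda>x. q * act F x * j)) F triv j \<epsilon> q t"
    by (rule split_exact_kernel) (use F * in auto)
  with F assms show thesis
    by (intro that) (auto simp: augmentation_def augmentation_axioms_def)
qed

context augmentation
begin

lemma I_rep: "is_rep G I" and F_rep: "is_rep G F"
  using split_exactD [OF aug_split] by auto

text \<open>A projective module is a retract of \<open>kG \<otimes> P\<close>.\<close>

lemma projective_imp_higman:
  fixes P :: "('g, 'k) rep"
  assumes "rep_projective G P"
  shows "higman G P"
proof -
  have P: "is_rep G P" using assms by (simp add: rep_projective_def)
  have s: "split_exact G (tensor I P) (tensor F P) P (kron j (1\<^sub>m (deg P))) (kron \<epsilon> (1\<^sub>m (deg P)))
      (kron q (1\<^sub>m (deg P))) (kron t (1\<^sub>m (deg P)))"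
    using split_exact_tensor_right [OF aug_split P] by simp
  have "rep_surj G (tensor F P) P (kron \<epsilon> (1\<^sub>m (deg P)))"
    using short_exact_if_split_exact [OF s] by (simp add: short_exact_def)
  then obtain c where c: "c \<in> rep_hom G P (tensor F P)" "kron \<epsilon> (1\<^sub>m (deg P)) * c = 1\<^sub>m (deg P)"
    using rep_projectiveD [OF assms _ P _ rep_hom_one [OF P]] P F_rep by (metis is_rep_tensor)
  show ?thesis
    by (rule higman_retract [OF is_group _ higman_tensor P c(1) split_exactD(5) [OF s] c(2)])
      (use P F_rep higman_F is_group in auto)
qed

lemma projective_iff_higman:
  fixes P :: "('g, 'k) rep"
  shows "rep_projective G P \<longleftrightarrow> is_rep G P \<and> higman G P"
  using projective_imp_higman higman_imp_projective [OF is_group] rep_projective_rep by blast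

end

section \<open>Relative homological algebra\<close>

text \<open>
  Short exact sequences that split after tensoring with \<open>W\<close>; both a retraction and a section are
  recorded.
\<close>

definition W_split ::
  "('g, 'b) monoid_scheme \<Rightarrow> ('g, 'k::field) rep \<Rightarrow> ('g, 'k) rep \<Rightarrow> ('g, 'k) rep \<Rightarrow> ('g, 'k) rep
     \<Rightarrow> 'k mat \<Rightarrow> 'k mat \<Rightarrow> bool" where
  "W_split G W X Y Z f g \<longleftrightarrow> (\<exists>p s. split_exact G X Y Z f g p s) \<and>
     (\<exists>r\<in>rep_hom G (tensor Y W) (tensor X W). r * kron f (1\<^sub>m (deg W)) = 1\<^sub>m (deg X * deg W)) \<and>
     (\<exists>\<sigma>\<in>rep_hom G (tensor Z W) (tensor Y W). kron g (1\<^sub>m (deg W)) * \<sigma> = 1\<^sub>m (deg Z * deg W))"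

lemma W_splitD:
  assumes "W_split G W X Y Z f g"
  shows "is_rep G X" "is_rep G Y" "is_rep G Z" "f \<in> rep_hom G X Y" "g \<in> rep_hom G Y Z"
    "g * f = 0\<^sub>m (deg Z) (deg X)"
  using assms by (auto simp: W_split_def dest: split_exactD)

lemma W_split_retraction:
  assumes "W_split G W X Y Z f g"
  obtains r where "r \<in> rep_hom G (tensor Y W) (tensor X W)" "r * kron f (1\<^sub>m (deg W)) = 1\<^sub>m (deg X * deg W)"
  using assms by (auto simp: W_split_def)

lemma W_split_section:
  assumes "W_split G W X Y Z f g"
  obtains \<sigma> where "\<sigma> \<in> rep_hom G (tensor Z W) (tensor Y W)" "kron g (1\<^sub>m (deg W)) * \<sigma> = 1\<^sub>m (deg Z * deg W)"
  using assms by (auto simp: W_split_def)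

lemma W_split_lift:
  assumes "W_split G W X Y Z f g" "h \<in> rep_hom G T Y" "is_rep G T" "g * h = 0\<^sub>m (deg Z) (deg T)"
  obtains k where "k \<in> rep_hom G T X" "f * k = h"
  using assms by (auto simp: W_split_def elim: split_exact_lift)

lemma W_split_descend:
  assumes "W_split G W X Y Z f g" "h \<in> rep_hom G Y T" "is_rep G T" "h * f = 0\<^sub>m (deg T) (deg X)"
  obtains k where "k \<in> rep_hom G Z T" "k * g = h"
  using assms by (auto simp: W_split_def elim: split_exact_descend)

lemma W_split_epi:
  assumes "W_split G W X Y Z f g" "a * g = b * g" "dim_col a = deg Z" "dim_col b = deg Z"
  shows "a = b"
  using assms by (auto simp: W_split_def intro: split_exact_epi)

lemma W_split_mono:
  assumes "W_split G W X Y Z f g" "f * a = f * b" "dim_row a = deg X" "dim_row b = deg X"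
  shows "a = b"
  using assms by (auto simp: W_split_def intro: split_exact_mono)

text \<open>Either of the two splittings determines the other.\<close>

lemma W_splitI_section:
  assumes s: "split_exact G X Y Z f g p s" and W: "is_rep G W"
    and \<sigma>: "\<sigma> \<in> rep_hom G (tensor Z W) (tensor Y W)" "kron g (1\<^sub>m (deg W)) * \<sigma> = 1\<^sub>m (deg Z * deg W)"
  shows "W_split G W X Y Z f g"
proof -
  note D = split_exactD [OF s]
  note sW = split_exact_tensor_right [OF s W]
  note DW = split_exactD [OF sW]
  let ?f = "kron f (1\<^sub>m (deg W))" and ?g = "kron g (1\<^sub>m (deg W))"
  let ?e = "1\<^sub>m (deg (tensor Y W)) - \<sigma> * ?g"
  have \<sigma>g: "\<sigma> * ?g \<in> rep_hom G (tensor Y W) (tensor Y W)"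
    by (rule rep_hom_comp [OF \<sigma>(1) DW(5)]) (use DW in auto)
  have e: "?e \<in> rep_hom G (tensor Y W) (tensor Y W)"
    by (rule rep_hom_diff [OF rep_hom_one \<sigma>g]) (use DW in auto)
  have "?g * ?e = ?g - ?g * \<sigma> * ?g"
    using D DW \<sigma>(1) by (simp add: mat_diff_left mat_assoc)
  also have "\<dots> = 0\<^sub>m (deg (tensor Z W)) (deg (tensor Y W))"
    unfolding \<sigma>(2) using D by simp
  finally obtain r where r: "r \<in> rep_hom G (tensor Y W) (tensor X W)" "?f * r = ?e"
    using split_exact_lift [OF sW e DW(2)] by blast
  have "?f * (r * ?f) = ?e * ?f"
    using r D DW(4) by (simp add: mat_assoc [symmetric] del: assoc_mult_mat)
  also have "\<dots> = ?f - \<sigma> * (?g * ?f)"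
    using D DW(4) \<sigma>(1) by (simp add: mat_diff_right mat_assoc)
  also have "\<dots> = ?f * 1\<^sub>m (deg X * deg W)"
    unfolding DW(10) using D \<sigma>(1) by (intro mat_eqI) auto
  finally have "r * ?f = 1\<^sub>m (deg X * deg W)"
    by (rule split_exact_mono [OF sW]) (use r in auto)
  with r(1) \<sigma> s show ?thesis by (auto simp: W_split_def)
qed

lemma W_splitI_retraction:
  assumes s: "split_exact G X Y Z f g p s" and W: "is_rep G W"
    and r: "r \<in> rep_hom G (tensor Y W) (tensor X W)" "r * kron f (1\<^sub>m (deg W)) = 1\<^sub>m (deg X * deg W)"
  shows "W_split G W X Y Z f g"
proof -
  note D = split_exactD [OF s]
  note sW = split_exact_tensor_right [OF s W]
  note DW = split_exactD [OF sW]
  let ?f = "kron f (1\<^sub>m (deg W))" and ?g = "kron g (1\<^sub>m (deg W))"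
  let ?e = "1\<^sub>m (deg (tensor Y W)) - ?f * r"
  have fr: "?f * r \<in> rep_hom G (tensor Y W) (tensor Y W)"
    by (rule rep_hom_comp [OF DW(4) r(1)]) (use DW in auto)
  have e: "?e \<in> rep_hom G (tensor Y W) (tensor Y W)"
    by (rule rep_hom_diff [OF rep_hom_one fr]) (use DW in auto)
  have "?e * ?f = ?f - ?f * (r * ?f)"
    using D DW r(1) by (simp add: mat_diff_right mat_assoc)
  also have "\<dots> = 0\<^sub>m (deg (tensor Y W)) (deg (tensor X W))"
    unfolding r(2) using D by simp
  finally obtain \<sigma> where \<sigma>: "\<sigma> \<in> rep_hom G (tensor Z W) (tensor Y W)" "\<sigma> * ?g = ?e"
    using split_exact_descend [OF sW e DW(2)] by blast
  have "?g * \<sigma> * ?g = ?g * ?e"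
    using \<sigma> D DW(5) by (simp add: mat_assoc del: assoc_mult_mat)
  also have "\<dots> = ?g - ?g * ?f * r"
    using D DW(5) r(1) by (simp add: mat_diff_left mat_assoc)
  also have "\<dots> = 1\<^sub>m (deg Z * deg W) * ?g"
    unfolding DW(10) using D r(1) by (intro mat_eqI) auto
  finally have "?g * \<sigma> = 1\<^sub>m (deg Z * deg W)"
    by (rule split_exact_epi [OF sW]) (use \<sigma> in auto)
  with \<sigma>(1) r s show ?thesis by (auto simp: W_split_def)
qed

lemma W_split_tensor:
  assumes "W_split G W X Y Z f g" "is_rep G A" "is_rep G W"
  shows "W_split G W (tensor A X) (tensor A Y) (tensor A Z) (kron (1\<^sub>m (deg A)) f) (kron (1\<^sub>m (deg A)) g)"
proof -
  obtain p s where s: "split_exact G X Y Z f g p s" using assms by (auto simp: W_split_def)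
  obtain r where r: "r \<in> rep_hom G (tensor Y W) (tensor X W)" "r * kron f (1\<^sub>m (deg W)) = 1\<^sub>m (deg X * deg W)"
    using W_split_retraction [OF assms(1)] .
  note D = split_exactD [OF s]
  show ?thesis
  proof (rule W_splitI_retraction [OF split_exact_tensor_left [OF s assms(2)] assms(3)])
    show "kron (1\<^sub>m (deg A)) r \<in> rep_hom G (tensor (tensor A Y) W) (tensor (tensor A X) W)"
      unfolding tensor_assoc by (rule rep_hom_kron_left) (use r D assms in auto)
    show "kron (1\<^sub>m (deg A)) r * kron (kron (1\<^sub>m (deg A)) f) (1\<^sub>m (deg W)) = 1\<^sub>m (deg (tensor A X) * deg W)"
      using r D by (simp add: kron_assoc kron_mult mult.assoc)
  qed
qed

text \<open>Traces extend along, and lift through, the maps of a \<open>W\<close>-split sequence.\<close>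

lemma traces_extend:
  assumes "W_split G W X Y Z f g" "h \<in> traces G W X B" "is_rep G B" "is_rep G W"
  obtains h' where "h' \<in> traces G W Y B" "h' * f = h"
proof -
  note D = W_splitD [OF assms(1)]
  obtain r where r: "r \<in> rep_hom G (tensor Y W) (tensor X W)" "r * kron f (1\<^sub>m (deg W)) = 1\<^sub>m (deg X * deg W)"
    using W_split_retraction [OF assms(1)] .
  obtain \<theta> where \<theta>: "\<theta> \<in> rep_hom G (tensor X W) (tensor B W)" "h = tr W X B \<theta>"
    using assms(2) by (auto simp: traces_def)
  have \<theta>r: "\<theta> * r \<in> rep_hom G (tensor Y W) (tensor B W)"
    by (rule rep_hom_comp [OF \<theta>(1) r(1)]) (use D assms in auto)
  have "tr W Y B (\<theta> * r) * f = tr W X B (\<theta> * r * kron f (1\<^sub>m (deg W)))"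
    using rep_hom_carrier [OF \<theta>r] rep_hom_carrier [OF D(4)] by (intro tr_right) auto
  also have "\<theta> * r * kron f (1\<^sub>m (deg W)) = \<theta> * (r * kron f (1\<^sub>m (deg W)))"
    using \<theta>(1) r(1) D(4) by (simp add: mat_assoc)
  also have "\<dots> = \<theta>" unfolding r(2) using \<theta>(1) by simp
  finally have "tr W Y B (\<theta> * r) * f = h" using \<theta>(2) by simp
  moreover have "tr W Y B (\<theta> * r) \<in> traces G W Y B" using \<theta>r by (simp add: traces_def)
  ultimately show thesis by (intro that)
qed

lemma traces_lift:
  assumes "W_split G W X Y Z f g" "h \<in> traces G W B Z" "is_rep G B" "is_rep G W"
  obtains h' where "h' \<in> traces G W B Y" "g * h' = h"
proof -
  note D = W_splitD [OF assms(1)]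
  obtain \<sigma> where \<sigma>: "\<sigma> \<in> rep_hom G (tensor Z W) (tensor Y W)" "kron g (1\<^sub>m (deg W)) * \<sigma> = 1\<^sub>m (deg Z * deg W)"
    using W_split_section [OF assms(1)] .
  obtain \<theta> where \<theta>: "\<theta> \<in> rep_hom G (tensor B W) (tensor Z W)" "h = tr W B Z \<theta>"
    using assms(2) by (auto simp: traces_def)
  have \<sigma>\<theta>: "\<sigma> * \<theta> \<in> rep_hom G (tensor B W) (tensor Y W)"
    by (rule rep_hom_comp [OF \<sigma>(1) \<theta>(1)]) (use D assms in auto)
  have "g * tr W B Y (\<sigma> * \<theta>) = tr W B Z (kron g (1\<^sub>m (deg W)) * (\<sigma> * \<theta>))"
    using rep_hom_carrier [OF \<sigma>\<theta>] rep_hom_carrier [OF D(5)] by (intro tr_left) auto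
  also have "kron g (1\<^sub>m (deg W)) * (\<sigma> * \<theta>) = kron g (1\<^sub>m (deg W)) * \<sigma> * \<theta>"
    using \<theta>(1) \<sigma>(1) D(5) by (simp add: mat_assoc)
  also have "\<dots> = \<theta>" unfolding \<sigma>(2) using \<theta>(1) by simp
  finally have "g * tr W B Y (\<sigma> * \<theta>) = h" using \<theta>(2) by simp
  moreover have "tr W B Y (\<sigma> * \<theta>) \<in> traces G W B Y" using \<sigma>\<theta> by (simp add: traces_def)
  ultimately show thesis by (intro that)
qed

text \<open>The module \<open>B \<otimes> W \<otimes> W\<^sup>*\<close> with its unit and counit.\<close>

abbreviation (input) "Wend G W B \<equiv> tensor (tensor B W) (dual G W)"
abbreviation (input) "Wunit W B \<equiv> kron (1\<^sub>m (deg B)) (coevaluation (deg W))"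
abbreviation (input) "Wcounit W B \<equiv> kron (1\<^sub>m (deg B)) (evaluation (deg W))"

text \<open>The standing assumptions on \<open>W\<close>.\<close>

locale rel_setting = group G for G :: "('g, 'b) monoid_scheme" (structure) +
  fixes W :: "('g, 'k::field) rep"
  assumes W: "is_rep G W" and deg_W: "deg W \<noteq> 0"
begin

lemma Wend_rep [simp]: "is_rep G B \<Longrightarrow> is_rep G (Wend G W B)"
  using W is_rep_dual [OF is_group W] by simp

lemma W_rep [simp]: "is_rep G W" "is_rep G (dual G W)"
  using W is_rep_dual [OF is_group W] by auto

lemma Wunit_hom: "is_rep G B \<Longrightarrow> Wunit W B \<in> rep_hom G B (Wend G W B)"
  using unit_hom [OF is_group W] .

lemma Wcounit_hom: "is_rep G B \<Longrightarrow> Wcounit W B \<in> rep_hom G (Wend G W B) B"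
  using counit_hom [OF is_group W] .

text \<open>The endomorphism \<open>\<phi> \<otimes> w \<mapsto> \<phi>(w) \<Sum>\<^sub>i e\<^sub>i\<^sup>* \<otimes> e\<^sub>i\<close> of \<open>W\<^sup>* \<otimes> W\<close> has trace \<open>1\<close> over \<open>W\<close>; hence the identity of
  every \<open>B \<otimes> W \<otimes> W\<^sup>*\<close> is a trace.\<close>

lemma dual_one_trace: "tr W (dual G W) (dual G W) (coevaluation (deg W) * evaluation (deg W)) = 1\<^sub>m (deg W)"
proof -
  let ?w = "1\<^sub>m (deg W) :: 'k mat" and ?e = "evaluation (deg W) :: 'k mat" and ?c = "coevaluation (deg W) :: 'k mat"
  have "tr W (dual G W) (dual G W) (?c * ?e) = kron ?w ?e * (kron (?c * ?e) (?w * ?w) * kron ?w ?c)"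
    by (simp add: tr_def hom_adj_def)
  also have "kron (?c * ?e) (?w * ?w) = kron ?c ?w * kron ?e ?w"
    by (rule kron_mult [symmetric]) auto
  also have "kron ?w ?e * (kron ?c ?w * kron ?e ?w * kron ?w ?c) =
      kron ?w ?e * kron ?c ?w * (kron ?e ?w * kron ?w ?c)"
    by (simp add: mat_assoc mult.assoc)
  also have "\<dots> = ?w" unfolding zigzag1 zigzag2 by simp
  finally show ?thesis .
qed

lemma one_traces_dual: "1\<^sub>m (deg W) \<in> traces G W (dual G W) (dual G W)"
proof -
  let ?\<theta> = "coevaluation (deg W) * evaluation (deg W) :: 'k mat"
  have "?\<theta> \<in> rep_hom G (tensor (dual G W) W) (tensor (dual G W) W)"
    by (rule rep_hom_comp [OF coevaluation_hom(2) [OF is_group W] evaluation_hom(2) [OF is_group W]]) auto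
  then show ?thesis
    using dual_one_trace unfolding traces_def by (metis image_eqI)
qed

lemma one_traces_Wend:
  assumes "is_rep G B"
  shows "1\<^sub>m (deg (Wend G W B)) \<in> traces G W (Wend G W B) (Wend G W B)"
proof -
  have "kron (1\<^sub>m (deg (tensor B W))) (1\<^sub>m (deg W)) \<in> traces G W (Wend G W B) (Wend G W B)"
    by (rule traces_tensor [OF one_traces_dual]) (use assms in auto)
  then show ?thesis by simp
qed

text \<open>The traces into \<open>B\<close> are the maps factoring through the counit of \<open>B\<close>.\<close>

lemma trace_factor_counit:
  assumes "h \<in> traces G W A B" "is_rep G A" "is_rep G B"
  obtains l where "l \<in> rep_hom G A (Wend G W B)" "Wcounit W B * l = h"
proof -
  obtain \<theta> where \<theta>: "\<theta> \<in> rep_hom G (tensor A W) (tensor B W)" "h = tr W A B \<theta>"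
    using assms(1) by (auto simp: traces_def)
  have "hom_adj W A \<theta> \<in> rep_hom G A (Wend G W B)"
    by (rule hom_adj_hom [OF is_group W assms(2) _ \<theta>(1)]) (use assms in auto)
  then show thesis using \<theta>(2) by (intro that) (auto simp: tr_def)
qed

lemma counit_comp_traces:
  assumes "l \<in> rep_hom G A (Wend G W B)" "is_rep G A" "is_rep G B"
  shows "Wcounit W B * l \<in> traces G W A B"
proof -
  have "1\<^sub>m (deg (Wend G W B)) * l \<in> traces G W A (Wend G W B)"
    by (rule traces_comp_right [OF one_traces_Wend assms(1)]) (use assms in auto)
  then have "l \<in> traces G W A (Wend G W B)"
    using assms(1) by simp
  then show ?thesis
    by (rule traces_comp_left [OF _ Wcounit_hom]) (use assms in auto)
qed

lemma traces_unit_comp: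
  assumes "h \<in> rep_hom G A B" "is_rep G A" "is_rep G B"
  shows "Wunit W B * h \<in> traces G W A (Wend G W B)"
proof -
  have "Wunit W B * h \<in> rep_hom G A (Wend G W B)"
    by (rule rep_hom_comp [OF Wunit_hom assms(1)]) (use assms in auto)
  note * = this
  have "1\<^sub>m (deg (Wend G W B)) * (Wunit W B * h) \<in> traces G W A (Wend G W B)"
    by (rule traces_comp_right [OF one_traces_Wend *]) (use assms in auto)
  then show ?thesis using rep_hom_dim [OF *] by simp
qed

lemma deg_W_square: obtains m where "deg W * deg W = Suc m"
  using deg_W by (metis mult_eq_0_iff not0_implies_Suc)

text \<open>The counit is onto and the unit is injective because \<open>W \<noteq> 0\<close>.\<close>

lemma counit_sequence:
  assumes "is_rep G B"
  obtains K \<kappa> p s where "split_exact G K (Wend G W B) B \<kappa> (Wcounit W B) p s"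
proof -
  obtain m where m: "deg W * deg W = Suc m" by (rule deg_W_square)
  have e: "evaluation (deg W) \<in> carrier_mat 1 (Suc m)" "evaluation (deg W) $$ (0, 0) = (1 :: 'k)"
    using m deg_W by (auto simp: evaluation_def intro: carrier_matI)
  obtain f p s where *: "f \<in> carrier_mat (Suc m) m" "p \<in> carrier_mat m (Suc m)" "s \<in> carrier_mat (Suc m) 1"
    "p * f = 1\<^sub>m m" "evaluation (deg W) * s = 1\<^sub>m 1" "evaluation (deg W) * f = (0\<^sub>m 1 m :: 'k mat)"
    "f * p + s * evaluation (deg W) = 1\<^sub>m (Suc m)"
    using row_splitting [OF e] .
  have "split_exact G (Rep m (\<lambda>x. p * act (tensor W (dual G W)) x * f)) (tensor W (dual G W)) triv f
      (evaluation (deg W)) p s"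
    by (rule split_exact_kernel [OF _ _ evaluation_hom(1) [OF is_group W]]) (use * m in auto)
  from split_exact_tensor_left [OF this assms] show thesis
    by (intro that) (simp add: tensor_assoc)
qed

lemma unit_sequence:
  assumes B: "is_rep G B"
  obtains C \<gamma> where "W_split G W B (Wend G W B) C (Wunit W B) \<gamma>"
proof -
  obtain m where m: "deg W * deg W = Suc m" by (rule deg_W_square)
  have e: "coevaluation (deg W) \<in> carrier_mat (Suc m) 1" "coevaluation (deg W) $$ (0, 0) = (1 :: 'k)"
    using m deg_W by (auto simp: coevaluation_def intro: carrier_matI)
  obtain g s p where *: "g \<in> carrier_mat m (Suc m)" "s \<in> carrier_mat (Suc m) m" "p \<in> carrier_mat 1 (Suc m)"
    "g * s = 1\<^sub>m m" "p * coevaluation (deg W) = 1\<^sub>m 1" "g * coevaluation (deg W) = (0\<^sub>m m 1 :: 'k mat)"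
    "coevaluation (deg W) * p + s * g = 1\<^sub>m (Suc m)"
    using col_splitting [OF e] .
  let ?C = "Rep m (\<lambda>x. g * act (tensor W (dual G W)) x * s)"
  have C: "split_exact G triv (tensor W (dual G W)) ?C (coevaluation (deg W)) g p s"
    by (rule split_exact_cokernel [OF _ _ coevaluation_hom(1) [OF is_group W]]) (use * m in auto)
  let ?r = "kron (1\<^sub>m (deg W)) (evaluation (deg W)) :: 'k mat"
  have "W_split G W triv (tensor W (dual G W)) ?C (coevaluation (deg W)) g"
  proof (rule W_splitI_retraction [OF C W, of ?r])
    show "?r \<in> rep_hom G (tensor (tensor W (dual G W)) W) (tensor triv W)"
      using rep_hom_kron_left [OF evaluation_hom(2) [OF is_group W] W] by (simp add: tensor_assoc)
    show "?r * kron (coevaluation (deg W)) (1\<^sub>m (deg W)) = 1\<^sub>m (deg triv * deg W)"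
      by (simp add: zigzag1)
  qed
  from W_split_tensor [OF this B W] show thesis
    by (intro that) (simp add: tensor_assoc)
qed

text \<open>Let \<open>X \<rightarrow> Y \<rightarrow> Z\<close> be \<open>W\<close>-split.  If all maps from \<open>X\<close> and from \<open>Z\<close> to \<open>B\<close> are traces, so are all maps
  from \<open>Y\<close>: subtracting a trace makes a map vanish on \<open>X\<close>, hence descend to \<open>Z\<close>.\<close>

lemma vanishing_middle:
  assumes S: "W_split G W X Y Z f g" and B: "is_rep G B"
    and vX: "rep_hom G X B \<subseteq> traces G W X B" and vZ: "rep_hom G Z B \<subseteq> traces G W Z B"
  shows "rep_hom G Y B \<subseteq> traces G W Y B"
proof
  note D = W_splitD [OF S]
  fix h assume h: "h \<in> rep_hom G Y B"
  have "h * f \<in> traces G W X B"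
    using vX rep_hom_comp [OF h D(4)] D B by blast
  then obtain h' where h': "h' \<in> traces G W Y B" "h' * f = h * f"
    using traces_extend [OF S _ B W] by metis
  have h'': "h' \<in> rep_hom G Y B" using traces_rep_hom [OF h'(1) is_group] D B by simp
  have "(h - h') * f = 0\<^sub>m (deg B) (deg X)"
    using h h'' D(4) h'(2) by (simp add: mat_diff_right)
  then obtain k where k: "k \<in> rep_hom G Z B" "k * g = h - h'"
    using W_split_descend [OF S rep_hom_diff [OF h h''] B] D B by blast
  have "k * g \<in> traces G W Y B"
    by (rule traces_comp_right [OF _ D(5)]) (use k vZ D B in auto)
  then have "k * g + h' \<in> traces G W Y B"
    by (rule traces_add [OF _ h'(1)]) (use D B in auto)
  also have "k * g + h' = h"
    unfolding k(2) using h h'' by (intro mat_eqI) auto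
  finally show "h \<in> traces G W Y B" .
qed

text \<open>Maps out of \<open>Z\<close>: lift \<open>h g\<close> through the counit; on \<open>X\<close> the lift has values in the kernel \<open>K\<close>, and that
  restriction extends to \<open>Y\<close> because it is a trace.  After subtracting the extension the lift descends
  to a lift of \<open>h\<close>.\<close>

lemma vanishing_right:
  assumes S: "W_split G W X Y Z f g" and B: "is_rep G B"
    and K: "split_exact G K (Wend G W B) B \<kappa> (Wcounit W B) p s"
    and vX: "rep_hom G X K \<subseteq> traces G W X K" and vY: "rep_hom G Y B \<subseteq> traces G W Y B"
  shows "rep_hom G Z B \<subseteq> traces G W Z B"
proof
  note D = W_splitD [OF S] and DK = split_exactD [OF K]
  let ?E = "Wcounit W B"
  fix h assume h: "h \<in> rep_hom G Z B"
  have "h * g \<in> traces G W Y B"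
    using vY rep_hom_comp [OF h D(5)] D B by blast
  then obtain l where l: "l \<in> rep_hom G Y (Wend G W B)" "?E * l = h * g"
    using trace_factor_counit D B by metis
  have lf: "l * f \<in> rep_hom G X (Wend G W B)"
    by (rule rep_hom_comp [OF l(1) D(4)]) (use D B in auto)
  have "?E * (l * f) = h * g * f"
    unfolding l(2) [symmetric] using rep_hom_dim [OF DK(5)] rep_hom_dim [OF l(1)] D(4) by (simp add: mat_assoc)
  also have "\<dots> = h * (g * f)" using h D(4,5) by (simp add: mat_assoc)
  also have "\<dots> = 0\<^sub>m (deg B) (deg X)" unfolding D(6) using h by simp
  finally obtain k where k: "k \<in> rep_hom G X K" "\<kappa> * k = l * f"
    using split_exact_lift [OF K lf D(1)] by blast
  then obtain k' where k': "k' \<in> traces G W Y K" "k' * f = k"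
    using traces_extend [OF S _ DK(1) W, of k] vX by blast
  have k'': "k' \<in> rep_hom G Y K" using traces_rep_hom [OF k'(1) is_group] D DK by simp
  have \<kappa>k': "\<kappa> * k' \<in> rep_hom G Y (Wend G W B)"
    by (rule rep_hom_comp [OF DK(4) k'']) (use D DK in auto)
  have "(l - \<kappa> * k') * f = l * f - \<kappa> * (k' * f)"
    using rep_hom_dim [OF l(1)] rep_hom_dim [OF \<kappa>k'] rep_hom_dim [OF DK(4)] k'' D(4)
    by (simp add: mat_diff_right mat_assoc)
  also have "\<dots> = 0\<^sub>m (deg (Wend G W B)) (deg X)"
    unfolding k'(2) k(2) using rep_hom_dim [OF lf] by simp
  finally obtain u where u: "u \<in> rep_hom G Z (Wend G W B)" "u * g = l - \<kappa> * k'"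
    using W_split_descend [OF S rep_hom_diff [OF l(1) \<kappa>k']] D DK by blast
  have "?E * u * g = ?E * (u * g)"
    using rep_hom_dim [OF DK(5)] rep_hom_dim [OF u(1)] D(5) by (simp add: mat_assoc)
  also have "\<dots> = ?E * l - ?E * \<kappa> * k'"
    unfolding u(2) using rep_hom_dim [OF DK(5)] rep_hom_dim [OF l(1)] rep_hom_dim [OF \<kappa>k'] rep_hom_dim [OF DK(4)] k''
    by (simp add: mat_diff_left mat_assoc)
  also have "\<dots> = h * g"
    unfolding DK(10) l(2) using h k'' D(5) by (intro mat_eqI) auto
  finally have "?E * u = h"
    by (rule W_split_epi [OF S]) (use rep_hom_dim [OF u(1)] h in auto)
  then show "h \<in> traces G W Z B"
    using counit_comp_traces [OF u(1) D(3) B] by simp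
qed

text \<open>Maps out of \<open>X\<close>: extend \<open>h\<close>, followed by the unit, to \<open>Y\<close>; its composite to the cokernel \<open>C\<close> factors through
  \<open>Z\<close> as a trace, which lifts to \<open>B \<otimes> W \<otimes> W\<^sup>*\<close>.  After subtracting the lift the extension has values
  in \<open>B\<close> and restricts to \<open>h\<close>.\<close>

lemma vanishing_left:
  assumes S: "W_split G W X Y Z f g" and B: "is_rep G B"
    and C: "W_split G W B (Wend G W B) C (Wunit W B) \<gamma>"
    and vY: "rep_hom G Y B \<subseteq> traces G W Y B" and vZ: "rep_hom G Z C \<subseteq> traces G W Z C"
  shows "rep_hom G X B \<subseteq> traces G W X B"
proof
  note D = W_splitD [OF S] and DC = W_splitD [OF C]
  let ?c = "Wunit W B"
  fix h assume h: "h \<in> rep_hom G X B"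
  obtain l where l: "l \<in> traces G W Y (Wend G W B)" "l * f = ?c * h"
    using traces_extend [OF S traces_unit_comp [OF h D(1) B] DC(2) W] .
  have l': "l \<in> rep_hom G Y (Wend G W B)" using traces_rep_hom [OF l(1) is_group] D DC by simp
  have \<gamma>l: "\<gamma> * l \<in> rep_hom G Y C"
    by (rule rep_hom_comp [OF DC(5) l']) (use D DC in auto)
  have "\<gamma> * l * f = \<gamma> * (l * f)"
    using rep_hom_dim [OF DC(5)] rep_hom_dim [OF l'] D(4) by (simp add: mat_assoc)
  also have "\<dots> = \<gamma> * ?c * h"
    unfolding l(2) using rep_hom_dim [OF DC(5)] rep_hom_dim [OF DC(4)] h by (simp add: mat_assoc)
  also have "\<dots> = 0\<^sub>m (deg C) (deg X)" unfolding DC(6) using h by simp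
  finally obtain k where k: "k \<in> rep_hom G Z C" "k * g = \<gamma> * l"
    using W_split_descend [OF S \<gamma>l DC(3)] by blast
  then obtain k' where k': "k' \<in> traces G W Z (Wend G W B)" "\<gamma> * k' = k"
    using traces_lift [OF C _ D(3) W, of k] vZ by blast
  have k'': "k' \<in> rep_hom G Z (Wend G W B)" using traces_rep_hom [OF k'(1) is_group] D DC by simp
  have k'g: "k' * g \<in> rep_hom G Y (Wend G W B)"
    by (rule rep_hom_comp [OF k'' D(5)]) (use D DC in auto)
  have "\<gamma> * (l - k' * g) = \<gamma> * l - \<gamma> * k' * g"
    using rep_hom_dim [OF DC(5)] rep_hom_dim [OF l'] rep_hom_dim [OF k'g] rep_hom_dim [OF k''] D(5)
    by (simp add: mat_diff_left mat_assoc)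
  also have "\<dots> = 0\<^sub>m (deg C) (deg Y)"
    unfolding k'(2) k(2) using rep_hom_dim [OF \<gamma>l] by simp
  finally obtain u where u: "u \<in> rep_hom G Y B" "?c * u = l - k' * g"
    using W_split_lift [OF C rep_hom_diff [OF l' k'g]] D DC by blast
  have "?c * (u * f) = ?c * u * f"
    using rep_hom_dim [OF DC(4)] rep_hom_dim [OF u(1)] D(4) by (simp add: mat_assoc)
  also have "\<dots> = l * f - k' * (g * f)"
    unfolding u(2) using rep_hom_dim [OF l'] rep_hom_dim [OF k'g] rep_hom_dim [OF k''] D(4,5)
    by (simp add: mat_diff_right mat_assoc)
  also have "\<dots> = ?c * h"
    unfolding D(6) l(2) using rep_hom_dim [OF DC(4)] rep_hom_dim [OF k''] h by (intro mat_eqI) auto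
  finally have "u * f = h"
    by (rule W_split_mono [OF C]) (use u(1) h in auto)
  moreover have "u * f \<in> traces G W X B"
    by (rule traces_comp_right [OF _ D(4)]) (use u(1) vY D B in auto)
  ultimately show "h \<in> traces G W X B" by simp
qed

end

section \<open>Comparison of resolutions\<close>

text \<open>
  Augmented complexes of projective modules over \<open>M\<close>, not necessarily exact.
\<close>

definition proj_complex ::
  "('g, 'b) monoid_scheme \<Rightarrow> ('g, 'k::field) rep \<Rightarrow> ('g, 'k) aug_complex \<Rightarrow> bool" where
  "proj_complex G M P \<longleftrightarrow>
     (\<forall>n. rep_projective G (ob P n)) \<and>
     (\<forall>n. bd P n \<in> rep_hom G (ob P (Suc n)) (ob P n)) \<and>
     aug P \<in> rep_hom G (ob P 0) M \<and>
     aug P * bd P 0 = 0\<^sub>m (deg M) (deg (ob P (Suc 0))) \<and>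
     (\<forall>n. bd P n * bd P (Suc n) = 0\<^sub>m (deg (ob P n)) (deg (ob P (Suc (Suc n)))))"

lemma proj_complexD:
  assumes "proj_complex G M P"
  shows "rep_projective G (ob P n)" "is_rep G (ob P n)" "bd P n \<in> rep_hom G (ob P (Suc n)) (ob P n)"
    "aug P \<in> rep_hom G (ob P 0) M" "aug P * bd P 0 = 0\<^sub>m (deg M) (deg (ob P (Suc 0)))"
    "bd P n * bd P (Suc n) = 0\<^sub>m (deg (ob P n)) (deg (ob P (Suc (Suc n))))"
  using assms by (auto simp: proj_complex_def rep_projective_def)

lemma proj_resolution_complex:
  assumes "proj_resolution G M P"
  shows "proj_complex G M P"
proof -
  have D: "\<And>n. bd P n \<in> rep_hom G (ob P (Suc n)) (ob P n)" "aug P \<in> rep_hom G (ob P 0) M"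
    "mat_image (bd P 0) = mat_kernel (aug P)" "\<And>n. mat_image (bd P (Suc n)) = mat_kernel (bd P n)"
    using assms by (auto simp: proj_resolution_def rep_surj_def)
  have "aug P * bd P 0 = 0\<^sub>m (deg M) (deg (ob P (Suc 0)))"
    by (rule exact_comp [OF rep_hom_carrier [OF D(1)] rep_hom_carrier [OF D(2)]]) (simp add: D)
  moreover have "bd P n * bd P (Suc n) = 0\<^sub>m (deg (ob P n)) (deg (ob P (Suc (Suc n))))" for n
    by (rule exact_comp [OF rep_hom_carrier [OF D(1)] rep_hom_carrier [OF D(1)]]) (simp add: D)
  ultimately show ?thesis
    using assms D by (auto simp: proj_resolution_def proj_complex_def)
qed

text \<open>Chain maps over the identity of the augmented module.\<close>

definition chain_map ::
  "('g, 'b) monoid_scheme \<Rightarrow> ('g, 'k::field) aug_complex \<Rightarrow> ('g, 'k) aug_complex \<Rightarrow> (nat \<Rightarrow> 'k mat) \<Rightarrow> bool" where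
  "chain_map G P Q \<phi> \<longleftrightarrow> (\<forall>n. \<phi> n \<in> rep_hom G (ob P n) (ob Q n)) \<and> aug Q * \<phi> 0 = aug P \<and>
     (\<forall>n. bd Q n * \<phi> (Suc n) = \<phi> n * bd P n)"

lemma chain_mapD:
  assumes "chain_map G P Q \<phi>"
  shows "\<phi> n \<in> rep_hom G (ob P n) (ob Q n)" "aug Q * \<phi> 0 = aug P" "bd Q n * \<phi> (Suc n) = \<phi> n * bd P n"
  using assms by (auto simp: chain_map_def)

lemma chain_map_id:
  assumes "proj_complex G M P"
  shows "chain_map G P P (\<lambda>n. 1\<^sub>m (deg (ob P n)))"
  unfolding chain_map_def
  using rep_hom_dim [OF proj_complexD(3) [OF assms]] rep_hom_dim [OF proj_complexD(4) [OF assms]]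
    proj_complexD(2) [OF assms] by auto

lemma chain_map_comp:
  assumes P: "proj_complex G M P" and Q: "proj_complex G M Q" and R: "proj_complex G M R"
    and \<phi>: "chain_map G P Q \<phi>" and \<psi>: "chain_map G Q R \<psi>"
  shows "chain_map G P R (\<lambda>n. \<psi> n * \<phi> n)"
  unfolding chain_map_def
proof (intro conjI allI)
  note d = rep_hom_dim [OF proj_complexD(3) [OF P]] rep_hom_dim [OF proj_complexD(3) [OF Q]]
    rep_hom_dim [OF proj_complexD(3) [OF R]] rep_hom_dim [OF proj_complexD(4) [OF R]]
    rep_hom_dim [OF chain_mapD(1) [OF \<phi>]] rep_hom_dim [OF chain_mapD(1) [OF \<psi>]]
  show "\<psi> n * \<phi> n \<in> rep_hom G (ob P n) (ob R n)" for n
    by (rule rep_hom_comp [OF chain_mapD(1) [OF \<psi>] chain_mapD(1) [OF \<phi>]])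
      (rule proj_complexD [OF P] proj_complexD [OF Q] proj_complexD [OF R])+
  have "aug R * (\<psi> 0 * \<phi> 0) = aug R * \<psi> 0 * \<phi> 0" using d by (simp add: mat_assoc)
  then show "aug R * (\<psi> 0 * \<phi> 0) = aug P"
    unfolding chain_mapD(2) [OF \<psi>] chain_mapD(2) [OF \<phi>] .
  show "bd R n * (\<psi> (Suc n) * \<phi> (Suc n)) = \<psi> n * \<phi> n * bd P n" for n
  proof -
    have "bd R n * (\<psi> (Suc n) * \<phi> (Suc n)) = bd R n * \<psi> (Suc n) * \<phi> (Suc n)"
      using d by (simp add: mat_assoc)
    also have "\<dots> = \<psi> n * (bd Q n * \<phi> (Suc n))"
      unfolding chain_mapD(3) [OF \<psi>] using d by (simp add: mat_assoc)
    also have "\<dots> = \<psi> n * \<phi> n * bd P n"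
      unfolding chain_mapD(3) [OF \<phi>] using d by (simp add: mat_assoc)
    finally show ?thesis .
  qed
qed

text \<open>The complex \<open>P \<otimes> W\<close>.\<close>

definition complex_tensor :: "('g, 'k::field) rep \<Rightarrow> ('g, 'k) aug_complex \<Rightarrow> ('g, 'k) aug_complex" where
  "complex_tensor W P = Aug_Complex (\<lambda>n. tensor (ob P n) W) (\<lambda>n. kron (bd P n) (1\<^sub>m (deg W)))
     (kron (aug P) (1\<^sub>m (deg W)))"

lemma complex_tensor_simps [simp]:
  "ob (complex_tensor W P) n = tensor (ob P n) W" "bd (complex_tensor W P) n = kron (bd P n) (1\<^sub>m (deg W))"
  "aug (complex_tensor W P) = kron (aug P) (1\<^sub>m (deg W))"
  by (simp_all add: complex_tensor_def)

lemma chain_map_tensor: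
  assumes P: "proj_complex G M P" and Q: "proj_complex G M Q" and \<phi>: "chain_map G P Q \<phi>" and W: "is_rep G W"
  shows "chain_map G (complex_tensor W P) (complex_tensor W Q) (\<lambda>n. kron (\<phi> n) (1\<^sub>m (deg W)))"
  unfolding chain_map_def complex_tensor_simps
proof (intro conjI allI)
  note d = rep_hom_dim [OF proj_complexD(3) [OF P]] rep_hom_dim [OF proj_complexD(3) [OF Q]]
    rep_hom_dim [OF proj_complexD(4) [OF Q]] rep_hom_dim [OF chain_mapD(1) [OF \<phi>]]
  show "kron (\<phi> n) (1\<^sub>m (deg W)) \<in> rep_hom G (tensor (ob P n) W) (tensor (ob Q n) W)" for n
    by (rule rep_hom_kron_right [OF chain_mapD(1) [OF \<phi>] W])
      (rule proj_complexD [OF P] proj_complexD [OF Q])+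
  show "kron (aug Q) (1\<^sub>m (deg W)) * kron (\<phi> 0) (1\<^sub>m (deg W)) = kron (aug P) (1\<^sub>m (deg W))"
    using d chain_mapD(2) [OF \<phi>] by (simp add: kron_mult)
  show "kron (bd Q n) (1\<^sub>m (deg W)) * kron (\<phi> (Suc n)) (1\<^sub>m (deg W)) =
      kron (\<phi> n) (1\<^sub>m (deg W)) * kron (bd P n) (1\<^sub>m (deg W))" for n
    using d chain_mapD(3) [OF \<phi>] by (simp add: kron_mult)
qed

context augmentation
begin

lemma projective_tensor:
  fixes P W :: "('g, 'k) rep"
  assumes "rep_projective G P" "is_rep G W"
  shows "rep_projective G (tensor P W)"
  using assms higman_tensor [OF is_group, of P W] by (simp add: projective_iff_higman)

lemma proj_complex_tensor:
  fixes P :: "('g, 'k) aug_complex"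
  assumes P: "proj_complex G M P" and "is_rep G M" and W: "is_rep G W"
  shows "proj_complex G (tensor M W) (complex_tensor W P)"
  unfolding proj_complex_def complex_tensor_simps
proof (intro conjI allI)
  note D = proj_complexD [OF P]
  note d = rep_hom_dim [OF D(3)] rep_hom_dim [OF D(4)]
  show "rep_projective G (tensor (ob P n) W)" for n
    using projective_tensor [OF D(1) W] .
  show "kron (bd P n) (1\<^sub>m (deg W)) \<in> rep_hom G (tensor (ob P (Suc n)) W) (tensor (ob P n) W)" for n
    by (rule rep_hom_kron_right [OF D(3) W D(2) D(2)])
  show "kron (aug P) (1\<^sub>m (deg W)) \<in> rep_hom G (tensor (ob P 0) W) (tensor M W)"
    by (rule rep_hom_kron_right [OF D(4) W D(2) assms(2)])
  show "kron (aug P) (1\<^sub>m (deg W)) * kron (bd P 0) (1\<^sub>m (deg W)) =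
      0\<^sub>m (deg (tensor M W)) (deg (tensor (ob P (Suc 0)) W))"
    using d D(5) by (simp add: kron_mult)
  show "kron (bd P n) (1\<^sub>m (deg W)) * kron (bd P (Suc n)) (1\<^sub>m (deg W)) =
      0\<^sub>m (deg (tensor (ob P n) W)) (deg (tensor (ob P (Suc (Suc n))) W))" for n
    using d D(6) by (simp add: kron_mult)
qed

text \<open>The lifting step of the comparison theorem.\<close>

lemma projective_lift_exact:
  fixes P :: "('g, 'k) rep"
  assumes "rep_projective G P" "is_rep G A" "is_rep G B"
    and "a \<in> rep_hom G A B" "b \<in> rep_hom G B C" "mat_image a = mat_kernel b"
    and "h \<in> rep_hom G P B" "b * h = 0\<^sub>m (deg C) (deg P)"
  obtains k where "k \<in> rep_hom G P A" "a * k = h"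
proof -
  obtain L where "L \<in> carrier_mat (deg A) (deg P)" "a * L = h"
    using exact_lift [OF rep_hom_carrier [OF assms(4)] rep_hom_carrier [OF assms(5)]
        rep_hom_carrier [OF assms(7)] assms(6,8)] .
  then show thesis
    using higman_lift [OF is_group _ _ assms(2,3,4,7)] assms(1) that by (auto simp: projective_iff_higman)
qed

lemma chain_map_exists:
  fixes P Q :: "('g, 'k) aug_complex"
  assumes P: "proj_complex G M P" and Q: "proj_resolution G M Q" and M: "is_rep G M"
  obtains \<phi> where "chain_map G P Q \<phi>"
proof -
  note D = proj_complexD [OF P] and DQ = proj_complexD [OF proj_resolution_complex [OF Q]]
  note d = rep_hom_dim [OF D(3)] rep_hom_dim [OF D(4)] rep_hom_dim [OF DQ(3)] rep_hom_dim [OF DQ(4)]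
  \<comment> \<open>the differential out of degree \<open>n\<close>, which is the augmentation for \<open>n = 0\<close>\<close>
  define b where "b n = (case n of 0 \<Rightarrow> aug Q | Suc k \<Rightarrow> bd Q k)" for n
  define T where "T n = (case n of 0 \<Rightarrow> M | Suc k \<Rightarrow> ob Q k)" for n
  have b: "b n \<in> rep_hom G (ob Q n) (T n)" for n
    using DQ by (auto simp: b_def T_def split: nat.split)
  have ex: "mat_image (bd Q n) = mat_kernel (b n)" for n
    using Q by (auto simp: b_def proj_resolution_def split: nat.split)
  note d = d rep_hom_dim [OF b]
  \<comment> \<open>the invariant under which the next component of the chain map can be chosen\<close>
  define A where "A n \<phi> \<longleftrightarrow> \<phi> \<in> rep_hom G (ob P n) (ob Q n) \<and> (n = 0 \<longrightarrow> aug Q * \<phi> = aug P) \<and>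
    b n * (\<phi> * bd P n) = 0\<^sub>m (deg (T n)) (deg (ob P (Suc n)))" for n \<phi>
  have "\<exists>\<phi>. \<forall>n. A n (\<phi> n) \<and> bd Q n * \<phi> (Suc n) = \<phi> n * bd P n"
  proof (rule dependent_nat_choice)
    obtain L where "L \<in> carrier_mat (deg (ob Q 0)) (deg (ob P 0))" "aug Q * L = aug P"
      using surj_lift [OF rep_hom_carrier [OF DQ(4)] _ rep_hom_carrier [OF D(4)]] Q
      by (auto simp: proj_resolution_def rep_surj_def)
    then obtain \<phi> where \<phi>: "\<phi> \<in> rep_hom G (ob P 0) (ob Q 0)" "aug Q * \<phi> = aug P"
      using higman_lift [OF is_group _ _ DQ(2) M DQ(4) D(4)] D(1) [of 0] by (auto simp: projective_iff_higman)
    have "b 0 * (\<phi> * bd P 0) = aug Q * \<phi> * bd P 0"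
      using d \<phi>(1) by (simp add: mat_assoc b_def)
    then have "A 0 \<phi>" unfolding A_def \<phi>(2) D(5) using \<phi> by (simp add: T_def)
    then show "\<exists>\<phi>. A 0 \<phi>" by blast
  next
    fix \<phi> n assume "A n \<phi>"
    then have \<phi>: "\<phi> \<in> rep_hom G (ob P n) (ob Q n)" "b n * (\<phi> * bd P n) = 0\<^sub>m (deg (T n)) (deg (ob P (Suc n)))"
      by (auto simp: A_def)
    obtain \<psi> where \<psi>: "\<psi> \<in> rep_hom G (ob P (Suc n)) (ob Q (Suc n))" "bd Q n * \<psi> = \<phi> * bd P n"
      using projective_lift_exact [OF D(1) DQ(2) DQ(2) DQ(3) b ex rep_hom_comp [OF \<phi>(1) D(3) D(2) D(2) DQ(2)] \<phi>(2)] .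
    have "b (Suc n) * (\<psi> * bd P (Suc n)) = bd Q n * \<psi> * bd P (Suc n)"
      using d \<psi>(1) by (simp add: mat_assoc b_def)
    also have "\<dots> = \<phi> * (bd P n * bd P (Suc n))"
      unfolding \<psi>(2) using d \<phi>(1) by (simp add: mat_assoc)
    also have "\<dots> = 0\<^sub>m (deg (T (Suc n))) (deg (ob P (Suc (Suc n))))"
      unfolding D(6) using \<phi>(1) by (simp add: T_def)
    finally show "\<exists>\<psi>. A (Suc n) \<psi> \<and> bd Q n * \<psi> = \<phi> * bd P n"
      using \<psi> by (auto simp: A_def)
  qed
  then obtain \<phi> where "\<And>n. A n (\<phi> n)" "\<And>n. bd Q n * \<phi> (Suc n) = \<phi> n * bd P n" by blast
  then show thesis by (intro that [of \<phi>]) (auto simp: chain_map_def A_def)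
qed

text \<open>Two chain maps over the identity are homotopic.  Only the positive degrees are stated; the
  homotopy formula in degree zero has one term.\<close>

lemma chain_homotopy_exists:
  fixes P Q :: "('g, 'k) aug_complex"
  assumes P: "proj_complex G M P" and Q: "proj_resolution G M Q"
    and \<phi>: "chain_map G P Q \<phi>" and \<psi>: "chain_map G P Q \<psi>"
  obtains s where "\<And>n. s n \<in> rep_hom G (ob P n) (ob Q (Suc n))"
    "\<And>n. \<phi> (Suc n) - \<psi> (Suc n) = bd Q (Suc n) * s (Suc n) + s n * bd P n"
proof -
  note D = proj_complexD [OF P] and DQ = proj_complexD [OF proj_resolution_complex [OF Q]]
  note F = chain_mapD [OF \<phi>] and S = chain_mapD [OF \<psi>]
  note d = rep_hom_dim [OF D(3)] rep_hom_dim [OF DQ(3)] rep_hom_dim [OF DQ(4)]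
    rep_hom_dim [OF F(1)] rep_hom_dim [OF S(1)]
  define E where "E n = \<phi> n - \<psi> n" for n
  have E: "E n \<in> rep_hom G (ob P n) (ob Q n)" for n
    unfolding E_def by (rule rep_hom_diff [OF F(1) S(1) D(2) DQ(2)])
  note d = d rep_hom_dim [OF E]
  have E_aug: "aug Q * E 0 = 0\<^sub>m (deg M) (deg (ob P 0))"
    unfolding E_def using d F(2) S(2) rep_hom_dim [OF D(4)] by (simp add: mat_diff_left)
  have E_bd: "bd Q n * E (Suc n) = E n * bd P n" for n
    unfolding E_def using d F(3) S(3) by (simp add: mat_diff_left mat_diff_right)
  have ex: "mat_image (bd Q 0) = mat_kernel (aug Q)" "mat_image (bd Q (Suc n)) = mat_kernel (bd Q n)" for n
    using Q by (auto simp: proj_resolution_def)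
  \<comment> \<open>the invariant under which the next component of the homotopy can be chosen\<close>
  define A where "A n s \<longleftrightarrow> s \<in> rep_hom G (ob P n) (ob Q (Suc n)) \<and>
    (E n - bd Q n * s) * bd P n = 0\<^sub>m (deg (ob Q n)) (deg (ob P (Suc n)))" for n s
  have "\<exists>s. \<forall>n. A n (s n) \<and> bd Q (Suc n) * s (Suc n) = E (Suc n) - s n * bd P n"
  proof (rule dependent_nat_choice)
    obtain s where "s \<in> rep_hom G (ob P 0) (ob Q (Suc 0))" "bd Q 0 * s = E 0"
      using projective_lift_exact [OF D(1) DQ(2) DQ(2) DQ(3) DQ(4) ex(1) E E_aug] .
    then have "A 0 s" unfolding A_def using d by simp
    then show "\<exists>s. A 0 s" by blast
  next
    fix s n assume "A n s"
    then have s: "s \<in> rep_hom G (ob P n) (ob Q (Suc n))"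
      "(E n - bd Q n * s) * bd P n = 0\<^sub>m (deg (ob Q n)) (deg (ob P (Suc n)))"
      by (auto simp: A_def)
    let ?h = "E (Suc n) - s * bd P n"
    have sb: "s * bd P n \<in> rep_hom G (ob P (Suc n)) (ob Q (Suc n))"
      by (rule rep_hom_comp [OF s(1) D(3) D(2) D(2) DQ(2)])
    have h: "?h \<in> rep_hom G (ob P (Suc n)) (ob Q (Suc n))"
      by (rule rep_hom_diff [OF E sb D(2) DQ(2)])
    have "bd Q n * ?h = (E n - bd Q n * s) * bd P n"
      using d s(1) by (simp add: mat_diff_left mat_diff_right mat_assoc E_bd)
    then have 0: "bd Q n * ?h = 0\<^sub>m (deg (ob Q n)) (deg (ob P (Suc n)))" using s(2) by simp
    obtain s' where s': "s' \<in> rep_hom G (ob P (Suc n)) (ob Q (Suc (Suc n)))" "bd Q (Suc n) * s' = ?h"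
      using projective_lift_exact [OF D(1) DQ(2) DQ(2) DQ(3) DQ(3) ex(2) h 0] .
    have "E (Suc n) - ?h = s * bd P n"
      using d s(1) by (intro mat_eqI) auto
    then have "(E (Suc n) - bd Q (Suc n) * s') * bd P (Suc n) = s * (bd P n * bd P (Suc n))"
      unfolding s'(2) using d s(1) by (simp add: mat_assoc)
    then have "A (Suc n) s'" unfolding A_def D(6) using s'(1) s(1) by simp
    then show "\<exists>s'. A (Suc n) s' \<and> bd Q (Suc n) * s' = ?h" using s'(2) by blast
  qed
  then obtain s where s: "\<And>n. A n (s n)" "\<And>n. bd Q (Suc n) * s (Suc n) = E (Suc n) - s n * bd P n" by blast
  have sh: "s n \<in> rep_hom G (ob P n) (ob Q (Suc n))" for n using s(1) by (simp add: A_def)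
  have "\<phi> (Suc n) - \<psi> (Suc n) = bd Q (Suc n) * s (Suc n) + s n * bd P n" for n
    unfolding s(2) E_def using d rep_hom_dim [OF sh] by (intro mat_eqI) auto
  with sh show thesis by (intro that)
qed

section \<open>Syzygies and the standard resolution\<close>

text \<open>The syzygies \<open>I \<otimes> \<dots> \<otimes> I \<otimes> X\<close> of the standard resolution.\<close>

primrec syz :: "nat \<Rightarrow> ('g, 'k) rep \<Rightarrow> ('g, 'k) rep" where
  "syz 0 X = X"
| "syz (Suc n) X = tensor I (syz n X)"

lemma syz_rep: "is_rep G X \<Longrightarrow> is_rep G (syz n X)"
  by (induction n) (auto simp: I_rep)

lemma syz_tensor: "syz n (tensor X A) = tensor (syz n X) A"
  by (induction n) (auto simp: tensor_assoc)

lemma syz_triv: "syz n X = tensor (syz n triv) X"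
  using syz_tensor [of n triv X] by simp

text \<open>The projection \<open>kG \<otimes> \<Omega>\<^sup>n X \<rightarrow> \<Omega>\<^sup>n X\<close> and the inclusion \<open>\<Omega>\<^sup>n\<^sup>+\<^sup>1 X \<rightarrow> kG \<otimes> \<Omega>\<^sup>n X\<close>.\<close>

definition syz_proj :: "nat \<Rightarrow> ('g, 'k) rep \<Rightarrow> 'k mat" where
  "syz_proj n X = kron \<epsilon> (1\<^sub>m (deg (syz n X)))"

definition syz_inj :: "nat \<Rightarrow> ('g, 'k) rep \<Rightarrow> 'k mat" where
  "syz_inj n X = kron j (1\<^sub>m (deg (syz n X)))"

lemma syz_split:
  assumes "is_rep G X"
  obtains p s where "split_exact G (syz (Suc n) X) (tensor F (syz n X)) (syz n X) (syz_inj n X) (syz_proj n X) p s"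
  using split_exact_tensor_right [OF aug_split syz_rep [OF assms]]
  by (auto simp: syz_proj_def syz_inj_def)

text \<open>The resolution spliced from the sequences \<open>\<Omega>\<^sup>n\<^sup>+\<^sup>1 X \<rightarrow> kG \<otimes> \<Omega>\<^sup>n X \<rightarrow> \<Omega>\<^sup>n X\<close>.\<close>

definition standard :: "('g, 'k) rep \<Rightarrow> ('g, 'k) aug_complex" where
  "standard X = Aug_Complex (\<lambda>n. tensor F (syz n X)) (\<lambda>n. syz_inj n X * syz_proj (Suc n) X) (syz_proj 0 X)"

lemma standard_simps [simp]:
  "ob (standard X) n = tensor F (syz n X)" "bd (standard X) n = syz_inj n X * syz_proj (Suc n) X"
  "aug (standard X) = syz_proj 0 X"
  by (simp_all add: standard_def)

lemma free_projective:
  assumes "is_rep G X"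
  shows "rep_projective G (tensor F X)"
  using assms higman_tensor [OF is_group F_rep higman_F] F_rep by (simp add: projective_iff_higman)

lemma syz_hom:
  assumes "is_rep G X"
  shows "syz_inj n X \<in> rep_hom G (syz (Suc n) X) (tensor F (syz n X))"
    "syz_proj n X \<in> rep_hom G (tensor F (syz n X)) (syz n X)"
    "syz_proj n X * syz_inj n X = 0\<^sub>m (deg (syz n X)) (deg (syz (Suc n) X))"
  using syz_split [OF assms, of n] split_exactD by metis+

lemma standard_resolution:
  assumes X: "is_rep G X"
  shows "proj_resolution G X (standard X)"
  unfolding proj_resolution_def standard_simps
proof (intro conjI allI)
  note H = syz_hom [OF X] and R = syz_rep [OF X] F_rep is_rep_tensor
  show "rep_projective G (tensor F (syz n X))" for n
    using free_projective [OF syz_rep [OF X]] .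
  show "syz_inj n X * syz_proj (Suc n) X \<in> rep_hom G (tensor F (syz (Suc n) X)) (tensor F (syz n X))" for n
    by (rule rep_hom_comp [OF H(1,2)]) (intro R)+
  show "rep_surj G (tensor F (syz 0 X)) X (syz_proj 0 X)"
    using syz_split [OF X, of 0] short_exact_if_split_exact by (metis short_exact_def syz.simps(1))
  have ex: "mat_image (syz_inj n X * syz_proj (Suc n) X) = mat_kernel (syz_proj n X)" for n
  proof -
    obtain p s where S: "split_exact G (syz (Suc n) X) (tensor F (syz n X)) (syz n X) (syz_inj n X) (syz_proj n X) p s"
      using syz_split [OF X] .
    obtain p' s' where S': "split_exact G (syz (Suc (Suc n)) X) (tensor F (syz (Suc n) X)) (syz (Suc n) X)
        (syz_inj (Suc n) X) (syz_proj (Suc n) X) p' s'"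
      using syz_split [OF X] .
    show ?thesis using split_exact_splice(1) [OF S' S] .
  qed
  then show "mat_image (syz_inj 0 X * syz_proj (Suc 0) X) = mat_kernel (syz_proj 0 X)" .
  show "mat_image (syz_inj (Suc n) X * syz_proj (Suc (Suc n)) X) = mat_kernel (syz_inj n X * syz_proj (Suc n) X)" for n
  proof -
    obtain p s where S: "split_exact G (syz (Suc n) X) (tensor F (syz n X)) (syz n X) (syz_inj n X) (syz_proj n X) p s"
      using syz_split [OF X] .
    obtain p' s' where S': "split_exact G (syz (Suc (Suc n)) X) (tensor F (syz (Suc n) X)) (syz (Suc n) X)
        (syz_inj (Suc n) X) (syz_proj (Suc n) X) p' s'"
      using syz_split [OF X] .
    show ?thesis using ex split_exact_splice(2) [OF S' S] by simp
  qed
qed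

text \<open>By strict associativity, tensoring the standard resolution of \<open>X\<close> with \<open>W\<close> gives the standard resolution
  of \<open>X \<otimes> W\<close> on the nose.\<close>

lemma standard_tensor:
  assumes "is_rep G X"
  shows "complex_tensor W (standard X) = standard (tensor X W)"
proof -
  note d = rep_hom_dim [OF syz_hom(1) [OF assms]] rep_hom_dim [OF syz_hom(2) [OF assms]]
  have 1: "kron (syz_inj n X) (1\<^sub>m (deg W)) = syz_inj n (tensor X W)"
    "kron (syz_proj n X) (1\<^sub>m (deg W)) = syz_proj n (tensor X W)" for n
    by (simp_all add: syz_inj_def syz_proj_def kron_assoc syz_tensor)
  have "kron (syz_inj n X * syz_proj (Suc n) X) (1\<^sub>m (deg W)) =
      kron (syz_inj n X) (1\<^sub>m (deg W)) * kron (syz_proj (Suc n) X) (1\<^sub>m (deg W))" for n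
    using d by (simp add: kron_mult)
  then show ?thesis
    unfolding complex_tensor_def standard_simps by (simp add: standard_def 1 tensor_assoc syz_tensor)
qed

lemma resolution_is_resolution:
  fixes X :: "('g, 'k) rep"
  assumes "is_rep G X"
  shows "proj_resolution G X (resolution G X)"
  unfolding resolution_def by (rule someI, rule standard_resolution [OF assms])

end

section \<open>The transfer and virtually projective modules\<close>

text \<open>The standing assumptions on \<open>W\<close>, and a chosen augmentation sequence.\<close>

locale ext_setting = augmentation G F I j \<epsilon> q t + rel_setting G W
  for G :: "('g, 'b) monoid_scheme" (structure) and F I :: "('g, 'k::field) rep" and j \<epsilon> q t
    and W :: "('g, 'k) rep"
begin

lemma ext_resolution:
  fixes X :: "('g, 'k) rep"
  assumes "is_rep G X"
  shows "proj_complex G X (resolution G X)"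
  using resolution_is_resolution [OF assms] by (rule proj_resolution_complex)

lemma cocycles_iff:
  "f \<in> cocycles G n X Y \<longleftrightarrow> f \<in> rep_hom G (ob (resolution G X) n) Y \<and>
     f * bd (resolution G X) n = 0\<^sub>m (deg Y) (deg (ob (resolution G X) (Suc n)))"
  by (simp add: cocycles_def Let_def)

lemma coboundaries_iff:
  "f \<in> coboundaries G (Suc m) X Y \<longleftrightarrow> (\<exists>h\<in>rep_hom G (ob (resolution G X) m) Y. f = h * bd (resolution G X) m)"
  by (auto simp: coboundaries_def Let_def)

context
  fixes X Y :: "('g, 'k) rep" and m :: nat
  assumes X: "is_rep G X" and Y: "is_rep G Y"
begin

lemma ext_rel_equiv: "equiv (cocycles G (Suc m) X Y) (ext_rel G (Suc m) X Y)"
  unfolding ext_rel_def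
proof (rule equiv_mod_mat)
  let ?P = "resolution G X"
  note D = proj_complexD [OF ext_resolution [OF X]]
  note d = rep_hom_dim [OF D(3)]
  show "cocycles G (Suc m) X Y \<subseteq> carrier_mat (deg Y) (deg (ob ?P (Suc m)))"
    by (auto simp: cocycles_iff dest: rep_hom_carrier)
  have "0\<^sub>m (deg Y) (deg (ob ?P (Suc m))) = 0\<^sub>m (deg Y) (deg (ob ?P m)) * bd ?P m"
    using d by simp
  then show "0\<^sub>m (deg Y) (deg (ob ?P (Suc m))) \<in> coboundaries G (Suc m) X Y"
    using rep_hom_zero [OF D(2) Y] by (auto simp: coboundaries_iff)
  fix f g assume "f \<in> coboundaries G (Suc m) X Y" "g \<in> coboundaries G (Suc m) X Y"
  then obtain h k where h: "h \<in> rep_hom G (ob ?P m) Y" "f = h * bd ?P m"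
    and k: "k \<in> rep_hom G (ob ?P m) Y" "g = k * bd ?P m"
    by (auto simp: coboundaries_iff)
  have "f - g = (h - k) * bd ?P m" using h k d by (simp add: mat_diff_right)
  then show "f - g \<in> coboundaries G (Suc m) X Y"
    using rep_hom_diff [OF h(1) k(1) D(2) Y] unfolding coboundaries_iff by blast
qed

lemma ext_class_eq_iff:
  assumes "f \<in> cocycles G (Suc m) X Y" "g \<in> cocycles G (Suc m) X Y"
  shows "ext_class G (Suc m) X Y f = ext_class G (Suc m) X Y g \<longleftrightarrow> f - g \<in> coboundaries G (Suc m) X Y"
  using eq_equiv_class_iff [OF ext_rel_equiv assms] assms by (auto simp: ext_class_def ext_rel_def)

lemma Ext_eq: "Ext G (Suc m) X Y = ext_class G (Suc m) X Y ` cocycles G (Suc m) X Y"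
  by (auto simp: Ext_def quotient_def ext_class_def)

lemma mem_ext_class_iff:
  "g \<in> ext_class G (Suc m) X Y f \<longleftrightarrow> f \<in> cocycles G (Suc m) X Y \<and> g \<in> cocycles G (Suc m) X Y \<and>
     f - g \<in> coboundaries G (Suc m) X Y"
  by (auto simp: ext_class_def ext_rel_def)

lemma ext_class_self:
  "f \<in> cocycles G (Suc m) X Y \<Longrightarrow> f \<in> ext_class G (Suc m) X Y f"
  using equiv_class_self [OF ext_rel_equiv] by (simp add: ext_class_def)

end

text \<open>A union over representatives of a class is the class of any one of them.\<close>

lemma UN_ext_class:
  fixes X Y :: "('g, 'k) rep"
  assumes "is_rep G X" "is_rep G Y" "c \<in> C"
    and "\<And>f. f \<in> C \<Longrightarrow> a f \<in> cocycles G (Suc m) X Y \<and> a c - a f \<in> coboundaries G (Suc m) X Y"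
  shows "(\<Union>f\<in>C. ext_class G (Suc m) X Y (a f)) = ext_class G (Suc m) X Y (a c)"
proof -
  have "ext_class G (Suc m) X Y (a f) = ext_class G (Suc m) X Y (a c)" if "f \<in> C" for f
    using ext_class_eq_iff [OF assms(1,2), of "a c" m "a f"] assms(4) [OF assms(3)] assms(4) [OF that] by simp
  then have "(\<Union>f\<in>C. ext_class G (Suc m) X Y (a f)) = (\<Union>f\<in>C. ext_class G (Suc m) X Y (a c))"
    by (intro SUP_cong refl)
  also have "\<dots> = ext_class G (Suc m) X Y (a c)"
    using assms(3) by (intro UN_constant_eq) auto
  finally show ?thesis .
qed

lemma comparison_chain_map:
  fixes X :: "('g, 'k) rep"
  assumes X: "is_rep G X"
  shows "chain_map G (complex_tensor W (resolution G X)) (resolution G (tensor X W)) (comparison G W X)"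
proof -
  have XW: "is_rep G (tensor X W)" using X W by simp
  obtain \<phi> where "chain_map G (complex_tensor W (resolution G X)) (resolution G (tensor X W)) \<phi>"
    using chain_map_exists [OF proj_complex_tensor [OF ext_resolution [OF X] X W] resolution_is_resolution [OF XW] XW] .
  then have "is_comparison G W X \<phi>"
    by (simp add: is_comparison_def chain_map_def Let_def)
  then have "is_comparison G W X (comparison G W X)"
    unfolding comparison_def by (rule someI [of "is_comparison G W X"])
  then show ?thesis
    by (simp add: is_comparison_def chain_map_def Let_def)
qed

text \<open>On cocycles the transfer is the trace of the pullback along the comparison map.\<close>

lemma transfer_class:
  fixes X Y :: "('g, 'k) rep"
  assumes X: "is_rep G X" and Y: "is_rep G Y" and c: "c \<in> cocycles G (Suc m) (tensor X W) (tensor Y W)"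
  defines "T \<equiv> tr W (ob (resolution G X) (Suc m)) Y (c * comparison G W X (Suc m))"
  shows "T \<in> cocycles G (Suc m) X Y"
    and "transfer G W (Suc m) X Y (ext_class G (Suc m) (tensor X W) (tensor Y W) c) = ext_class G (Suc m) X Y T"
proof -
  let ?P = "resolution G X" and ?Q = "resolution G (tensor X W)"
  let ?\<phi> = "comparison G W X" and ?YW = "tensor Y W" and ?YE = "Wend G W Y"
  let ?w = "1\<^sub>m (deg W) :: 'k mat"
  let ?a = "\<lambda>f. hom_adj W (ob ?P (Suc m)) (f * ?\<phi> (Suc m))"
  have XW: "is_rep G (tensor X W)" and YW: "is_rep G ?YW" and YE: "is_rep G ?YE" using X Y W by simp_all
  note D = proj_complexD [OF ext_resolution [OF X]] and DQ = proj_complexD [OF ext_resolution [OF XW]]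
  note \<phi> = chain_mapD [OF comparison_chain_map [OF X], unfolded complex_tensor_simps]
  note d = rep_hom_dim [OF D(3)] rep_hom_dim [OF DQ(3)] rep_hom_dim [OF \<phi>(1)]
  have PW: "is_rep G (tensor (ob ?P n) W)" for n using D(2) W by simp
  have a: "?a f \<in> cocycles G (Suc m) X ?YE" if f: "f \<in> cocycles G (Suc m) (tensor X W) ?YW" for f
  proof -
    have f': "f \<in> rep_hom G (ob ?Q (Suc m)) ?YW" "f * bd ?Q (Suc m) = 0\<^sub>m (deg ?YW) (deg (ob ?Q (Suc (Suc m))))"
      using f by (auto simp: cocycles_iff)
    have f\<phi>: "f * ?\<phi> (Suc m) \<in> rep_hom G (tensor (ob ?P (Suc m)) W) ?YW"
      by (rule rep_hom_comp [OF f'(1) \<phi>(1) PW DQ(2) YW])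
    have "?a f * bd ?P (Suc m) = hom_adj W (ob ?P (Suc (Suc m))) (f * ?\<phi> (Suc m) * kron (bd ?P (Suc m)) ?w)"
      by (rule hom_adj_comp_right [symmetric]) (use rep_hom_dim [OF f\<phi>] rep_hom_carrier [OF D(3)] in auto)
    also have "f * ?\<phi> (Suc m) * kron (bd ?P (Suc m)) ?w = f * bd ?Q (Suc m) * ?\<phi> (Suc (Suc m))"
      using d f'(1) \<phi>(3) by (simp add: mat_assoc)
    also have "\<dots> = 0\<^sub>m (deg ?YW) (deg (tensor (ob ?P (Suc (Suc m))) W))"
      unfolding f'(2) using d by simp
    also have "hom_adj W (ob ?P (Suc (Suc m))) \<dots> = 0\<^sub>m (deg ?YE) (deg (ob ?P (Suc (Suc m))))"
      by (simp add: hom_adj_def mult.assoc)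
    finally show ?thesis
      using hom_adj_hom [OF is_group W D(2) YW f\<phi>] by (simp add: cocycles_iff)
  qed
  have a_diff: "?a c - ?a f \<in> coboundaries G (Suc m) X ?YE"
    if f: "f \<in> ext_class G (Suc m) (tensor X W) ?YW c" for f
  proof -
    have f': "f \<in> rep_hom G (ob ?Q (Suc m)) ?YW" and c': "c \<in> rep_hom G (ob ?Q (Suc m)) ?YW"
      using f c by (auto simp: cocycles_iff mem_ext_class_iff [OF XW YW])
    obtain h where h: "h \<in> rep_hom G (ob ?Q m) ?YW" "c - f = h * bd ?Q m"
      using f by (auto simp: mem_ext_class_iff [OF XW YW] coboundaries_iff)
    have h\<phi>: "h * ?\<phi> m \<in> rep_hom G (tensor (ob ?P m) W) ?YW"
      by (rule rep_hom_comp [OF h(1) \<phi>(1) PW DQ(2) YW])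
    have "?a c - ?a f = hom_adj W (ob ?P (Suc m)) ((c - f) * ?\<phi> (Suc m))"
      using d f' c' by (simp add: hom_adj_diff mat_diff_right)
    also have "(c - f) * ?\<phi> (Suc m) = h * ?\<phi> m * kron (bd ?P m) ?w"
      unfolding h(2) using d h(1) \<phi>(3) by (simp add: mat_assoc)
    also have "hom_adj W (ob ?P (Suc m)) \<dots> = hom_adj W (ob ?P m) (h * ?\<phi> m) * bd ?P m"
      by (rule hom_adj_comp_right) (use rep_hom_dim [OF h\<phi>] rep_hom_carrier [OF D(3)] in auto)
    finally show ?thesis
      using hom_adj_hom [OF is_group W D(2) YW h\<phi>] by (auto simp: coboundaries_iff)
  qed
  have 1: "ext_adj G W (Suc m) X ?YW (ext_class G (Suc m) (tensor X W) ?YW c) = ext_class G (Suc m) X ?YE (?a c)"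
    unfolding ext_adj_def
  proof (rule UN_ext_class [OF X YE ext_class_self [OF XW YW c]])
    fix f assume f: "f \<in> ext_class G (Suc m) (tensor X W) ?YW c"
    then have "f \<in> cocycles G (Suc m) (tensor X W) ?YW"
      by (simp add: mem_ext_class_iff [OF XW YW])
    then show "?a f \<in> cocycles G (Suc m) X ?YE \<and> ?a c - ?a f \<in> coboundaries G (Suc m) X ?YE"
      using a a_diff [OF f] by blast
  qed
  note E = Wcounit_hom [OF Y]
  have E_coc: "Wcounit W Y * f \<in> cocycles G (Suc m) X Y" if f: "f \<in> cocycles G (Suc m) X ?YE" for f
  proof -
    have f': "f \<in> rep_hom G (ob ?P (Suc m)) ?YE" "f * bd ?P (Suc m) = 0\<^sub>m (deg ?YE) (deg (ob ?P (Suc (Suc m))))"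
      using f by (auto simp: cocycles_iff)
    have "Wcounit W Y * f * bd ?P (Suc m) = Wcounit W Y * (f * bd ?P (Suc m))"
      using d rep_hom_dim [OF f'(1)] rep_hom_dim [OF E] by (simp add: mat_assoc)
    also have "\<dots> = 0\<^sub>m (deg Y) (deg (ob ?P (Suc (Suc m))))"
      unfolding f'(2) using rep_hom_dim [OF E] by simp
    finally show ?thesis
      using rep_hom_comp [OF E f'(1) D(2) YE Y] by (simp add: cocycles_iff)
  qed
  have 2: "ext_map G (Suc m) X Y (Wcounit W Y) (ext_class G (Suc m) X ?YE (?a c)) =
      ext_class G (Suc m) X Y (Wcounit W Y * ?a c)"
    unfolding ext_map_def
  proof (rule UN_ext_class [OF X Y ext_class_self [OF X YE a [OF c]]])
    fix f assume f: "f \<in> ext_class G (Suc m) X ?YE (?a c)"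
    have f': "f \<in> cocycles G (Suc m) X ?YE" using f by (simp add: mem_ext_class_iff [OF X YE])
    obtain h where h: "h \<in> rep_hom G (ob ?P m) ?YE" "?a c - f = h * bd ?P m"
      using f by (auto simp: mem_ext_class_iff [OF X YE] coboundaries_iff)
    have "?a c \<in> rep_hom G (ob ?P (Suc m)) ?YE" "f \<in> rep_hom G (ob ?P (Suc m)) ?YE"
      using a [OF c] f' by (auto simp: cocycles_iff)
    moreover have "c \<in> rep_hom G (ob ?Q (Suc m)) ?YW" using c by (simp add: cocycles_iff)
    ultimately have hom: "?a c \<in> rep_hom G (ob ?P (Suc m)) ?YE" "f \<in> rep_hom G (ob ?P (Suc m)) ?YE"
      "c \<in> rep_hom G (ob ?Q (Suc m)) ?YW" by blast+
    note dd = d hom [THEN rep_hom_dim(1)] hom [THEN rep_hom_dim(2)] rep_hom_dim [OF h(1)] rep_hom_dim [OF E]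
    have "Wcounit W Y * ?a c - Wcounit W Y * f = Wcounit W Y * (?a c - f)"
      using dd by (simp add: mat_diff_left)
    also have "\<dots> = Wcounit W Y * h * bd ?P m"
      unfolding h(2) using dd by (simp add: mat_assoc)
    finally have "Wcounit W Y * ?a c - Wcounit W Y * f \<in> coboundaries G (Suc m) X Y"
      using rep_hom_comp [OF E h(1) D(2) YE Y] by (auto simp: coboundaries_iff)
    then show "Wcounit W Y * f \<in> cocycles G (Suc m) X Y \<and>
        Wcounit W Y * ?a c - Wcounit W Y * f \<in> coboundaries G (Suc m) X Y"
      using E_coc [OF f'] by blast
  qed
  have T: "T = Wcounit W Y * ?a c" by (simp add: T_def tr_def)
  show "T \<in> cocycles G (Suc m) X Y" unfolding T by (rule E_coc [OF a [OF c]])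
  show "transfer G W (Suc m) X Y (ext_class G (Suc m) (tensor X W) ?YW c) = ext_class G (Suc m) X Y T"
    unfolding T transfer_def o_apply 1 2 ..
qed

lemma transfer_surj_iff:
  fixes X Y :: "('g, 'k) rep"
  assumes X: "is_rep G X" and Y: "is_rep G Y"
  shows "transfer G W (Suc m) X Y ` Ext G (Suc m) (tensor X W) (tensor Y W) = Ext G (Suc m) X Y \<longleftrightarrow>
    (\<forall>z\<in>cocycles G (Suc m) X Y. \<exists>c\<in>cocycles G (Suc m) (tensor X W) (tensor Y W).
       z - tr W (ob (resolution G X) (Suc m)) Y (c * comparison G W X (Suc m)) \<in> coboundaries G (Suc m) X Y)"
    (is "?L \<longleftrightarrow> ?R")
proof -
  have XW: "is_rep G (tensor X W)" and YW: "is_rep G (tensor Y W)" using X Y W by simp_all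
  let ?T = "\<lambda>c. tr W (ob (resolution G X) (Suc m)) Y (c * comparison G W X (Suc m))"
  let ?Z = "cocycles G (Suc m) (tensor X W) (tensor Y W)"
  note T = transfer_class [OF X Y]
  have img: "transfer G W (Suc m) X Y ` Ext G (Suc m) (tensor X W) (tensor Y W) =
      (\<lambda>c. ext_class G (Suc m) X Y (?T c)) ` ?Z"
    unfolding Ext_eq [OF XW YW] image_image using T(2) by (auto intro!: image_cong)
  have sub: "(\<lambda>c. ext_class G (Suc m) X Y (?T c)) ` ?Z \<subseteq> Ext G (Suc m) X Y"
    unfolding Ext_eq [OF X Y] using T(1) by auto
  have "?L \<longleftrightarrow> Ext G (Suc m) X Y \<subseteq> (\<lambda>c. ext_class G (Suc m) X Y (?T c)) ` ?Z"
    unfolding img using sub by auto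
  also have "\<dots> \<longleftrightarrow> (\<forall>z\<in>cocycles G (Suc m) X Y. \<exists>c\<in>?Z. ext_class G (Suc m) X Y z = ext_class G (Suc m) X Y (?T c))"
    unfolding Ext_eq [OF X Y] by auto
  also have "\<dots> \<longleftrightarrow> ?R"
    using ext_class_eq_iff [OF X Y _ T(1)] by (meson)
  finally show ?thesis .
qed

text \<open>Maps out of a projective module lift through the counit, which is onto.\<close>

lemma projective_traces:
  fixes P Y :: "('g, 'k) rep"
  assumes "rep_projective G P" "is_rep G Y"
  shows "rep_hom G P Y \<subseteq> traces G W P Y"
proof
  fix h assume h: "h \<in> rep_hom G P Y"
  obtain K \<kappa> p s where "split_exact G K (Wend G W Y) Y \<kappa> (Wcounit W Y) p s"
    using counit_sequence [OF assms(2)] .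
  then have "rep_surj G (Wend G W Y) Y (Wcounit W Y)"
    using short_exact_if_split_exact [of G K "Wend G W Y" Y \<kappa> "Wcounit W Y" p s] by (simp add: short_exact_def)
  then obtain l where "l \<in> rep_hom G P (Wend G W Y)" "Wcounit W Y * l = h"
    using rep_projectiveD [OF assms(1) Wend_rep [OF assms(2)] assms(2) _ h] by blast
  then show "h \<in> traces G W P Y"
    using counit_comp_traces [of l P Y] rep_projective_rep [OF assms(1)] assms(2) by auto
qed

text \<open>
  In degree \<open>n \<ge> 1\<close> the transfer is onto exactly when all maps out of the \<open>n\<close>-th syzygy are traces.
  First, let \<open>z'\<close> be such a map and \<open>z\<close> the corresponding cocycle of the standard resolution.  Moved to
  the chosen resolution along \<open>\<alpha>\<close>, it is the trace of a cocycle up to a coboundary; moved back along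
  \<open>\<beta>\<close>, it gives \<open>z'\<close> as a trace plus a map factoring through a projective module.
\<close>

lemma transfer_surj_imp_traces:
  fixes X Y :: "('g, 'k) rep"
  assumes X: "is_rep G X" and Y: "is_rep G Y"
    and surj: "transfer G W (Suc m) X Y ` Ext G (Suc m) (tensor X W) (tensor Y W) = Ext G (Suc m) X Y"
  shows "rep_hom G (syz (Suc m) X) Y \<subseteq> traces G W (syz (Suc m) X) Y"
proof
  let ?P = "resolution G X" and ?Q = "resolution G (tensor X W)" and ?S = "standard X"
  let ?\<phi> = "comparison G W X" and ?YW = "tensor Y W" and ?n = "Suc m"
  let ?w = "1\<^sub>m (deg W) :: 'k mat"
  let ?U = "syz ?n X" and ?FU = "tensor F (syz ?n X)"
  have XW: "is_rep G (tensor X W)" and YW: "is_rep G ?YW" using X Y W by simp_all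
  note resP = resolution_is_resolution [OF X] and resS = standard_resolution [OF X]
  note cP = proj_resolution_complex [OF resP] and cS = proj_resolution_complex [OF resS]
  obtain \<alpha> where \<alpha>: "chain_map G ?P ?S \<alpha>" using chain_map_exists [OF cP resS X] .
  obtain \<beta> where \<beta>: "chain_map G ?S ?P \<beta>" using chain_map_exists [OF cS resP X] .
  obtain s where s: "\<And>n. s n \<in> rep_hom G (ob ?S n) (ob ?S (Suc n))"
    "\<And>n. \<alpha> (Suc n) * \<beta> (Suc n) - 1\<^sub>m (deg (ob ?S (Suc n))) = bd ?S (Suc n) * s (Suc n) + s n * bd ?S n"
    using chain_homotopy_exists [OF cS resS chain_map_comp [OF cS cP cS \<beta> \<alpha>] chain_map_id [OF cS]] by blast
  note A = chain_mapD [OF \<alpha>] and B = chain_mapD [OF \<beta>]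
  note D = proj_complexD [OF cP] and DS = proj_complexD [OF cS] and DQ = proj_complexD [OF ext_resolution [OF XW]]
  note \<phi> = chain_mapD [OF comparison_chain_map [OF X], unfolded complex_tensor_simps]
  note d = rep_hom_dim [OF D(3)] rep_hom_dim [OF DS(3)] rep_hom_dim [OF DQ(3)] rep_hom_dim [OF \<phi>(1)]
    rep_hom_dim [OF A(1)] rep_hom_dim [OF B(1)] rep_hom_dim [OF s(1)]
  obtain p u where S: "split_exact G (syz (Suc ?n) X) ?FU ?U (syz_inj ?n X) (syz_proj ?n X) p u"
    using syz_split [OF X] .
  obtain p' u' where S': "split_exact G (syz (Suc (Suc ?n)) X) (tensor F (syz (Suc ?n) X)) (syz (Suc ?n) X)
      (syz_inj (Suc ?n) X) (syz_proj (Suc ?n) X) p' u'"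
    using syz_split [OF X] .
  note SW = split_exact_tensor_right [OF S W] and SW' = split_exact_tensor_right [OF S' W]
  note J = syz_hom(1) [OF X] and E = syz_hom(2) [OF X] and EJ = syz_hom(3) [OF X]
  note d = d rep_hom_dim [OF J] rep_hom_dim [OF E]
  have U: "is_rep G ?U" "is_rep G ?FU" "is_rep G (syz m X)" using syz_rep [OF X] F_rep by (auto simp: I_rep)
  fix z' assume z': "z' \<in> rep_hom G ?U Y"
  define z where "z = z' * syz_proj ?n X"
  have z: "z \<in> rep_hom G (ob ?S ?n) Y"
    unfolding z_def standard_simps by (rule rep_hom_comp [OF z' E U(2,1) Y])
  note d = d rep_hom_dim [OF z']  rep_hom_dim [OF z]
  have "z * bd ?S ?n = z' * (syz_proj ?n X * syz_inj ?n X * syz_proj (Suc ?n) X)"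
    unfolding z_def standard_simps using d by (simp add: mat_assoc)
  also have "\<dots> = 0\<^sub>m (deg Y) (deg (ob ?S (Suc ?n)))"
    unfolding EJ using d by simp
  finally have z_bd: "z * bd ?S ?n = 0\<^sub>m (deg Y) (deg (ob ?S (Suc ?n)))" .
  have z\<alpha>: "z * \<alpha> ?n \<in> cocycles G ?n X Y"
  proof -
    have "z * \<alpha> ?n * bd ?P ?n = z * bd ?S ?n * \<alpha> (Suc ?n)"
      using d A(3) by (simp add: mat_assoc)
    also have "\<dots> = 0\<^sub>m (deg Y) (deg (ob ?P (Suc ?n)))"
      unfolding z_bd using d by simp
    finally show ?thesis
      using rep_hom_comp [OF z A(1) D(2) DS(2) Y] by (simp add: cocycles_iff)
  qed
  then obtain c h where c: "c \<in> cocycles G ?n (tensor X W) ?YW"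
    and h: "h \<in> rep_hom G (ob ?P m) Y" "z * \<alpha> ?n - tr W (ob ?P ?n) Y (c * ?\<phi> ?n) = h * bd ?P m"
    using surj [unfolded transfer_surj_iff [OF X Y] coboundaries_iff] by metis
  have c': "c \<in> rep_hom G (ob ?Q ?n) ?YW" "c * bd ?Q ?n = 0\<^sub>m (deg ?YW) (deg (ob ?Q (Suc ?n)))"
    using c by (auto simp: cocycles_iff)
  note d = d rep_hom_dim [OF c'(1)] rep_hom_dim [OF h(1)]
  define \<theta> where "\<theta> = c * ?\<phi> ?n * kron (\<beta> ?n) ?w"
  have c\<phi>: "c * ?\<phi> ?n \<in> rep_hom G (tensor (ob ?P ?n) W) ?YW"
    by (rule rep_hom_comp [OF c'(1) \<phi>(1) _ DQ(2) YW]) (use D(2) W in simp)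
  have \<theta>: "\<theta> \<in> rep_hom G (tensor ?FU W) ?YW"
    unfolding \<theta>_def
    using rep_hom_comp [OF c\<phi> rep_hom_kron_right [OF B(1) W DS(2) D(2)]] D(2) [of ?n] DS(2) [of ?n] W YW by simp
  have tr_\<theta>: "tr W (ob ?P ?n) Y (c * ?\<phi> ?n) * \<beta> ?n = tr W ?FU Y \<theta>"
    unfolding \<theta>_def
    using rep_hom_carrier [OF c\<phi>] rep_hom_carrier [OF B(1) [of ?n]] by (intro tr_right) auto
  have "\<theta> * kron (bd ?S ?n) ?w = c * (?\<phi> ?n * kron (bd ?P ?n) ?w) * kron (\<beta> (Suc ?n)) ?w"
  proof -
    have "\<theta> * kron (bd ?S ?n) ?w = c * ?\<phi> ?n * (kron (\<beta> ?n) ?w * kron (bd ?S ?n) ?w)"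
      unfolding \<theta>_def using d by (simp add: mat_assoc)
    also have "kron (\<beta> ?n) ?w * kron (bd ?S ?n) ?w = kron (bd ?P ?n) ?w * kron (\<beta> (Suc ?n)) ?w"
      using d B(3) [of ?n] by (simp add: kron_mult)
    finally show ?thesis using d by (simp add: mat_assoc)
  qed
  also have "c * (?\<phi> ?n * kron (bd ?P ?n) ?w) = c * bd ?Q ?n * ?\<phi> (Suc ?n)"
    unfolding \<phi>(3) [symmetric] using d by (simp add: mat_assoc)
  also have "c * bd ?Q ?n * ?\<phi> (Suc ?n) * kron (\<beta> (Suc ?n)) ?w = 0\<^sub>m (deg ?YW) (deg (tensor (ob ?S (Suc ?n)) W))"
    unfolding c'(2) using d by simp
  finally have \<theta>_bd: "\<theta> * kron (bd ?S ?n) ?w = 0\<^sub>m (deg ?YW) (deg (tensor (ob ?S (Suc ?n)) W))" .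
  have "\<theta> * kron (syz_inj ?n X) ?w * kron (syz_proj (Suc ?n) X) ?w = \<theta> * kron (bd ?S ?n) ?w"
    using d rep_hom_dim [OF \<theta>] by (simp add: mat_assoc kron_mult)
  also have "\<dots> = 0\<^sub>m (deg ?YW) (deg (syz (Suc ?n) X) * deg W) * kron (syz_proj (Suc ?n) X) ?w"
    unfolding \<theta>_bd using d by simp
  finally have "\<theta> * kron (syz_inj ?n X) ?w = 0\<^sub>m (deg ?YW) (deg (syz (Suc ?n) X) * deg W)"
    by (rule split_exact_epi [OF SW']) (use d in auto)
  then obtain \<theta>' where \<theta>': "\<theta>' \<in> rep_hom G (tensor ?U W) ?YW" "\<theta>' * kron (syz_proj ?n X) ?w = \<theta>"
    using split_exact_descend [OF SW \<theta> YW] by auto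
  have tr': "tr W ?U Y \<theta>' * syz_proj ?n X = tr W ?FU Y \<theta>"
    unfolding \<theta>'(2) [symmetric] using rep_hom_carrier [OF \<theta>'(1)] rep_hom_carrier [OF E [of ?n]] by (intro tr_right) auto
  define h' where "h' = h * \<beta> m - z * s m"
  have h': "h' \<in> rep_hom G (ob ?S m) Y"
    unfolding h'_def
    by (rule rep_hom_diff [OF rep_hom_comp [OF h(1) B(1)] rep_hom_comp [OF z s(1)]])
      (use D(2) DS(2) Y in \<open>auto simp del: standard_simps\<close>)
  have eq: "z = tr W ?FU Y \<theta> + h' * bd ?S m"
  proof -
    have "z * (\<alpha> ?n * \<beta> ?n - 1\<^sub>m (deg (ob ?S ?n))) = z * bd ?S ?n * s ?n + z * s m * bd ?S m"
      unfolding s(2) using d by (simp add: mat_distrib_left mat_assoc del: standard_simps)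
    also have "\<dots> = z * s m * bd ?S m"
      unfolding z_bd using d by (intro mat_eqI) (auto simp del: standard_simps)
    finally have 1: "z * \<alpha> ?n * \<beta> ?n - z = z * s m * bd ?S m"
      using d by (simp add: mat_diff_left mat_assoc del: standard_simps)
    have "(z * \<alpha> ?n - tr W (ob ?P ?n) Y (c * ?\<phi> ?n)) * \<beta> ?n = h * (bd ?P m * \<beta> ?n)"
      unfolding h(2) using d by (simp add: mat_assoc del: standard_simps)
    then have 2: "z * \<alpha> ?n * \<beta> ?n - tr W ?FU Y \<theta> = h * \<beta> m * bd ?S m"
      unfolding B(3) tr_\<theta> [symmetric] using d by (simp add: mat_diff_right mat_assoc del: standard_simps)
    have 3: "h' * bd ?S m = h * \<beta> m * bd ?S m - z * s m * bd ?S m"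
      unfolding h'_def using d by (simp add: mat_diff_right del: standard_simps)
    show ?thesis
      unfolding 3 1 [symmetric] 2 [symmetric] using d by (intro mat_eqI) (auto simp del: index_mult_mat(1))
  qed
  note dh = rep_hom_dim [OF h']
  have "z' * syz_proj ?n X = (tr W ?U Y \<theta>' + h' * syz_inj m X) * syz_proj ?n X"
    unfolding z_def [symmetric] using eq tr' d dh by (simp add: mat_distrib_right mat_assoc)
  then have z'_eq: "z' = tr W ?U Y \<theta>' + h' * syz_inj m X"
    by (rule split_exact_epi [OF S]) (use d in auto)
  have h'': "h' \<in> traces G W (tensor F (syz m X)) Y"
    using projective_traces [OF free_projective [OF U(3)] Y] h' by auto
  have "h' * syz_inj m X \<in> traces G W ?U Y"
    by (rule traces_comp_right [OF h'' J]) (use U Y F_rep in auto)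
  moreover have "tr W ?U Y \<theta>' \<in> traces G W ?U Y"
    using \<theta>'(1) by (simp add: traces_def)
  ultimately show "z' \<in> traces G W ?U Y"
    unfolding z'_eq by (intro traces_add) (use U Y W in auto)
qed

text \<open>Conversely, a cocycle \<open>z\<close> of the chosen resolution, moved to the standard one along \<open>\<beta>\<close>, is the trace
  of a cocycle \<open>\<theta>\<close> of the standard resolution of \<open>X \<otimes> W\<close>.  Moving \<open>\<theta>\<close> to the chosen resolution of \<open>X \<otimes> W\<close>
  along \<open>\<gamma>\<close> gives the preimage, since \<open>\<gamma>\<close> after the comparison map is homotopic to \<open>\<alpha> \<otimes> W\<close>.\<close>

lemma traces_imp_transfer_surj:
  fixes X Y :: "('g, 'k) rep"
  assumes X: "is_rep G X" and Y: "is_rep G Y"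
    and van: "rep_hom G (syz (Suc m) X) Y \<subseteq> traces G W (syz (Suc m) X) Y"
  shows "transfer G W (Suc m) X Y ` Ext G (Suc m) (tensor X W) (tensor Y W) = Ext G (Suc m) X Y"
  unfolding transfer_surj_iff [OF X Y]
proof
  let ?P = "resolution G X" and ?Q = "resolution G (tensor X W)" and ?S = "standard X"
  let ?\<phi> = "comparison G W X" and ?YW = "tensor Y W" and ?n = "Suc m"
  let ?PW = "complex_tensor W ?P" and ?SW = "standard (tensor X W)"
  let ?w = "1\<^sub>m (deg W) :: 'k mat"
  let ?U = "syz ?n X" and ?FU = "tensor F (syz ?n X)"
  have XW: "is_rep G (tensor X W)" and YW: "is_rep G ?YW" using X Y W by simp_all
  note resP = resolution_is_resolution [OF X] and resS = standard_resolution [OF X]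
    and resSW = standard_resolution [OF XW] and resQ = resolution_is_resolution [OF XW]
  note cP = proj_resolution_complex [OF resP] and cS = proj_resolution_complex [OF resS]
    and cSW = proj_resolution_complex [OF resSW] and cQ = proj_resolution_complex [OF resQ]
    and cPW = proj_complex_tensor [OF ext_resolution [OF X] X W]
  obtain \<alpha> where \<alpha>: "chain_map G ?P ?S \<alpha>" using chain_map_exists [OF cP resS X] .
  obtain \<beta> where \<beta>: "chain_map G ?S ?P \<beta>" using chain_map_exists [OF cS resP X] .
  obtain \<gamma> where \<gamma>: "chain_map G ?Q ?SW \<gamma>" using chain_map_exists [OF cQ resSW XW] .
  have \<alpha>W: "chain_map G ?PW ?SW (\<lambda>n. kron (\<alpha> n) ?w)"
    using chain_map_tensor [OF cP cS \<alpha> W] unfolding standard_tensor [OF X] .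
  obtain s where s: "\<And>n. s n \<in> rep_hom G (ob ?P n) (ob ?P (Suc n))"
    "\<And>n. \<beta> (Suc n) * \<alpha> (Suc n) - 1\<^sub>m (deg (ob ?P (Suc n))) = bd ?P (Suc n) * s (Suc n) + s n * bd ?P n"
    using chain_homotopy_exists [OF cP resP chain_map_comp [OF cP cS cP \<alpha> \<beta>] chain_map_id [OF cP]] by blast
  obtain r where r: "\<And>n. r n \<in> rep_hom G (ob ?PW n) (ob ?SW (Suc n))"
    "\<And>n. \<gamma> (Suc n) * ?\<phi> (Suc n) - kron (\<alpha> (Suc n)) ?w = bd ?SW (Suc n) * r (Suc n) + r n * bd ?PW n"
    using chain_homotopy_exists [OF cPW resSW chain_map_comp [OF cPW cQ cSW comparison_chain_map [OF X] \<gamma>] \<alpha>W] by blast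
  have SW_ob: "ob ?SW n = tensor (ob ?S n) W" and SW_bd: "bd ?SW n = kron (bd ?S n) ?w" for n
    unfolding standard_tensor [OF X, of W, symmetric] by (rule complex_tensor_simps)+
  note A = chain_mapD [OF \<alpha>] and B = chain_mapD [OF \<beta>] and C = chain_mapD [OF \<gamma>, unfolded SW_ob SW_bd]
  note r = r [unfolded SW_ob SW_bd complex_tensor_simps]
  note D = proj_complexD [OF cP] and DS = proj_complexD [OF cS] and DQ = proj_complexD [OF cQ]
  note \<phi> = chain_mapD [OF comparison_chain_map [OF X], unfolded complex_tensor_simps]
  note d = rep_hom_dim [OF D(3)] rep_hom_dim [OF DS(3)] rep_hom_dim [OF DQ(3)] rep_hom_dim [OF \<phi>(1)]
    rep_hom_dim [OF A(1)] rep_hom_dim [OF B(1)] rep_hom_dim [OF C(1)] rep_hom_dim [OF s(1)] rep_hom_dim [OF r(1)]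
  note R = D(2) DS(2) DQ(2) X Y W XW YW is_rep_tensor
  obtain p u where S: "split_exact G (syz (Suc ?n) X) ?FU ?U (syz_inj ?n X) (syz_proj ?n X) p u"
    using syz_split [OF X] .
  obtain p' u' where S': "split_exact G (syz (Suc (Suc ?n)) X) (tensor F (syz (Suc ?n) X)) (syz (Suc ?n) X)
      (syz_inj (Suc ?n) X) (syz_proj (Suc ?n) X) p' u'"
    using syz_split [OF X] .
  note J = syz_hom(1) [OF X] and E = syz_hom(2) [OF X] and EJ = syz_hom(3) [OF X]
  note dE = rep_hom_dim [OF J] rep_hom_dim [OF E]
  have U: "is_rep G ?U" "is_rep G ?FU" using syz_rep [OF X] F_rep by (auto simp: I_rep)
  fix z assume "z \<in> cocycles G ?n X Y"
  then have z: "z \<in> rep_hom G (ob ?P ?n) Y" and z_bd: "z * bd ?P ?n = 0\<^sub>m (deg Y) (deg (ob ?P (Suc ?n)))"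
    by (auto simp: cocycles_iff)
  have z\<beta>: "z * \<beta> ?n \<in> rep_hom G (ob ?S ?n) Y"
    by (rule rep_hom_comp [OF z B(1)]) (rule R)+
  note d = d rep_hom_dim [OF z] rep_hom_dim [OF z\<beta>]
  have "z * \<beta> ?n * syz_inj ?n X * syz_proj (Suc ?n) X = z * (\<beta> ?n * bd ?S ?n)"
    using d dE by (simp add: mat_assoc)
  also have "\<dots> = z * bd ?P ?n * \<beta> (Suc ?n)"
    unfolding B(3) [symmetric] using d by (simp add: mat_assoc)
  also have "\<dots> = 0\<^sub>m (deg Y) (deg (syz (Suc ?n) X)) * syz_proj (Suc ?n) X"
    unfolding z_bd using d dE by simp
  finally have "z * \<beta> ?n * syz_inj ?n X = 0\<^sub>m (deg Y) (deg (syz (Suc ?n) X))"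
    by (rule split_exact_epi [OF S']) (use d dE in auto)
  then obtain z' where z': "z' \<in> rep_hom G ?U Y" "z' * syz_proj ?n X = z * \<beta> ?n"
    using split_exact_descend [OF S _ Y] z\<beta> by auto
  then obtain \<theta>' where \<theta>': "\<theta>' \<in> rep_hom G (tensor ?U W) ?YW" "z' = tr W ?U Y \<theta>'"
    using van by (auto simp: traces_def)
  define \<theta> where "\<theta> = \<theta>' * kron (syz_proj ?n X) ?w"
  have \<theta>: "\<theta> \<in> rep_hom G (tensor (ob ?S ?n) W) ?YW"
    unfolding \<theta>_def standard_simps
    by (rule rep_hom_comp [OF \<theta>'(1) rep_hom_kron_right [OF E]]) (use U W YW in auto)
  note d = d rep_hom_dim [OF \<theta>] and d' = rep_hom_dim [OF \<theta>'(1)]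
  have tr_\<theta>: "tr W (ob ?S ?n) Y \<theta> = z * \<beta> ?n"
    unfolding z'(2) [symmetric] \<theta>'(2) \<theta>_def standard_simps
    using rep_hom_carrier [OF \<theta>'(1)] rep_hom_carrier [OF E [of ?n]] by (intro tr_right [symmetric]) auto
  have "\<theta> * kron (bd ?S ?n) ?w = \<theta>' * kron (syz_proj ?n X * syz_inj ?n X * syz_proj (Suc ?n) X) ?w"
    unfolding \<theta>_def standard_simps using d' dE by (simp add: mat_assoc kron_mult)
  also have "\<dots> = 0\<^sub>m (deg ?YW) (deg (tensor (ob ?S (Suc ?n)) W))"
    unfolding EJ using d' dE by simp
  finally have \<theta>_bd: "\<theta> * kron (bd ?S ?n) ?w = 0\<^sub>m (deg ?YW) (deg (tensor (ob ?S (Suc ?n)) W))" .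
  define c where "c = \<theta> * \<gamma> ?n"
  have c: "c \<in> rep_hom G (ob ?Q ?n) ?YW"
    unfolding c_def by (rule rep_hom_comp [OF \<theta> C(1)]) (rule R)+
  have "c * bd ?Q ?n = \<theta> * kron (bd ?S ?n) ?w * \<gamma> (Suc ?n)"
    unfolding c_def using d C(3) by (simp add: mat_assoc del: standard_simps)
  also have "\<dots> = 0\<^sub>m (deg ?YW) (deg (ob ?Q (Suc ?n)))"
    unfolding \<theta>_bd using d by (simp del: standard_simps)
  finally have c_coc: "c \<in> cocycles G ?n (tensor X W) ?YW"
    using c by (simp add: cocycles_iff)
  have \<theta>r: "\<theta> * r m \<in> rep_hom G (tensor (ob ?P m) W) ?YW"
    by (rule rep_hom_comp [OF \<theta> r(1)]) (rule R)+
  have \<theta>\<alpha>: "\<theta> * kron (\<alpha> ?n) ?w \<in> rep_hom G (tensor (ob ?P ?n) W) ?YW"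
    by (rule rep_hom_comp [OF \<theta> rep_hom_kron_right [OF A(1)]]) (rule R)+
  have c\<phi>: "c * ?\<phi> ?n \<in> rep_hom G (tensor (ob ?P ?n) W) ?YW"
    by (rule rep_hom_comp [OF c \<phi>(1)]) (rule R)+
  have "c * ?\<phi> ?n - \<theta> * kron (\<alpha> ?n) ?w = \<theta> * (\<gamma> ?n * ?\<phi> ?n - kron (\<alpha> ?n) ?w)"
    unfolding c_def using d by (simp add: mat_diff_left mat_assoc del: standard_simps)
  also have "\<dots> = \<theta> * kron (bd ?S ?n) ?w * r ?n + \<theta> * r m * kron (bd ?P m) ?w"
    unfolding r(2) using d by (simp add: mat_distrib_left mat_assoc del: standard_simps)
  also have "\<dots> = \<theta> * r m * kron (bd ?P m) ?w"
    unfolding \<theta>_bd using d by (intro mat_eqI) (auto simp del: standard_simps index_mult_mat(1))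
  finally have "tr W (ob ?P ?n) Y (c * ?\<phi> ?n) - tr W (ob ?P ?n) Y (\<theta> * kron (\<alpha> ?n) ?w) =
      tr W (ob ?P ?n) Y (\<theta> * r m * kron (bd ?P m) ?w)"
    using tr_diff [of "c * ?\<phi> ?n" Y W "ob ?P ?n" "\<theta> * kron (\<alpha> ?n) ?w"] rep_hom_carrier [OF c\<phi>] rep_hom_carrier [OF \<theta>\<alpha>]
    by (simp del: standard_simps)
  also have "\<dots> = tr W (ob ?P m) Y (\<theta> * r m) * bd ?P m"
    using rep_hom_carrier [OF \<theta>r] rep_hom_carrier [OF D(3)] by (intro tr_right [symmetric]) auto
  also have "tr W (ob ?P ?n) Y (\<theta> * kron (\<alpha> ?n) ?w) = tr W (ob ?S ?n) Y \<theta> * \<alpha> ?n"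
    using rep_hom_carrier [OF \<theta>] rep_hom_carrier [OF A(1) [of ?n]] by (intro tr_right [symmetric]) auto
  also have "\<dots> = z * \<beta> ?n * \<alpha> ?n" unfolding tr_\<theta> ..
  finally have 1: "tr W (ob ?P ?n) Y (c * ?\<phi> ?n) - z * \<beta> ?n * \<alpha> ?n = tr W (ob ?P m) Y (\<theta> * r m) * bd ?P m" .
  have "z * (\<beta> ?n * \<alpha> ?n - 1\<^sub>m (deg (ob ?P ?n))) = z * bd ?P ?n * s ?n + z * s m * bd ?P m"
    unfolding s(2) using d by (simp add: mat_distrib_left mat_assoc del: standard_simps)
  also have "\<dots> = z * s m * bd ?P m"
    unfolding z_bd using d by (intro mat_eqI) (auto simp del: standard_simps index_mult_mat(1))
  finally have 2: "z * \<beta> ?n * \<alpha> ?n - z = z * s m * bd ?P m"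
    using d by (simp add: mat_diff_left mat_assoc del: standard_simps)
  define h where "h = 0\<^sub>m (deg Y) (deg (ob ?P m)) - (tr W (ob ?P m) Y (\<theta> * r m) + z * s m)"
  have h: "h \<in> rep_hom G (ob ?P m) Y"
    unfolding h_def
    by (intro rep_hom_diff rep_hom_add rep_hom_zero tr_hom [OF is_group W _ _ \<theta>r] rep_hom_comp [OF z s(1)] R)
  have "h * bd ?P m = 0\<^sub>m (deg Y) (deg (ob ?P ?n)) - (tr W (ob ?P m) Y (\<theta> * r m) * bd ?P m + z * s m * bd ?P m)"
    unfolding h_def using d by (simp add: mat_diff_right mat_distrib_right del: standard_simps)
  also have "\<dots> = z - tr W (ob ?P ?n) Y (c * ?\<phi> ?n)"
    unfolding 1 [symmetric] 2 [symmetric] using d by (intro mat_eqI) (auto simp del: standard_simps index_mult_mat(1))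
  finally have "z - tr W (ob ?P ?n) Y (c * ?\<phi> ?n) \<in> coboundaries G ?n X Y"
    using h unfolding coboundaries_iff by metis
  then show "\<exists>c\<in>cocycles G ?n (tensor X W) ?YW. z - tr W (ob ?P ?n) Y (c * ?\<phi> ?n) \<in> coboundaries G ?n X Y"
    using c_coc by blast
qed

text \<open>Degree zero is irrelevant for a statement about all large degrees.\<close>

lemma virtually_projective_iff:
  "virtually_projective G W X \<longleftrightarrow> is_rep G X \<and>
     (\<forall>Y. is_rep G Y \<longrightarrow> (\<forall>\<^sub>F n in sequentially. rep_hom G (syz n X) Y \<subseteq> traces G W (syz n X) Y))"
proof -
  have "(transfer G W n X Y ` Ext G n (tensor X W) (tensor Y W) = Ext G n X Y) =
      (rep_hom G (syz n X) Y \<subseteq> traces G W (syz n X) Y)"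
    if X: "is_rep G X" and Y: "is_rep G Y" and n: "n \<ge> Suc 0" for Y n
  proof -
    obtain m where m: "n = Suc m" using n by (cases n) auto
    show ?thesis
      unfolding m using transfer_surj_imp_traces [OF X Y] traces_imp_transfer_surj [OF X Y] by (rule iffI)
  qed
  then have *: "(\<exists>n\<^sub>0. \<forall>n\<ge>n\<^sub>0. transfer G W n X Y ` Ext G n (tensor X W) (tensor Y W) = Ext G n X Y) \<longleftrightarrow>
      (\<forall>\<^sub>F n in sequentially. rep_hom G (syz n X) Y \<subseteq> traces G W (syz n X) Y)"
    if "is_rep G X" "is_rep G Y" for Y
    unfolding eventually_sequentially [symmetric]
    by (intro eventually_cong [OF eventually_ge_at_top [of "Suc 0"]]) (use that in auto)
  show ?thesis
    unfolding virtually_projective_def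
    by (rule conj_cong [OF refl], rule all_cong1, rule imp_cong [OF refl], rule *)
qed

end

section \<open>Relative projectivity and the stable category\<close>

text \<open>The inclusion of and the projection to the first summand of \<open>rep_sum\<close> are the matrices \<open>i\<close> and \<open>p\<close> with
  entries \<open>\<delta>\<^sub>r\<^sub>c\<close>.\<close>

lemma rep_summand_retract:
  fixes M N :: "('g, 'k::field) rep"
  assumes "rep_summand G M N" "is_rep G M" "is_rep G N"
  obtains u v where "u \<in> rep_hom G M N" "v \<in> rep_hom G N M" "v * u = 1\<^sub>m (deg M)"
proof -
  obtain M' f g where M': "is_rep G M'" and f: "f \<in> rep_hom G N (rep_sum M M')"
    and g: "g \<in> rep_hom G (rep_sum M M') N" and fg: "f * g = 1\<^sub>m (deg (rep_sum M M'))"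
    using assms(1) by (auto simp: rep_summand_def rep_iso_def)
  let ?a = "deg M" and ?b = "deg M'"
  have deg: "deg (rep_sum M M') = ?a + ?b" by (simp add: rep_sum_def)
  define i where "i = mat (?a + ?b) ?a (\<lambda>(r, c). if r = c then 1 else (0 :: 'k))"
  define p where "p = mat ?a (?a + ?b) (\<lambda>(r, c). if r = c then 1 else (0 :: 'k))"
  have if_mult: "(if P then 1 else 0) * x = (if P then x else 0)"
    "x * (if P then 1 else 0) = (if P then x else 0)" for P and x :: 'k by auto
  have act: "dim_row (act (rep_sum M M') x) = ?a + ?b" "dim_col (act (rep_sum M M') x) = ?a + ?b"
    if "x \<in> carrier G" for x
    using that assms(2) M' by (auto simp: rep_sum_def rep_dim)
  have S: "is_rep G (rep_sum M M')"
  proof (rule is_repI)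
    show "act (rep_sum M M') x \<in> carrier_mat (deg (rep_sum M M')) (deg (rep_sum M M'))" if "x \<in> carrier G" for x
      using act [OF that] deg by (auto intro: carrier_matI)
    show "act (rep_sum M M') \<one>\<^bsub>G\<^esub> = 1\<^sub>m (deg (rep_sum M M'))"
      using assms(2) M' by (simp add: rep_sum_def rep_one)
    show "act (rep_sum M M') (x \<otimes>\<^bsub>G\<^esub> y) = act (rep_sum M M') x * act (rep_sum M M') y"
      if "x \<in> carrier G" "y \<in> carrier G" for x y
    proof -
      have c: "act M x \<in> carrier_mat ?a ?a" "act M y \<in> carrier_mat ?a ?a"
        "act M' x \<in> carrier_mat ?b ?b" "act M' y \<in> carrier_mat ?b ?b"
        using that assms(2) M' by (auto simp: is_rep_def)
      show ?thesis
        using that assms(2) M' c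
          mult_four_block_mat [OF c(1) zero_carrier_mat zero_carrier_mat c(3) c(2) zero_carrier_mat zero_carrier_mat c(4)]
        by (simp add: rep_sum_def rep_mult)
    qed
  qed
  have i: "i \<in> rep_hom G M (rep_sum M M')"
  proof (rule rep_homI)
    fix x assume x: "x \<in> carrier G"
    note dx = rep_dim [OF assms(2) x] rep_dim [OF M' x] act [OF x]
    show "i * act M x = act (rep_sum M M') x * i"
    proof (rule mat_eqI, goal_cases)
      case (3 r c)
      then have rc: "r < ?a + ?b" "c < ?a" using dx by (auto simp: i_def)
      have "(i * act M x) $$ (r, c) = (\<Sum>k<?a. i $$ (r, k) * act M x $$ (k, c))"
        using rc dx by (subst mult_index) (auto simp: i_def)
      also have "\<dots> = (\<Sum>k<?a. if r = k then act M x $$ (k, c) else 0)"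
        using rc by (intro sum.cong) (auto simp: i_def)
      also have "\<dots> = act (rep_sum M M') x $$ (r, c)"
        using rc dx by (auto simp: rep_sum_def)
      also have "\<dots> = (\<Sum>k<?a + ?b. if k = c then act (rep_sum M M') x $$ (r, k) else 0)"
        using rc by simp
      also have "\<dots> = (\<Sum>k<?a + ?b. act (rep_sum M M') x $$ (r, k) * i $$ (k, c))"
        using rc by (intro sum.cong) (auto simp: i_def)
      also have "\<dots> = (act (rep_sum M M') x * i) $$ (r, c)"
        using rc dx by (subst mult_index) (auto simp: i_def)
      finally show ?case .
    qed (use dx in \<open>auto simp: i_def\<close>)
  qed (simp add: i_def deg)
  have p: "p \<in> rep_hom G (rep_sum M M') M"
  proof (rule rep_homI)
    fix x assume x: "x \<in> carrier G"
    note dx = rep_dim [OF assms(2) x] rep_dim [OF M' x] act [OF x]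
    show "p * act (rep_sum M M') x = act M x * p"
    proof (rule mat_eqI, goal_cases)
      case (3 r c)
      then have rc: "r < ?a" "c < ?a + ?b" using dx by (auto simp: p_def)
      have "(p * act (rep_sum M M') x) $$ (r, c) = (\<Sum>k<?a + ?b. p $$ (r, k) * act (rep_sum M M') x $$ (k, c))"
        using rc dx by (subst mult_index) (auto simp: p_def)
      also have "\<dots> = (\<Sum>k<?a + ?b. if r = k then act (rep_sum M M') x $$ (k, c) else 0)"
        using rc by (intro sum.cong) (auto simp: p_def)
      also have "\<dots> = act (rep_sum M M') x $$ (r, c)"
        using rc by simp
      also have "\<dots> = (\<Sum>k<?a. if k = c then act M x $$ (r, k) else 0)"
        using rc dx by (auto simp: rep_sum_def)
      also have "\<dots> = (\<Sum>k<?a. act M x $$ (r, k) * p $$ (k, c))"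
        using rc by (intro sum.cong) (auto simp: p_def)
      also have "\<dots> = (act M x * p) $$ (r, c)"
        using rc dx by (subst mult_index) (auto simp: p_def)
      finally show ?case .
    qed (use dx in \<open>auto simp: p_def\<close>)
  qed (simp add: p_def deg)
  have pi: "p * i = 1\<^sub>m ?a"
  proof (rule mat_eqI, goal_cases)
    case (3 r c)
    then have rc: "r < ?a" "c < ?a" by auto
    have "(p * i) $$ (r, c) = (\<Sum>k<?a + ?b. p $$ (r, k) * i $$ (k, c))"
      using rc by (subst mult_index) (auto simp: p_def i_def)
    also have "\<dots> = (\<Sum>k<?a + ?b. if r = k then (if r = c then 1 else 0) else 0)"
      using rc by (intro sum.cong) (auto simp: p_def i_def)
    also have "\<dots> = 1\<^sub>m ?a $$ (r, c)" using rc by simp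
    finally show ?case .
  qed (auto simp: p_def i_def)
  show thesis
  proof
    show "g * i \<in> rep_hom G M N" by (rule rep_hom_comp [OF g i assms(2) S assms(3)])
    show "p * f \<in> rep_hom G N M" by (rule rep_hom_comp [OF p f assms(3) S assms(2)])
    have "p * f * (g * i) = p * (f * g * i)"
      using rep_hom_dim [OF f] rep_hom_dim [OF g] rep_hom_dim [OF i] rep_hom_dim [OF p] by (simp add: mat_assoc)
    also have "\<dots> = 1\<^sub>m ?a" unfolding fg using rep_hom_dim [OF i] pi by simp
    finally show "p * f * (g * i) = 1\<^sub>m ?a" .
  qed
qed

text \<open>The zero module.\<close>

definition zero_rep :: "('g, 'k::field) rep" where
  "zero_rep = Rep 0 (\<lambda>_. 1\<^sub>m 0)"

lemma zero_rep_simps [simp]: "deg zero_rep = 0" "act zero_rep g = 1\<^sub>m 0"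
  by (simp_all add: zero_rep_def)

lemma is_rep_zero [simp]: "is_rep G zero_rep"
  by (rule is_repI) auto

lemma rep_sum_zero:
  assumes "is_rep G M" "x \<in> carrier G"
  shows "act (rep_sum M zero_rep) x = act M x"
  using rep_dim [OF assms] by (auto simp: rep_sum_def intro!: mat_eqI)

context rel_setting
begin

text \<open>\<open>B \<otimes> W \<otimes> W\<^sup>*\<close> is a summand, with complement \<open>0\<close>, of \<open>W\<^sup>* \<otimes> (B \<otimes> W)\<close>.\<close>

lemma rel_projective_Wend:
  assumes B: "is_rep G B"
  shows "rel_projective G W (Wend G W B)"
proof -
  let ?N = "tensor (dual G W) (tensor B W)" and ?M = "Wend G W B"
  let ?S = "rep_sum ?M zero_rep"
  have M: "is_rep G ?M" and BW: "is_rep G (tensor B W)" using B by simp_all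
  let ?f = "swap (deg W) (deg B * deg W) :: 'k mat" and ?g = "swap (deg B * deg W) (deg W) :: 'k mat"
  have f: "?f \<in> rep_hom G ?N ?M"
    using rep_hom_swap [OF W_rep(2) BW] by simp
  have g: "?g \<in> rep_hom G ?M ?N"
    using rep_hom_swap [OF BW W_rep(2)] by simp
  have deg: "deg ?S = deg ?M" by (simp add: rep_sum_def)
  have "?f \<in> rep_hom G ?N ?S" "?g \<in> rep_hom G ?S ?N"
    using f g unfolding rep_hom_def deg by (auto simp: rep_sum_zero [OF M] simp del: tensor_simps(2))
  moreover have "?g * ?f = 1\<^sub>m (deg ?N)" "?f * ?g = 1\<^sub>m (deg ?S)"
    unfolding swap_swap deg by simp_all
  ultimately have "rep_iso G ?N ?S" by (auto simp: rep_iso_def)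
  then have "rep_summand G ?M ?N" unfolding rep_summand_def using is_rep_zero by blast
  then show ?thesis using M BW by (auto simp: rel_projective_def)
qed

lemma rel_projective_one_traces:
  assumes "rel_projective G W Q"
  shows "1\<^sub>m (deg Q) \<in> traces G W Q Q"
proof -
  obtain Y where Q: "is_rep G Q" and Y: "is_rep G Y" and "rep_summand G Q (tensor (dual G W) Y)"
    using assms by (auto simp: rel_projective_def)
  let ?N = "tensor (dual G W) Y" and ?N' = "tensor Y (dual G W)"
  have N: "is_rep G ?N" "is_rep G ?N'" using Y by simp_all
  obtain u v where u: "u \<in> rep_hom G Q ?N" and v: "v \<in> rep_hom G ?N Q" and vu: "v * u = 1\<^sub>m (deg Q)"
    using rep_summand_retract [OF \<open>rep_summand G Q ?N\<close> Q N(1)] .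
  let ?f = "swap (deg W) (deg Y) :: 'k mat" and ?g = "swap (deg Y) (deg W) :: 'k mat"
  have f: "?f \<in> rep_hom G ?N ?N'" and g: "?g \<in> rep_hom G ?N' ?N"
    using rep_hom_swap [OF W_rep(2) Y] rep_hom_swap [OF Y W_rep(2)] by simp_all
  have "kron (1\<^sub>m (deg Y)) (1\<^sub>m (deg W)) \<in> traces G W ?N' ?N'"
    using traces_tensor [OF one_traces_dual W_rep(2) W_rep(2) W Y] by simp
  then have 1: "1\<^sub>m (deg Y * deg W) \<in> traces G W ?N' ?N'" by simp
  have fu: "?f * u \<in> rep_hom G Q ?N'" by (rule rep_hom_comp [OF f u Q N])
  have vg: "v * ?g \<in> rep_hom G ?N' Q" by (rule rep_hom_comp [OF v g N(2,1) Q])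
  have "v * ?g * (1\<^sub>m (deg Y * deg W) * (?f * u)) \<in> traces G W Q Q"
    by (rule traces_comp_left [OF traces_comp_right [OF 1 fu N(2) N(2) Q W] vg Q N(2) Q W])
  also have "v * ?g * (1\<^sub>m (deg Y * deg W) * (?f * u)) = v * (?g * ?f * u)"
    using rep_hom_dim [OF u] rep_hom_dim [OF v] by (simp add: mat_assoc)
  also have "\<dots> = 1\<^sub>m (deg Q)"
    unfolding swap_swap using rep_hom_dim [OF u] vu by simp
  finally show ?thesis .
qed

lemma null_homs_eq_traces:
  assumes M: "is_rep G M" and N: "is_rep G N"
  shows "null_homs G W M N = traces G W M N"
proof (intro subset_antisym subsetI)
  fix f assume "f \<in> null_homs G W M N"
  then obtain a b Q where Q: "rel_projective G W Q" and a: "a \<in> rep_hom G M Q" and b: "b \<in> rep_hom G Q N"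
    and f: "f = b * a"
    by (auto simp: null_homs_def)
  have Q': "is_rep G Q" using Q by (simp add: rel_projective_def)
  have "b * (1\<^sub>m (deg Q) * a) \<in> traces G W M N"
    by (rule traces_comp_left [OF traces_comp_right [OF rel_projective_one_traces [OF Q] a Q' Q' M W] b M Q' N W])
  then show "f \<in> traces G W M N" using a f by simp
next
  fix f assume "f \<in> traces G W M N"
  then obtain l where "l \<in> rep_hom G M (Wend G W N)" "Wcounit W N * l = f"
    using trace_factor_counit [OF _ M N] by blast
  then show "f \<in> null_homs G W M N"
    using rel_projective_Wend [OF N] Wcounit_hom [OF N] unfolding null_homs_def by blast
qed

text \<open>The swap passes between sections after \<open>W \<otimes> -\<close> and after \<open>- \<otimes> W\<close>.\<close>

lemma rel_split_iff_W_split: "rel_split G W X Y Z f g \<longleftrightarrow> W_split G W X Y Z f g"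
proof
  assume S: "rel_split G W X Y Z f g"
  then have "short_exact G X Y Z f g" by (simp add: rel_split_def)
  then obtain p s where s: "split_exact G X Y Z f g p s"
    by (rule split_exact_if_short_exact)
  note D = split_exactD [OF s]
  obtain s' where s': "s' \<in> rep_hom G (tensor W Z) (tensor W Y)" "kron (1\<^sub>m (deg W)) g * s' = 1\<^sub>m (deg W * deg Z)"
    using S by (auto simp: rel_split_def)
  let ?\<sigma> = "swap (deg W) (deg Y) * (s' * swap (deg Z) (deg W))"
  have "?\<sigma> \<in> rep_hom G (tensor Z W) (tensor Y W)"
    by (rule rep_hom_comp [OF rep_hom_swap rep_hom_comp [OF s'(1) rep_hom_swap]]) (use D in auto)
  moreover have "kron g (1\<^sub>m (deg W)) * ?\<sigma> = kron g (1\<^sub>m (deg W)) * swap (deg W) (deg Y) * s' * swap (deg Z) (deg W)"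
    using D rep_hom_dim [OF s'(1)] by (simp add: mat_assoc)
  moreover have "kron g (1\<^sub>m (deg W)) * swap (deg W) (deg Y) = swap (deg W) (deg Z) * kron (1\<^sub>m (deg W)) g"
    using rep_hom_carrier [OF D(5)] by (intro swap_kron [symmetric]) auto
  moreover have "swap (deg W) (deg Z) * kron (1\<^sub>m (deg W)) g * s' * swap (deg Z) (deg W) =
      swap (deg W) (deg Z) * (kron (1\<^sub>m (deg W)) g * s' * swap (deg Z) (deg W))"
    using D rep_hom_dim [OF s'(1)] by (simp add: mat_assoc)
  moreover have "\<dots> = 1\<^sub>m (deg Z * deg W)"
    unfolding s'(2) by (simp add: swap_swap)
  ultimately show "W_split G W X Y Z f g"
    by (intro W_splitI_section [OF s W, of ?\<sigma>]) auto
next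
  assume S: "W_split G W X Y Z f g"
  note D = W_splitD [OF S]
  obtain \<sigma> where \<sigma>: "\<sigma> \<in> rep_hom G (tensor Z W) (tensor Y W)" "kron g (1\<^sub>m (deg W)) * \<sigma> = 1\<^sub>m (deg Z * deg W)"
    using W_split_section [OF S] .
  let ?s = "swap (deg Y) (deg W) * (\<sigma> * swap (deg W) (deg Z))"
  have "?s \<in> rep_hom G (tensor W Z) (tensor W Y)"
    by (rule rep_hom_comp [OF rep_hom_swap rep_hom_comp [OF \<sigma>(1) rep_hom_swap]]) (use D in auto)
  moreover have "kron (1\<^sub>m (deg W)) g * ?s = 1\<^sub>m (deg W * deg Z)"
  proof -
    have "kron (1\<^sub>m (deg W)) g * ?s = kron (1\<^sub>m (deg W)) g * swap (deg Y) (deg W) * \<sigma> * swap (deg W) (deg Z)"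
      using D rep_hom_dim [OF \<sigma>(1)] by (simp add: mat_assoc)
    also have "kron (1\<^sub>m (deg W)) g * swap (deg Y) (deg W) = swap (deg Z) (deg W) * kron g (1\<^sub>m (deg W))"
      using rep_hom_carrier [OF D(5)] by (intro swap_kron [symmetric]) auto
    also have "swap (deg Z) (deg W) * kron g (1\<^sub>m (deg W)) * \<sigma> * swap (deg W) (deg Z) =
        swap (deg Z) (deg W) * (kron g (1\<^sub>m (deg W)) * \<sigma> * swap (deg W) (deg Z))"
      using D rep_hom_dim [OF \<sigma>(1)] by (simp add: mat_assoc)
    also have "\<dots> = 1\<^sub>m (deg W * deg Z)"
      unfolding \<sigma>(2) by (simp add: swap_swap)
    finally show ?thesis .
  qed
  moreover have "short_exact G X Y Z f g"
    using S short_exact_if_split_exact by (auto simp: W_split_def)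
  ultimately show "rel_split G W X Y Z f g"
    by (auto simp: rel_split_def)
qed

text \<open>The unit sequence shows that the chosen suspension sequence exists.\<close>

lemma suspension_spec:
  assumes X: "is_rep G X"
  shows "rel_projective G W (susp_mid (suspension G W X))"
    and "W_split G W X (susp_mid (suspension G W X)) (susp_end (suspension G W X))
      (susp_inj (suspension G W X)) (susp_prj (suspension G W X))"
proof -
  obtain C \<gamma> where C: "W_split G W X (Wend G W X) C (Wunit W X) \<gamma>"
    using unit_sequence [OF X] .
  let ?P = "\<lambda>s. rel_projective G W (susp_mid s) \<and> rel_split G W X (susp_mid s) (susp_end s) (susp_inj s) (susp_prj s)"
  have "?P (Susp_Seq (Wend G W X) C (Wunit W X) \<gamma>)"
    using rel_projective_Wend [OF X] C by (simp add: rel_split_iff_W_split)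
  then have "?P (suspension G W X)"
    unfolding suspension_def by (rule someI [of ?P])
  then show "rel_projective G W (susp_mid (suspension G W X))"
    "W_split G W X (susp_mid (suspension G W X)) (susp_end (suspension G W X))
      (susp_inj (suspension G W X)) (susp_prj (suspension G W X))"
    by (auto simp: rel_split_iff_W_split)
qed

lemma stable_rel_equiv:
  assumes M: "is_rep G M" and N: "is_rep G N"
  shows "equiv (rep_hom G M N) (stable_rel G W M N)"
  unfolding stable_rel_def null_homs_eq_traces [OF M N]
  by (rule equiv_mod_mat [OF _ traces_zero [OF M N W] traces_diff [OF _ _ M N W]])
    (auto dest: rep_hom_carrier)

lemma stable_class_eq_iff:
  assumes "is_rep G M" "is_rep G N" "f \<in> rep_hom G M N" "g \<in> rep_hom G M N"
  shows "stable_class G W M N f = stable_class G W M N g \<longleftrightarrow> f - g \<in> traces G W M N"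
  using eq_equiv_class_iff [OF stable_rel_equiv [OF assms(1,2)] assms(3,4)] assms
  by (simp add: stable_class_def stable_rel_def null_homs_eq_traces)

lemma mem_stable_class_iff:
  assumes "is_rep G M" "is_rep G N"
  shows "g \<in> stable_class G W M N f \<longleftrightarrow> f \<in> rep_hom G M N \<and> g \<in> rep_hom G M N \<and> f - g \<in> traces G W M N"
  using assms by (auto simp: stable_class_def stable_rel_def null_homs_eq_traces)

lemma stable_shift_cat_simps [simp]:
  "Obj (stable_shift_cat G W) = {M. is_rep G M}"
  "Hom (stable_shift_cat G W) M N = rep_hom G M N // stable_rel G W M N"
  "Ident (stable_shift_cat G W) M = stable_class G W M M (1\<^sub>m (deg M))"
  "Zero (stable_shift_cat G W) M N = stable_class G W M N (0\<^sub>m (deg N) (deg M))"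
  "Shift (stable_shift_cat G W) M = susp_end (suspension G W M)"
  by (simp_all add: stable_shift_cat_def)

lemma stable_cat_simps [simp]:
  "Obj (stable_cat G W) = Obj (stable_shift_cat G W)"
  "Hom (stable_cat G W) = Hom (stable_shift_cat G W)"
  "Comp (stable_cat G W) = Comp (stable_shift_cat G W)"
  "Ident (stable_cat G W) = Ident (stable_shift_cat G W)"
  "Zero (stable_cat G W) = Zero (stable_shift_cat G W)"
  "Add (stable_cat G W) = Add (stable_shift_cat G W)"
  "Shift (stable_cat G W) = Shift (stable_shift_cat G W)"
  "Distinguished (stable_cat G W) = {t. is_triangle (stable_shift_cat G W) t \<and>
     (\<exists>t'\<in>standard_triangles G W. triangle_iso (stable_shift_cat G W) t t')}"
  by (simp_all add: stable_cat_def shift_cat.defs triangulated_cat.defs)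

lemma stable_Hom_E:
  assumes "u \<in> Hom (stable_shift_cat G W) M N"
  obtains f where "f \<in> rep_hom G M N" "u = stable_class G W M N f"
  using assms by (auto simp: quotient_def stable_class_def)

lemma stable_Comp:
  assumes L: "is_rep G L" and M: "is_rep G M" and N: "is_rep G N"
    and f: "f \<in> rep_hom G L M" and g: "g \<in> rep_hom G M N"
  shows "Comp (stable_shift_cat G W) L M N (stable_class G W M N g) (stable_class G W L M f) =
    stable_class G W L N (g * f)"
proof -
  have "stable_class G W L N (g' * f') = stable_class G W L N (g * f)"
    if "g' \<in> stable_class G W M N g" "f' \<in> stable_class G W L M f" for g' f'
  proof -
    have g': "g' \<in> rep_hom G M N" "g - g' \<in> traces G W M N" and f': "f' \<in> rep_hom G L M" "f - f' \<in> traces G W L M"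
      using that by (auto simp: mem_stable_class_iff L M N)
    have "(g - g') * f' + g * (f - f') \<in> traces G W L N"
      by (intro traces_add traces_comp_right [OF g'(2) f'(1)] traces_comp_left [OF f'(2) g] L M N W)
    also have "(g - g') * f' + g * (f - f') = g * f - g' * f'"
      using f g f'(1) g'(1) by (intro mat_eqI) (auto simp: mat_diff_left mat_diff_right simp del: index_mult_mat(1))
    finally have "stable_class G W L N (g * f) = stable_class G W L N (g' * f')"
      by (subst stable_class_eq_iff) (auto intro: rep_hom_comp [OF g f L M N] rep_hom_comp [OF g'(1) f'(1) L M N] simp: L N)
    then show ?thesis by simp
  qed
  then have "(\<Union>g'\<in>stable_class G W M N g. \<Union>f'\<in>stable_class G W L M f. stable_class G W L N (g' * f')) =
      (\<Union>g'\<in>stable_class G W M N g. \<Union>f'\<in>stable_class G W L M f. stable_class G W L N (g * f))"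
    by (intro SUP_cong refl)
  moreover have "g \<in> stable_class G W M N g" "f \<in> stable_class G W L M f"
    using f g traces_zero [OF M N W] traces_zero [OF L M W] by (auto simp: mem_stable_class_iff L M N)
  then have "stable_class G W M N g \<noteq> {}" "stable_class G W L M f \<noteq> {}" by auto
  moreover have "Comp (stable_shift_cat G W) L M N (stable_class G W M N g) (stable_class G W L M f) =
      (\<Union>g'\<in>stable_class G W M N g. \<Union>f'\<in>stable_class G W L M f. stable_class G W L N (g' * f'))"
    by (simp add: stable_shift_cat_def)
  ultimately show ?thesis by simp
qed

text \<open>A retraction in the stable category, expressed by representatives.\<close>

lemma stable_retraction:
  assumes M: "is_rep G M" and N: "is_rep G N"
    and "u \<in> Hom (stable_shift_cat G W) M N" "v \<in> Hom (stable_shift_cat G W) N M"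
    and "Comp (stable_shift_cat G W) M N M v u = Ident (stable_shift_cat G W) M"
  obtains a b where "a \<in> rep_hom G M N" "b \<in> rep_hom G N M" "b * a - 1\<^sub>m (deg M) \<in> traces G W M M"
proof -
  obtain a where a: "a \<in> rep_hom G M N" "u = stable_class G W M N a" using assms(3) by (rule stable_Hom_E)
  obtain b where b: "b \<in> rep_hom G N M" "v = stable_class G W N M b" using assms(4) by (rule stable_Hom_E)
  have "stable_class G W M M (b * a) = stable_class G W M M (1\<^sub>m (deg M))"
    using assms(5) stable_Comp [OF M N M a(1) b(1)] a(2) b(2) by simp
  then have "b * a - 1\<^sub>m (deg M) \<in> traces G W M M"
    using stable_class_eq_iff [OF M M rep_hom_comp [OF b(1) a(1) M N M] rep_hom_one [OF M]] by simp
  with a b show thesis by (intro that)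
qed

end

section \<open>Closure properties of virtually projective modules\<close>

context ext_setting
begin

lemma syz_W_split:
  fixes X Y Z :: "('g, 'k) rep"
  assumes "W_split G W X Y Z f g"
  obtains f' g' where "W_split G W (syz n X) (syz n Y) (syz n Z) f' g'"
  using W_split_tensor [OF assms syz_rep [OF is_rep_triv, of n] W]
  unfolding syz_triv [of n X, symmetric] syz_triv [of n Y, symmetric] syz_triv [of n Z, symmetric] by (rule that)

text \<open>Closure under retracts in the \<open>W\<close>-stable category: write \<open>h = h (b a) - h (b a - 1)\<close> after applying \<open>\<Omega>\<^sup>n\<close>.\<close>

lemma virtually_projective_retract:
  assumes X': "virtually_projective G W X'" and X: "is_rep G X"
    and a: "a \<in> rep_hom G X X'" and b: "b \<in> rep_hom G X' X" and ba: "b * a - 1\<^sub>m (deg X) \<in> traces G W X X"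
  shows "virtually_projective G W X"
proof -
  have X'_rep: "is_rep G X'" using X' by (simp add: virtually_projective_def)
  have main: "rep_hom G (syz n X) B \<subseteq> traces G W (syz n X) B"
    if B: "is_rep G B" and v: "rep_hom G (syz n X') B \<subseteq> traces G W (syz n X') B" for n B
  proof
    let ?A = "syz n triv"
    have A: "is_rep G ?A" by (rule syz_rep [OF is_rep_triv])
    note sX = syz_triv [of n X] and sX' = syz_triv [of n X']
    have AX: "is_rep G (tensor ?A X)" "is_rep G (tensor ?A X')" using A X X'_rep by simp_all
    fix h assume h: "h \<in> rep_hom G (syz n X) B"
    then have h: "h \<in> rep_hom G (tensor ?A X) B" using sX by simp
    let ?a = "kron (1\<^sub>m (deg ?A)) a" and ?b = "kron (1\<^sub>m (deg ?A)) b"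
    have a': "?a \<in> rep_hom G (tensor ?A X) (tensor ?A X')" by (rule rep_hom_kron_left [OF a A X X'_rep])
    have b': "?b \<in> rep_hom G (tensor ?A X') (tensor ?A X)" by (rule rep_hom_kron_left [OF b A X'_rep X])
    have "h * ?b \<in> traces G W (tensor ?A X') B"
      using v rep_hom_comp [OF h b' AX(2,1) B] sX' by auto
    then have 1: "h * ?b * ?a \<in> traces G W (tensor ?A X) B"
      by (rule traces_comp_right [OF _ a' AX(2) B AX(1) W])
    have 2: "h * kron (1\<^sub>m (deg ?A)) (b * a - 1\<^sub>m (deg X)) \<in> traces G W (tensor ?A X) B"
      by (rule traces_comp_left [OF traces_tensor [OF ba X X W A] h AX(1,1) B W])
    have "h * kron (1\<^sub>m (deg ?A)) (b * a - 1\<^sub>m (deg X)) = h * (?b * ?a - 1\<^sub>m (deg ?A * deg X))"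
      using a b by (simp add: kron_minus_right kron_mult)
    also have "\<dots> = h * ?b * ?a - h"
      using rep_hom_dim [OF h] a b by (simp add: mat_diff_left mat_assoc)
    finally have "h * ?b * ?a - h * kron (1\<^sub>m (deg ?A)) (b * a - 1\<^sub>m (deg X)) = h"
      using rep_hom_dim [OF h] a b by (auto intro!: mat_eqI simp del: index_mult_mat(1))
    with traces_diff [OF 1 2 AX(1) B W] show "h \<in> traces G W (syz n X) B" using sX by simp
  qed
  show ?thesis
    unfolding virtually_projective_iff
  proof (intro conjI X allI impI)
    fix B :: "('g, 'k) rep" assume B: "is_rep G B"
    then have "\<forall>\<^sub>F n in sequentially. rep_hom G (syz n X') B \<subseteq> traces G W (syz n X') B"
      using X' by (simp add: virtually_projective_iff)
    then show "\<forall>\<^sub>F n in sequentially. rep_hom G (syz n X) B \<subseteq> traces G W (syz n X) B"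
      by (rule eventually_mono) (rule main [OF B])
  qed
qed

lemma virtually_projective_zero: "virtually_projective G W zero_rep"
proof -
  have "h \<in> traces G W (syz n zero_rep) B" if B: "is_rep G B" and h: "h \<in> rep_hom G (syz n zero_rep) B" for n B h
  proof -
    have deg: "deg (syz n zero_rep) = 0" using syz_triv [of n zero_rep] by simp
    have "h = 0\<^sub>m (deg B) (deg (syz n zero_rep))"
      by (rule mat_eqI) (use rep_hom_dim [OF h] deg in auto)
    then show ?thesis using traces_zero [OF syz_rep [OF is_rep_zero] B W] by metis
  qed
  then show ?thesis
    unfolding virtually_projective_iff by (auto intro!: always_eventually)
qed

lemma virtually_projective_rel_projective:
  assumes "rel_projective G W Q"
  shows "virtually_projective G W Q"
proof (rule virtually_projective_retract [OF virtually_projective_zero])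
  show Q: "is_rep G Q" using assms by (simp add: rel_projective_def)
  show "0\<^sub>m 0 (deg Q) \<in> rep_hom G Q zero_rep" "0\<^sub>m (deg Q) 0 \<in> rep_hom G zero_rep Q"
    using rep_hom_zero [OF Q is_rep_zero] rep_hom_zero [OF is_rep_zero Q] by simp_all
  have "0\<^sub>m (deg Q) (deg Q) - 1\<^sub>m (deg Q) \<in> traces G W Q Q"
    by (rule traces_diff [OF traces_zero rel_projective_one_traces [OF assms]]) (use Q W in auto)
  then show "0\<^sub>m (deg Q) 0 * 0\<^sub>m 0 (deg Q) - 1\<^sub>m (deg Q) \<in> traces G W Q Q" by simp
qed

lemma virtually_projective_two_of_three:
  assumes S: "W_split G W X Y Z f g"
  shows "virtually_projective G W X \<Longrightarrow> virtually_projective G W Z \<Longrightarrow> virtually_projective G W Y"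
    and "virtually_projective G W X \<Longrightarrow> virtually_projective G W Y \<Longrightarrow> virtually_projective G W Z"
    and "virtually_projective G W Y \<Longrightarrow> virtually_projective G W Z \<Longrightarrow> virtually_projective G W X"
proof -
  note D = W_splitD [OF S]
  have ev: "\<forall>\<^sub>F n in sequentially. rep_hom G (syz n V) B \<subseteq> traces G W (syz n V) B"
    if "virtually_projective G W V" "is_rep G B" for V B
    using that by (simp add: virtually_projective_iff)
  show "virtually_projective G W Y" if X: "virtually_projective G W X" and Z: "virtually_projective G W Z"
    unfolding virtually_projective_iff
  proof (intro conjI allI impI)
    fix B :: "('g, 'k) rep" assume B: "is_rep G B"
    from ev [OF X B] ev [OF Z B] show "\<forall>\<^sub>F n in sequentially. rep_hom G (syz n Y) B \<subseteq> traces G W (syz n Y) B"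
    proof eventually_elim
      case (elim n)
      obtain f' g' where "W_split G W (syz n X) (syz n Y) (syz n Z) f' g'" using syz_W_split [OF S] .
      from vanishing_middle [OF this B elim] show ?case .
    qed
  qed (rule D)
  show "virtually_projective G W Z" if X: "virtually_projective G W X" and Y: "virtually_projective G W Y"
    unfolding virtually_projective_iff
  proof (intro conjI allI impI)
    fix B :: "('g, 'k) rep" assume B: "is_rep G B"
    obtain K \<kappa> p s where K: "split_exact G K (Wend G W B) B \<kappa> (Wcounit W B) p s"
      using counit_sequence [OF B] .
    from ev [OF X split_exactD(1) [OF K]] ev [OF Y B]
    show "\<forall>\<^sub>F n in sequentially. rep_hom G (syz n Z) B \<subseteq> traces G W (syz n Z) B"
    proof eventually_elim
      case (elim n)
      obtain f' g' where "W_split G W (syz n X) (syz n Y) (syz n Z) f' g'" using syz_W_split [OF S] .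
      from vanishing_right [OF this B K elim] show ?case .
    qed
  qed (rule D)
  show "virtually_projective G W X" if Y: "virtually_projective G W Y" and Z: "virtually_projective G W Z"
    unfolding virtually_projective_iff
  proof (intro conjI allI impI)
    fix B :: "('g, 'k) rep" assume B: "is_rep G B"
    obtain C \<gamma> where C: "W_split G W B (Wend G W B) C (Wunit W B) \<gamma>"
      using unit_sequence [OF B] .
    from ev [OF Y B] ev [OF Z W_splitD(3) [OF C]]
    show "\<forall>\<^sub>F n in sequentially. rep_hom G (syz n X) B \<subseteq> traces G W (syz n X) B"
    proof eventually_elim
      case (elim n)
      obtain f' g' where "W_split G W (syz n X) (syz n Y) (syz n Z) f' g'" using syz_W_split [OF S] .
      from vanishing_left [OF this B C elim] show ?case .
    qed
  qed (rule D)
qed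

lemma virtually_projective_stable_iso:
  assumes "is_rep G X" "is_rep G Y" "is_iso (stable_shift_cat G W) X Y u"
  shows "virtually_projective G W X \<longleftrightarrow> virtually_projective G W Y"
proof -
  obtain v where v: "u \<in> Hom (stable_shift_cat G W) X Y" "v \<in> Hom (stable_shift_cat G W) Y X"
    "Comp (stable_shift_cat G W) X Y X v u = Ident (stable_shift_cat G W) X"
    "Comp (stable_shift_cat G W) Y X Y u v = Ident (stable_shift_cat G W) Y"
    using assms(3) unfolding is_iso_def inverse_mors_def by blast
  show ?thesis
    using stable_retraction [OF assms(1,2) v(1,2,3)] stable_retraction [OF assms(2,1) v(2,1,4)]
      virtually_projective_retract assms(1,2) by metis
qed

lemma virtually_projective_suspension:
  assumes "is_rep G X"
  shows "virtually_projective G W X \<longleftrightarrow> virtually_projective G W (susp_end (suspension G W X))"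
  using virtually_projective_two_of_three(2,3) [OF suspension_spec(2) [OF assms]]
    virtually_projective_rel_projective [OF suspension_spec(1) [OF assms]] by blast

text \<open>A distinguished triangle is, up to stable isomorphism of its vertices, a \<open>W\<close>-split sequence.\<close>

lemma virtually_projective_triangle:
  assumes "Triangle X Y Z u v w \<in> Distinguished (stable_cat G W)"
  obtains X' Y' Z' f g where "W_split G W X' Y' Z' f g"
    "virtually_projective G W X \<longleftrightarrow> virtually_projective G W X'"
    "virtually_projective G W Y \<longleftrightarrow> virtually_projective G W Y'"
    "virtually_projective G W Z \<longleftrightarrow> virtually_projective G W Z'"
proof -
  have XYZ: "is_rep G X" "is_rep G Y" "is_rep G Z"
    and "\<exists>t'\<in>standard_triangles G W. triangle_iso (stable_shift_cat G W) (Triangle X Y Z u v w) t'"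
    using assms by auto
  then obtain t' where t': "t' \<in> standard_triangles G W" "triangle_iso (stable_shift_cat G W) (Triangle X Y Z u v w) t'"
    by blast
  then obtain X' Y' Z' f g u' v' w' where s: "t' = Triangle X' Y' Z' u' v' w'" "rel_split G W X' Y' Z' f g"
    unfolding standard_triangles_def by blast
  obtain a b c where iso: "is_iso (stable_shift_cat G W) X X' a" "is_iso (stable_shift_cat G W) Y Y' b"
    "is_iso (stable_shift_cat G W) Z Z' c"
    using t'(2) unfolding s(1) triangle_iso.simps by blast
  have S: "W_split G W X' Y' Z' f g" using s(2) by (simp add: rel_split_iff_W_split)
  show thesis
    by (rule that [OF S]; rule virtually_projective_stable_iso)
      (use XYZ iso W_splitD [OF S] in auto)
qed

lemma virtually_projective_thick:
  "thick_subcategory (stable_cat G W) {X. virtually_projective G W X}"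
  unfolding thick_subcategory_def triangulated_subcategory_def
proof (intro conjI allI ballI impI)
  let ?C = "stable_shift_cat G W"
  have obj: "is_rep G X" if "virtually_projective G W X" for X
    using that by (simp add: virtually_projective_def)
  show "{X. virtually_projective G W X} \<subseteq> Obj (stable_cat G W)"
    using obj by auto
  have "1\<^sub>m 0 = (0\<^sub>m 0 0 :: 'k mat)" by (rule mat_eqI) auto
  then have "Ident (stable_cat G W) zero_rep = Zero (stable_cat G W) zero_rep zero_rep" by simp
  then show "\<exists>X\<in>{X. virtually_projective G W X}. Ident (stable_cat G W) X = Zero (stable_cat G W) X X"
    using virtually_projective_zero by blast
  fix X assume "X \<in> Obj (stable_cat G W)"
  then show "X \<in> {X. virtually_projective G W X} \<longleftrightarrow> Shift (stable_cat G W) X \<in> {X. virtually_projective G W X}"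
    using virtually_projective_suspension [of X] by simp
next
  fix X Y assume X: "X \<in> {X. virtually_projective G W X}" and Y: "Y \<in> Obj (stable_cat G W)"
    and iso: "\<exists>u. is_iso (stable_cat G W) X Y u"
  have "is_iso (stable_cat G W) X Y u = is_iso (stable_shift_cat G W) X Y u" for u
    by (simp add: is_iso_def inverse_mors_def)
  moreover have "is_rep G X" using X by (simp add: virtually_projective_def)
  ultimately show "Y \<in> {X. virtually_projective G W X}"
    using X Y iso virtually_projective_stable_iso [of X Y] by auto
next
  fix X Y Z u v w assume T: "Triangle X Y Z u v w \<in> Distinguished (stable_cat G W)"
  then obtain X' Y' Z' f g where S: "W_split G W X' Y' Z' f g"
    and iff: "virtually_projective G W X \<longleftrightarrow> virtually_projective G W X'"
    "virtually_projective G W Y \<longleftrightarrow> virtually_projective G W Y'"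
    "virtually_projective G W Z \<longleftrightarrow> virtually_projective G W Z'"
    by (rule virtually_projective_triangle)
  note two = virtually_projective_two_of_three [OF S, folded iff]
  show "X \<in> {X. virtually_projective G W X} \<and> Y \<in> {X. virtually_projective G W X} \<Longrightarrow> Z \<in> {X. virtually_projective G W X}"
    "Y \<in> {X. virtually_projective G W X} \<and> Z \<in> {X. virtually_projective G W X} \<Longrightarrow> X \<in> {X. virtually_projective G W X}"
    "X \<in> {X. virtually_projective G W X} \<and> Z \<in> {X. virtually_projective G W X} \<Longrightarrow> Y \<in> {X. virtually_projective G W X}"
    using two by auto
next
  fix X A assume X: "X \<in> {X. virtually_projective G W X}" and A: "A \<in> Obj (stable_cat G W)"
    and "direct_summand (stable_cat G W) A X"
  then obtain i p where ip: "i \<in> Hom (stable_shift_cat G W) A X" "p \<in> Hom (stable_shift_cat G W) X A"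
    "Comp (stable_shift_cat G W) A X A p i = Ident (stable_shift_cat G W) A"
    unfolding direct_summand_def stable_cat_simps by blast
  have "is_rep G X" "is_rep G A" using X A by (auto simp: virtually_projective_def)
  then obtain a b where "a \<in> rep_hom G A X" "b \<in> rep_hom G X A" "b * a - 1\<^sub>m (deg A) \<in> traces G W A A"
    using stable_retraction [of A X i p] ip by blast
  then show "A \<in> {X. virtually_projective G W X}"
    using virtually_projective_retract [of X A a b] X \<open>is_rep G A\<close> by simp
qed

end

theorem corollary4p5:
  fixes G :: "('g, 'b) monoid_scheme" and W :: "('g, 'k::field) rep"
  assumes "group G" and "finite (carrier G)"
    and "CHAR('k) dvd order G"
    and "is_rep G W" and "deg W \<noteq> 0"
  shows "thick_subcategory (stable_cat G W) {X. virtually_projective G W X}"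
proof -
  obtain F I :: "('g, 'k) rep" and j \<epsilon> q t where "augmentation G F I j \<epsilon> q t"
    using augmentation_exists [OF assms(1,2)] .
  then interpret ext_setting G F I j \<epsilon> q t W
    using assms by (simp add: ext_setting_def rel_setting_def rel_setting_axioms_def)
  show ?thesis by (rule virtually_projective_thick)
qed

end
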